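(* Let $X$ and $Y$ be separable, reflexive Banach spaces such that, for some $C\ge 1$ and some non-decreasing $K:\mathbb N\to\mathbb N$, the value $(K,C)\text{-}ld(X^*,Y^* )(n)$ is finite for every $n$, and let $T\in L(X)$ be compact. Choose a sequence $(m_k)_{k=0}^\infty$ of natural numbers such that $m_0=2$ and $m_k\ge K(4m_{k-1}+2)+1$ for $k\in\mathbb N$. Assume that for some constants $0\le\alpha<1/4$, $0\le\beta<1/4$ and $C'>0$ the spaces $X$ and $Y$ have property (D) with functions $f_X$, $f_Y$ (and constants $d(X),D(X)$, respectively $d(Y),D(Y)$) such that for all $k\in\mathbb N$ $$f_X(n)\le C'(a_{m_{k-1}}(T))^{-\alpha}\quad\text{and}\quad f_Y(n)\le C'(a_{m_{k-1}}(T))^{-\beta}\qquad\text{for } n\le m_{k+1},$$ and assume that for all $k\in\mathbb N$ $$(K,C)\text{-}ld(X^*,Y^* )(4m_{k+1})\le C'\,k^{-3/4}\,\Gamma(k+2)^{-5}\,a_{m_k}(T)^{(-1+4\max\{\alpha,\beta\})/4},$$ where $\Gamma(k):=(4D(C+3))^{(k+1)d^k}$, $d=\max\{d(X),d(Y),1\}$ and $D=\max\{D(X),D(Y)\}$. Then $T=T^{(2)}T^{(1)}$, where $T^{(1)}\in L(X,Y)$, $T^{(2)}\in L(Y,X)$ and $T^{(1)}(X)$ is dense in $Y$. Moreover, both $T^{(1)}$ and $T^{(2)}$ are compact.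
   Context: $\mathbb N=\{1,2,3,\dots\}$; Banach spaces are over $\mathbb R$ or $\mathbb C$; $L(X,Y)$ denotes the bounded linear operators and $L(X)=L(X,X)$. $d(M,N)=\inf\{\|\psi\|\|\psi^{-1}\| : \psi:M\to N\text{ isomorphism}\}$ is the Banach--Mazur distance. A subspace $N$ of a Banach space $X$ is $c$-complemented if there is a projection $P$ from $X$ onto $N$ with $\|P\|\le c$. Approximation numbers: $a_n(T)=\inf\{\|T-T_n\| : T_n\in L(X,Y),\ \operatorname{rank}T_n<n\}$ for compact $T\in L(X,Y)$. When $a_n(T)=0$, we read $0^{-s}=+\infty$ for $s>0$ and $0^{0}=1$. Uniform local distance function: for Banach spaces $X,Y$, $C\ge1$ and non-decreasing $K:\mathbb N\to\mathbb N$, $(K,C)\text{-}ld(X,Y)(n)\in\mathbb R^+\cup\{\infty\}$ is the infimum of $\infty$ and all numbers $r\in\mathbb R^+$ such that: whenever $M\subset X$, $M_Y\subset Y$ are subspaces of dimension at most $n$, there exist $C$-complemented subspaces $N\subset X$, $N_Y\subset Y$ with $M\subset N$, $M_Y\subset N_Y$, $\dim N=\dim N_Y\le K(n)$ and $d(N,N_Y)\le r$. Property (D): a Banach space $X$ has property (D) with a non-decreasing function $f_X:\mathbb N\to\mathbb R^+$ if there exist constants $d(X)\ge 0$ and $D(X)>0$ such that for each $n$-dimensional $c$-complemented subspace $M\subset X$ and each projection $P$ from $X$ onto $M$ with $\|P\|\le c$ there exist an $n$-dimensional subspace $N\subset X$ and a projection $Q$ from $X$ onto $N$ such that (1) $M\cap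 N=\{0\}$; (2) $\|Q\|\le D(X)c^{d(X)}$; (3) $PQ=QP=0$; (4) $d(M,N)\le f_X(n)$. *)

theory Defs
  imports "HOL-Analysis.Analysis"
begin

text \<open>
  Scalars: a type of class \<open>real_or_complex\<close> is isometrically isomorphic, as a normed field,
  to the reals or to the complex numbers.
\<close>

class real_or_complex = real_normed_field +
  assumes real_or_complex:
    "(\<forall>z. \<exists>a. z = a *\<^sub>R 1) \<or>
     (\<exists>i. i * i = - 1 \<and>
        (\<forall>z. \<exists>a b. z = a *\<^sub>R 1 + b *\<^sub>R i \<and> norm z = sqrt (a\<^sup>2 + b\<^sup>2)))"

instance real :: real_or_complex
  by standard auto

instance complex :: real_or_complex
proof
  have "\<forall>z. \<exists>a b. z = a *\<^sub>R 1 + b *\<^sub>R \<i> \<and> norm z = sqrt (a\<^sup>2 + b\<^sup>2)"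
  proof
    fix z :: complex
    have "z = Re z *\<^sub>R 1 + Im z *\<^sub>R \<i>"
      by (simp add: complex_eq_iff)
    then show "\<exists>a b. z = a *\<^sub>R 1 + b *\<^sub>R \<i> \<and> norm z = sqrt (a\<^sup>2 + b\<^sup>2)"
      using norm_complex_def by blast
  qed
  then show "(\<forall>z::complex. \<exists>a. z = a *\<^sub>R 1) \<or>
     (\<exists>i::complex. i * i = - 1 \<and>
        (\<forall>z. \<exists>a b. z = a *\<^sub>R 1 + b *\<^sub>R i \<and> norm z = sqrt (a\<^sup>2 + b\<^sup>2)))"
    by (intro disjI2 exI[of _ \<i>]) simp
qed

text \<open>
  A Banach space over \<open>'k\<close> is a type of class \<open>banach\<close> together with a multiplication by scalars
  from \<open>'k\<close> that extends the multiplication by reals. Linearity, subspaces and dimensions below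
  are always meant over \<open>'k\<close>, so the scalar multiplications \<open>s\<close>, \<open>t\<close> are explicit parameters.
\<close>

locale banach_over = vector_space s
  for s :: "'k::real_or_complex \<Rightarrow> 'a::banach \<Rightarrow> 'a" +
  assumes scale_of_real: "s (of_real r) x = r *\<^sub>R x"
    and norm_scale: "norm (s c x) = norm c * norm x"

lemma banach_over_scaleR: "banach_over (scaleR :: real \<Rightarrow> 'a::banach \<Rightarrow> 'a)"
  by unfold_locales (auto simp: algebra_simps)

lemma banach_over_complex: "banach_over ((*) :: complex \<Rightarrow> complex \<Rightarrow> complex)"
  by unfold_locales (auto simp: algebra_simps norm_mult scaleR_conv_of_real)

text \<open>
  \<open>L s t\<close> is the space of bounded operators that are linear over \<open>'k\<close>; the elements of
  \<open>'a \<Rightarrow>\<^sub>L 'b\<close> themselves are only linear over the reals. The norm of the latter type is the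
  operator norm.
\<close>

definition L :: "('k \<Rightarrow> 'a \<Rightarrow> 'a) \<Rightarrow> ('k \<Rightarrow> 'b \<Rightarrow> 'b)
    \<Rightarrow> ('a::real_normed_vector \<Rightarrow>\<^sub>L 'b::real_normed_vector) set" where
  "L s t = {T. \<forall>c x. blinfun_apply T (s c x) = t c (blinfun_apply T x)}"

text \<open>The dual space, a closed subspace of \<open>'a \<Rightarrow>\<^sub>L 'k\<close>, and its scalar multiplication.\<close>

definition dual :: "('k::real_or_complex \<Rightarrow> 'a \<Rightarrow> 'a) \<Rightarrow> ('a::real_normed_vector \<Rightarrow>\<^sub>L 'k) set" where
  "dual s = L s (*)"

definition dual_scale :: "'k::real_or_complex \<Rightarrow> ('a::real_normed_vector \<Rightarrow>\<^sub>L 'k) \<Rightarrow> ('a \<Rightarrow>\<^sub>L 'k)" where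
  "dual_scale c \<phi> = blinfun_mult_right c o\<^sub>L \<phi>"

lemma dual_scale_apply [simp]: "blinfun_apply (dual_scale c \<phi>) x = c * \<phi> x"
  by (simp add: dual_scale_def)

lemma vector_space_dual_scale: "vector_space dual_scale"
  by unfold_locales (auto intro!: blinfun_eqI simp: blinfun.bilinear_simps algebra_simps)

lemma subspace_dual: "module.subspace dual_scale (dual s)"
proof -
  interpret vector_space dual_scale
    by (rule vector_space_dual_scale)
  show ?thesis
    by (auto simp: subspace_def dual_def L_def blinfun.bilinear_simps algebra_simps)
qed

text \<open>
  Since the dual is a set and not a type, the following notions are relative to a subspace \<open>S\<close>
  of the ambient type, and maps are only considered on \<open>S\<close>. \<open>onorm_on S f\<close> is the operator
  norm of \<open>f\<close> restricted to \<open>S\<close>, in the form of the library constant \<open>onorm\<close>.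
\<close>

definition bounded_linear_on :: "('k \<Rightarrow> 'a \<Rightarrow> 'a) \<Rightarrow> ('k \<Rightarrow> 'b \<Rightarrow> 'b) \<Rightarrow> 'a set
    \<Rightarrow> ('a::real_normed_vector \<Rightarrow> 'b::real_normed_vector) \<Rightarrow> bool" where
  "bounded_linear_on s t S f \<longleftrightarrow>
     (\<forall>x\<in>S. \<forall>y\<in>S. f (x + y) = f x + f y) \<and>
     (\<forall>c. \<forall>x\<in>S. f (s c x) = t c (f x)) \<and>
     (\<exists>B. \<forall>x\<in>S. norm (f x) \<le> B * norm x)"

definition onorm_on :: "'a set \<Rightarrow> ('a::real_normed_vector \<Rightarrow> 'b::real_normed_vector) \<Rightarrow> real" where
  "onorm_on S f = (SUP x\<in>S. norm (f x) / norm x)"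

text \<open>Finite dimensionality is explicit because \<open>vector_space.dim\<close> is 0 in infinite dimension.\<close>

definition fin_dim_subspace :: "('k::field \<Rightarrow> 'a \<Rightarrow> 'a) \<Rightarrow> 'a::ab_group_add set \<Rightarrow> bool" where
  "fin_dim_subspace s M \<longleftrightarrow>
     module.subspace s M \<and> (\<exists>B. finite B \<and> module.span s B = M)"

definition projection_onto :: "('k \<Rightarrow> 'a \<Rightarrow> 'a) \<Rightarrow> 'a set \<Rightarrow> 'a set
    \<Rightarrow> ('a::real_normed_vector \<Rightarrow> 'a) \<Rightarrow> bool" where
  "projection_onto s S N P \<longleftrightarrow>
     bounded_linear_on s s S P \<and> P ` S = N \<and> (\<forall>x\<in>S. P (P x) = P x)"

definition complemented :: "('k::field \<Rightarrow> 'a \<Rightarrow> 'a) \<Rightarrow> 'a set \<Rightarrow> real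
    \<Rightarrow> 'a::real_normed_vector set \<Rightarrow> bool" where
  "complemented s S c N \<longleftrightarrow>
     module.subspace s N \<and> N \<subseteq> S \<and> (\<exists>P. projection_onto s S N P \<and> onorm_on S P \<le> c)"

definition isomorphism_on :: "('k \<Rightarrow> 'a \<Rightarrow> 'a) \<Rightarrow> ('k \<Rightarrow> 'b \<Rightarrow> 'b) \<Rightarrow> 'a set \<Rightarrow> 'b set
    \<Rightarrow> ('a::real_normed_vector \<Rightarrow> 'b::real_normed_vector) \<Rightarrow> bool" where
  "isomorphism_on s t M N \<psi> \<longleftrightarrow>
     bij_betw \<psi> M N \<and> bounded_linear_on s t M \<psi> \<and> bounded_linear_on t s N (inv_into M \<psi>)"

text \<open>The Banach--Mazur distance; it is infinite for non-isomorphic spaces.\<close>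

definition bm_dist :: "('k \<Rightarrow> 'a \<Rightarrow> 'a) \<Rightarrow> ('k \<Rightarrow> 'b \<Rightarrow> 'b)
    \<Rightarrow> 'a::real_normed_vector set \<Rightarrow> 'b::real_normed_vector set \<Rightarrow> ennreal" where
  "bm_dist s t M N =
     (INF \<psi>\<in>{\<psi>. isomorphism_on s t M N \<psi>}. ennreal (onorm_on M \<psi> * onorm_on N (inv_into M \<psi>)))"

text \<open>The canonical embedding into the bidual is onto.\<close>

definition reflexive :: "('k::real_or_complex \<Rightarrow> 'a \<Rightarrow> 'a::real_normed_vector) \<Rightarrow> bool" where
  "reflexive s \<longleftrightarrow>
     (\<forall>F. bounded_linear_on dual_scale (*) (dual s) F \<longrightarrow> (\<exists>x. \<forall>\<phi>\<in>dual s. F \<phi> = blinfun_apply \<phi> x))"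

definition compact_operator :: "('a::real_normed_vector \<Rightarrow>\<^sub>L 'b::real_normed_vector) \<Rightarrow> bool" where
  "compact_operator T \<longleftrightarrow> compact (closure (blinfun_apply T ` cball 0 1))"

definition approx_number :: "('k::field \<Rightarrow> 'a \<Rightarrow> 'a) \<Rightarrow> ('k \<Rightarrow> 'b \<Rightarrow> 'b)
    \<Rightarrow> ('a::real_normed_vector \<Rightarrow>\<^sub>L 'b::real_normed_vector) \<Rightarrow> nat \<Rightarrow> real" where
  "approx_number s t T n =
     Inf {norm (T - A) | A. A \<in> L s t \<and> fin_dim_subspace t (range (blinfun_apply A)) \<and>
                            vector_space.dim t (range (blinfun_apply A)) < n}"

text \<open>
  \<open>neg_pow a p\<close> is the \<open>-p\<close>-th power of \<open>a \<ge> 0\<close> for \<open>p \<ge> 0\<close>, with the convention for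
  \<open>a = 0\<close> used in the theorem (note that \<open>0 powr p = 0\<close> for all \<open>p\<close> in the library).
\<close>

definition neg_pow :: "real \<Rightarrow> real \<Rightarrow> ennreal" where
  "neg_pow a p = (if a = 0 then (if p = 0 then 1 else \<infinity>) else ennreal (a powr (- p)))"

text \<open>
  The positive integers are represented by \<open>nat\<close>, with the argument \<open>0\<close> left unconstrained.
\<close>

definition local_dist :: "(nat \<Rightarrow> nat) \<Rightarrow> real
    \<Rightarrow> ('k::field \<Rightarrow> 'a \<Rightarrow> 'a) \<Rightarrow> 'a::real_normed_vector set
    \<Rightarrow> ('k \<Rightarrow> 'b \<Rightarrow> 'b) \<Rightarrow> 'b::real_normed_vector set \<Rightarrow> nat \<Rightarrow> ennreal" where
  "local_dist K C s S t S' n =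
     Inf {ennreal r | r. 0 < r \<and>
       (\<forall>M M'. M \<subseteq> S \<and> fin_dim_subspace s M \<and> vector_space.dim s M \<le> n \<and>
               M' \<subseteq> S' \<and> fin_dim_subspace t M' \<and> vector_space.dim t M' \<le> n \<longrightarrow>
          (\<exists>N N'. complemented s S C N \<and> fin_dim_subspace s N \<and> M \<subseteq> N \<and>
                  complemented t S' C N' \<and> fin_dim_subspace t N' \<and> M' \<subseteq> N' \<and>
                  vector_space.dim s N = vector_space.dim t N' \<and>
                  vector_space.dim t N' \<le> K n \<and>
                  bm_dist s t N N' \<le> ennreal r))}"

definition property_D :: "('k::field \<Rightarrow> 'a \<Rightarrow> 'a::real_normed_vector)
    \<Rightarrow> (nat \<Rightarrow> real) \<Rightarrow> real \<Rightarrow> real \<Rightarrow> bool" where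
  "property_D s f d D \<longleftrightarrow>
     mono_on {1..} f \<and> (\<forall>n\<ge>1. 0 < f n) \<and> 0 \<le> d \<and> 0 < D \<and>
     (\<forall>n\<ge>1. \<forall>c (M :: 'a set) P.
        fin_dim_subspace s M \<and> vector_space.dim s M = n \<and> complemented s UNIV c M \<and>
        projection_onto s UNIV M P \<and> onorm_on UNIV P \<le> c \<longrightarrow>
        (\<exists>N Q. fin_dim_subspace s N \<and> vector_space.dim s N = n \<and> projection_onto s UNIV N Q \<and>
           M \<inter> N = {0} \<and>
           onorm_on UNIV Q \<le> D * c powr d \<and>
           (\<forall>x. P (Q x) = 0 \<and> Q (P x) = 0) \<and>
           bm_dist s s M N \<le> ennreal (f n)))"

definition Gamma_fac :: "real \<Rightarrow> real \<Rightarrow> real \<Rightarrow> nat \<Rightarrow> real" where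
  "Gamma_fac d D C k = (4 * D * (C + 3)) powr (real (k + 1) * d ^ k)"

end

theory Submission
  imports Defs
begin

text \<open>
  The operator \<open>T\<close> is cut into pieces by projections of finite rank. Let
  \<open>P\<^sub>0 = 0, P\<^sub>1, P\<^sub>2, \<dots>\<close> be commuting projections on \<open>X\<close> with increasing ranges such that
  \<open>T P\<^sub>k\<close> tends to \<open>T\<close>, and let \<open>\<Delta>\<^sub>k = P\<^sub>k\<^sub>+\<^sub>1 - P\<^sub>k\<close>. Suppose that there are operators
  \<open>A\<^sub>k : X \<rightarrow> Y\<close> and \<open>B\<^sub>k : Y \<rightarrow> X\<close> with \<open>B\<^sub>k A\<^sub>k \<Delta>\<^sub>k = \<Delta>\<^sub>k\<close> and \<open>B\<^sub>j A\<^sub>k = 0\<close> for \<open>j \<noteq> k\<close>. Then the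
  series \<open>T\<^sub>1 = \<Sum> \<mu>\<^sub>k A\<^sub>k \<Delta>\<^sub>k\<close> and \<open>T\<^sub>2 = \<Sum> \<mu>\<^sub>k\<^sup>-\<^sup>1 T \<Delta>\<^sub>k B\<^sub>k\<close> have the composition
  \<open>T\<^sub>2 T\<^sub>1 = \<Sum> T \<Delta>\<^sub>k = T\<close>. If \<open>\<parallel>A\<^sub>k\<parallel> \<parallel>B\<^sub>k\<parallel> \<parallel>T \<Delta>\<^sub>k\<parallel>\<close> decreases fast enough, scalars \<open>\<mu>\<^sub>k\<close> exist for which
  both series converge in norm, and then the two sums are compact.

  The data are built by recursion, together with commuting projections \<open>Q\<^sub>k\<close> on \<open>Y\<close> such that
  \<open>A\<^sub>k\<close> and \<open>B\<^sub>k\<close> live on the range of \<open>Q\<^sub>k\<^sub>+\<^sub>1 - Q\<^sub>k\<close>; this gives the orthogonality. Finiteness of the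
  local distance of the duals provides \<open>U : X \<rightarrow> Y\<close> and \<open>V : Y \<rightarrow> X\<close> for which \<open>V U\<close> and \<open>U V\<close> are
  projections of norm at most \<open>C\<close> whose adjoints fix prescribed functionals
  (\<open>local_dist_operators\<close>). Prescribing the functionals that factor through \<open>P\<^sub>k\<close> lets the new
  projection be made to commute with \<open>P\<^sub>k\<close>; prescribing those that factor through an approximation
  \<open>S\<close> of \<open>T\<close> of finite rank gives \<open>T (1 - P\<^sub>k) = (T - S) (1 - P\<^sub>k)\<close>, so that \<open>\<parallel>T \<Delta>\<^sub>k\<parallel>\<close> is controlled
  by the approximation number \<open>a\<^bsub>m\<^sub>k\<^esub>\<close>. The range of \<open>U V\<close> is not orthogonal to the previous
  \<open>Q\<^sub>k\<close>, and here property (D) of \<open>Y\<close> enters: it moves everything to an isomorphic copy that is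
  orthogonal (\<open>property_D_operators\<close>, \<open>factorization_step\<close>). The norms of the \<open>Q\<^sub>k\<close> are at most
  \<open>\<Gamma>(k)\<close>, and \<open>\<parallel>A\<^sub>k\<parallel> \<parallel>B\<^sub>k\<parallel>\<close> is at most a constant times the product of \<open>f\<^sub>Y\<close>, the local distance and
  \<open>\<Gamma>(k + 1)\<^sup>2\<close>. By hypothesis this is outweighed by \<open>a\<^bsub>m\<^sub>k\<^esub>\<close>.

  The operator \<open>T\<^sub>1\<close> need not have dense range, but \<open>T\<^sub>1 X + ker T\<^sub>2\<close> is dense in \<open>Y\<close>: each step also
  puts one member of a dense sequence of \<open>Y\<close> into the range of \<open>Q\<^sub>k\<^sub>+\<^sub>1\<close>, and a vector \<open>y\<close> in the range
  of \<open>Q\<^sub>n\<close> differs from \<open>\<Sum>\<^bsub>k < n\<^esub> A\<^sub>k \<Delta>\<^sub>k B\<^sub>k y\<close> by a vector in the kernel of \<open>T\<^sub>2\<close>. Adding to \<open>T\<^sub>1\<close> an operator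
  with values in this kernel does not change \<open>T\<^sub>2 T\<^sub>1\<close>. A compact one that makes the range dense is
  \<open>\<Sum> \<epsilon>\<^sub>k \<psi>\<^sub>k \<otimes> z\<^sub>k\<close>, where the \<open>z\<^sub>k\<close> recur densely in the unit ball of the kernel and the \<open>\<psi>\<^sub>k\<close> are
  biorthogonal to unit vectors \<open>x\<^sub>k\<close> in the range of \<open>\<Delta>\<^sub>k\<close>: the new operator maps \<open>x\<^sub>k / \<epsilon>\<^sub>k\<close> to
  \<open>z\<^sub>k\<close> up to the error \<open>T\<^sub>1 x\<^sub>k / \<epsilon>\<^sub>k\<close>, which tends to zero (\<open>dense_compact_factorization\<close>).
\<close>

section \<open>Norming functionals\<close>

definition sublinear :: "('a::real_vector \<Rightarrow> real) \<Rightarrow> bool" where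
  "sublinear p \<longleftrightarrow>
     (\<forall>x y. p (x + y) \<le> p x + p y) \<and> (\<forall>r x. 0 \<le> r \<longrightarrow> p (r *\<^sub>R x) = r * p x)"

lemma sublinearD:
  assumes "sublinear p"
  shows "p (x + y) \<le> p x + p y" and "0 \<le> r \<Longrightarrow> p (r *\<^sub>R x) = r * p x" and "p 0 = 0"
    and "- p (- x) \<le> p x"
proof -
  show *: "p (x + y) \<le> p x + p y" for x y
    using assms by (auto simp: sublinear_def)
  show "0 \<le> r \<Longrightarrow> p (r *\<^sub>R x) = r * p x"
    using assms by (auto simp: sublinear_def)
  have "p (0 *\<^sub>R 0) = 0 * p 0"
    using assms unfolding sublinear_def by blast
  then show "p 0 = 0"
    by simp
  with *[of x "- x"] show "- p (- x) \<le> p x"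
    by simp
qed

lemma sublinearI:
  assumes add: "\<And>x y. p (x + y) \<le> p x + p y"
    and scale: "\<And>r x. 0 < r \<Longrightarrow> p (r *\<^sub>R x) \<le> r * p x"
    and zero: "p 0 = 0"
  shows "sublinear p"
proof -
  have "p (r *\<^sub>R x) = r * p x" if "0 \<le> r" for r x
  proof (cases "r = 0")
    case True
    then show ?thesis
      by (simp add: zero)
  next
    case False
    with that have r: "0 < r"
      by simp
    have "p ((1 / r) *\<^sub>R (r *\<^sub>R x)) \<le> (1 / r) * p (r *\<^sub>R x)"
      using r by (intro scale) simp
    then have "r * p x \<le> p (r *\<^sub>R x)"
      using r by (simp add: field_simps)
    then show ?thesis
      using scale[OF r, of x] by simp
  qed
  with add show ?thesis
    by (auto simp: sublinear_def)
qed

text \<open>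
  The infimum over \<open>u \<ge> 0\<close> of \<open>p (x + u z) - u p z\<close> does it. The tilt is used twice: a minimal
  sublinear functional has to agree with all its tilts, which makes it linear; and a linear functional
  below the tilt of the norm in the direction \<open>z\<close> attains its norm at \<open>z\<close>.
\<close>

lemma sublinear_tilt:
  assumes p: "sublinear p"
  obtains q where "sublinear q" "\<And>x. q x \<le> p x" "q (- z) \<le> - p z"
proof -
  define g where "g x u = p (x + u *\<^sub>R z) - u * p z" for x u
  define q where "q x = (INF u\<in>{0..}. g x u)" for x
  have lower: "- p (- x) \<le> g x u" if "0 \<le> u" for x u
  proof -
    have "u * p z = p ((x + u *\<^sub>R z) + (- x))"
      using sublinearD(2)[OF p that, of z] by simp
    also have "\<dots> \<le> p (x + u *\<^sub>R z) + p (- x)"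
      by (rule sublinearD(1)[OF p])
    finally show ?thesis
      by (simp add: g_def)
  qed
  then have bdd: "bdd_below (g x ` {0..})" for x
    by (auto intro!: bdd_belowI)
  have q_le: "q x \<le> g x u" if "0 \<le> u" for x u
    unfolding q_def using bdd that by (intro cINF_lower) auto
  have le_q: "c \<le> q x" if "\<And>u. 0 \<le> u \<Longrightarrow> c \<le> g x u" for c x
    unfolding q_def using that by (intro cINF_greatest) auto
  have "sublinear q"
  proof (rule sublinearI)
    fix x y
    have g_add: "g (x + y) (u + v) \<le> g x u + g y v" for u v
      using sublinearD(1)[OF p, of "x + u *\<^sub>R z" "y + v *\<^sub>R z"]
      by (simp add: g_def algebra_simps)
    have "q (x + y) - g x u \<le> q y" if "0 \<le> u" for u
    proof (rule le_q)
      fix v :: real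
      assume "0 \<le> v"
      with that q_le[of "u + v" "x + y"] g_add[of u v] show "q (x + y) - g x u \<le> g y v"
        by simp
    qed
    then have "q (x + y) - q y \<le> q x"
      by (intro le_q) (simp add: algebra_simps)
    then show "q (x + y) \<le> q x + q y"
      by simp
  next
    fix r :: real and x
    assume r: "0 < r"
    have "q (r *\<^sub>R x) / r \<le> q x"
    proof (rule le_q)
      fix u :: real
      assume u: "0 \<le> u"
      have "q (r *\<^sub>R x) \<le> g (r *\<^sub>R x) (r * u)"
        using r u by (intro q_le) simp
      also have "\<dots> = r * g x u"
        using sublinearD(2)[OF p, of r "x + u *\<^sub>R z"] r by (simp add: g_def algebra_simps)
      finally show "q (r *\<^sub>R x) / r \<le> g x u"
        using r by (simp add: field_simps)
    qed
    then show "q (r *\<^sub>R x) \<le> r * q x"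
      using r by (simp add: field_simps)
  next
    have "g 0 u = 0" if "0 \<le> u" for u
      using sublinearD(2)[OF p that, of z] by (simp add: g_def)
    then show "q 0 = 0"
      by (intro antisym le_q) (use q_le[of 0 0] in auto)
  qed
  moreover have "q x \<le> p x" for x
    using q_le[of 0 x] by (simp add: g_def)
  moreover have "q (- z) \<le> - p z"
    using q_le[of 1 "- z"] sublinearD(3)[OF p] by (simp add: g_def)
  ultimately show thesis
    by (rule that)
qed

lemma sublinear_INF_chain:
  fixes P :: "('a::real_vector \<Rightarrow> real) set"
  assumes P: "P \<noteq> {}" "\<And>p. p \<in> P \<Longrightarrow> sublinear p"
    and chain: "\<And>p q. p \<in> P \<Longrightarrow> q \<in> P \<Longrightarrow> p \<le> q \<or> q \<le> p"
    and lower: "\<And>p x. p \<in> P \<Longrightarrow> l x \<le> p x"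
  shows "sublinear (\<lambda>x. INF p\<in>P. p x)"
proof -
  define q where "q x = (INF p\<in>P. p x)" for x
  have q_le: "q x \<le> p x" if "p \<in> P" for p x
    unfolding q_def using lower that by (intro cINF_lower bdd_belowI[where m = "l x"]) auto
  have le_q: "c \<le> q x" if "\<And>p. p \<in> P \<Longrightarrow> c \<le> p x" for c x
    unfolding q_def using that P by (intro cINF_greatest) auto
  have "sublinear q"
  proof (rule sublinearI)
    fix x y
    have *: "q (x + y) \<le> p1 x + p2 y" if p12: "p1 \<in> P" "p2 \<in> P" for p1 p2
    proof -
      obtain p where p: "p \<in> P" "p \<le> p1" "p \<le> p2"
        using chain[OF p12] p12 by blast
      have "q (x + y) \<le> p (x + y)"
        by (rule q_le[OF p(1)])
      also have "\<dots> \<le> p x + p y"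
        by (rule sublinearD(1)[OF P(2)[OF p(1)]])
      also have "\<dots> \<le> p1 x + p2 y"
        using p(2,3) by (intro add_mono) (auto simp: le_fun_def)
      finally show ?thesis .
    qed
    have "q (x + y) - p1 x \<le> q y" if "p1 \<in> P" for p1
      using *[OF that] by (intro le_q) (simp add: algebra_simps)
    then have "q (x + y) - q y \<le> q x"
      by (intro le_q) (simp add: algebra_simps)
    then show "q (x + y) \<le> q x + q y"
      by simp
  next
    fix r :: real and x
    assume r: "0 < r"
    have "q (r *\<^sub>R x) / r \<le> q x"
    proof (rule le_q)
      fix p
      assume p: "p \<in> P"
      show "q (r *\<^sub>R x) / r \<le> p x"
        using q_le[OF p, of "r *\<^sub>R x"] sublinearD(2)[OF P(2)[OF p], of r x] r
        by (simp add: field_simps)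
    qed
    then show "q (r *\<^sub>R x) \<le> r * q x"
      using r by (simp add: field_simps)
  next
    have "p 0 = 0" if "p \<in> P" for p
      by (rule sublinearD(3)[OF P(2)[OF that]])
    then have "(\<lambda>p. p 0) ` P = {0}"
      using P(1) by (auto simp: image_iff)
    then show "q 0 = 0"
      by (simp add: q_def)
  qed
  then show ?thesis
    by (simp add: q_def[abs_def])
qed

text \<open>
  The Hahn--Banach theorem in a form that needs no functionals on subspaces. By Zorn's lemma there is
  a minimal sublinear functional below \<open>p\<close>. It agrees with its tilts, so it is odd, and an odd
  sublinear functional is linear.
\<close>

lemma sublinear_dominates_linear:
  fixes p :: "'a::real_vector \<Rightarrow> real"
  assumes p: "sublinear p"
  obtains f where "linear f" "\<And>x. f x \<le> p x"
proof -
  define A where "A = {q. sublinear q \<and> q \<le> p}"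
  have lower: "- p (- x) \<le> q x" if "q \<in> A" for q x
  proof -
    have "q (- x) \<le> p (- x)" "- q (- x) \<le> q x"
      using that sublinearD(4) by (auto simp: A_def le_fun_def)
    then show ?thesis
      by simp
  qed
  have "\<exists>m\<in>A. \<forall>q\<in>A. q \<le> m \<longrightarrow> q = m"
  proof (rule predicate_Zorn)
    show "partial_order_on A (relation_of (\<lambda>x y. y \<le> x) A)"
      by (rule partial_order_on_relation_ofI) auto
  next
    fix Ch
    assume Ch: "Ch \<in> Chains (relation_of (\<lambda>x y. y \<le> x) A)"
    show "\<exists>u\<in>A. \<forall>a\<in>Ch. u \<le> a"
    proof (cases "Ch = {}")
      case True
      then show ?thesis
        using p by (auto simp: A_def)
    next
      case False
      have sub: "q \<in> A" if "q \<in> Ch" for q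
        using Ch that unfolding Chains_def relation_of_def by auto
      define u where "u x = (INF q\<in>Ch. q x)" for x
      have u_le: "u \<le> q" if "q \<in> Ch" for q
        unfolding le_fun_def u_def
        using lower sub that by (auto intro!: cINF_lower bdd_belowI[where m = "- p (- _)"])
      have "sublinear u"
        unfolding u_def
      proof (rule sublinear_INF_chain[where l = "\<lambda>x. - p (- x)"])
        show "Ch \<noteq> {}" by fact
        show "sublinear q" if "q \<in> Ch" for q
          using sub[OF that] by (simp add: A_def)
        show "q \<le> q' \<or> q' \<le> q" if "q \<in> Ch" "q' \<in> Ch" for q q'
          using Ch that unfolding Chains_def relation_of_def by auto
        show "- p (- x) \<le> q x" if "q \<in> Ch" for q x
          using sub[OF that] lower by blast
      qed
      moreover have "u \<le> p"
        using False u_le sub by (force simp: A_def)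
      ultimately show ?thesis
        using u_le by (auto simp: A_def)
    qed
  qed
  then obtain m where m: "sublinear m" "m \<le> p"
    and minimal: "\<And>q. sublinear q \<Longrightarrow> q \<le> m \<Longrightarrow> q = m"
    unfolding A_def by (auto intro: order_trans)
  have minus: "m (- z) = - m z" for z
  proof -
    obtain q where q: "sublinear q" "\<And>x. q x \<le> m x" "q (- z) \<le> - m z"
      using sublinear_tilt[OF m(1)] by blast
    then have "q = m"
      by (intro minimal) (auto simp: le_fun_def)
    with q(3) sublinearD(4)[OF m(1), of z] show ?thesis
      by simp
  qed
  have add: "m (x + y) = m x + m y" for x y
  proof -
    have "m (- x + - y) \<le> m (- x) + m (- y)"
      by (rule sublinearD(1)[OF m(1)])
    then have "m x + m y \<le> m (x + y)"
      using minus[of "x + y"] by (simp add: minus)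
    with sublinearD(1)[OF m(1), of x y] show ?thesis
      by simp
  qed
  have scale: "m (r *\<^sub>R x) = r * m x" for r x
  proof (cases "0 \<le> r")
    case True
    then show ?thesis
      by (rule sublinearD(2)[OF m(1)])
  next
    case False
    then have "m ((- r) *\<^sub>R x) = - r * m x"
      by (intro sublinearD(2)[OF m(1)]) simp
    then show ?thesis
      by (simp add: minus)
  qed
  have "linear m"
    by (rule linearI) (simp_all add: add scale)
  with m(2) show thesis
    by (intro that) (auto simp: le_fun_def)
qed

lemma norming_functional_real:
  fixes x :: "'a::real_normed_vector"
  obtains f :: "'a \<Rightarrow> real" where "linear f" "\<And>y. f y \<le> norm y" "f x = norm x"
proof -
  have "sublinear (norm :: 'a \<Rightarrow> real)"
    by (auto simp: sublinear_def norm_triangle_ineq)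
  then obtain q where q: "sublinear q" "\<And>y. q y \<le> norm y" "q (- x) \<le> - norm x"
    by (rule sublinear_tilt[where z = x]) blast
  obtain f where f: "linear f" "\<And>y. f y \<le> q y"
    using sublinear_dominates_linear[OF q(1)] by blast
  have le: "f y \<le> norm y" for y
    using f(2) q(2) by (rule order_trans)
  have "f (- x) \<le> - norm x"
    using f(2) q(3) by (rule order_trans)
  then have "norm x \<le> f x"
    by (simp add: linear_neg[OF f(1)])
  then show thesis
    using that f(1) le by (metis antisym)
qed

context banach_over
begin

lemma scale_scaleR: "s c (r *\<^sub>R x) = r *\<^sub>R s c x"
  by (metis scale_left_commute scale_of_real)

text \<open>
  If the scalars have an imaginary unit \<open>i\<close>, the real functional \<open>f\<close> is replaced by
  \<open>f y - i f (i y)\<close>. Multiplying \<open>y\<close> by a scalar of modulus one makes the value real and hence equal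
  to one of \<open>f\<close>, so the norm does not increase; and then the imaginary part at \<open>x\<close>, where the real part is
  already \<open>norm x\<close>, has to vanish.
\<close>

lemma norming_functional:
  obtains \<phi> where "\<phi> \<in> dual s" "norm \<phi> \<le> 1" "blinfun_apply \<phi> x = of_real (norm x)"
proof -
  obtain f :: "'a \<Rightarrow> real" where lin: "linear f" and le: "\<And>y. f y \<le> norm y" and fx: "f x = norm x"
    using norming_functional_real by blast
  have f_abs: "\<bar>f y\<bar> \<le> norm y" for y
    using le[of y] le[of "- y"] by (simp add: linear_neg[OF lin])
  have f_add: "f (y + z) = f y + f z" and f_scaleR: "f (r *\<^sub>R y) = r * f y" for y z r
    using linear_add[OF lin] linear_scale[OF lin] by auto
  have "\<exists>g. (\<forall>y z. g (y + z) = g y + g z) \<and> (\<forall>c y. g (s c y) = c * g y) \<and>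
      (\<forall>y. norm (g y) \<le> norm y) \<and> g x = of_real (norm x)"
    using real_or_complex
  proof
    assume real: "\<forall>z::'k. \<exists>a. z = a *\<^sub>R 1"
    define g where "g y = (of_real (f y) :: 'k)" for y
    have "g (s c y) = c * g y" for c y
    proof -
      obtain a where "c = a *\<^sub>R 1"
        using real by blast
      then have "c = of_real a"
        by (simp add: of_real_def)
      then show ?thesis
        by (simp add: g_def scale_of_real f_scaleR)
    qed
    then show ?thesis
      by (intro exI[of _ g]) (auto simp: g_def f_add fx f_abs)
  next
    assume "\<exists>i::'k. i * i = - 1 \<and>
        (\<forall>z. \<exists>a b. z = a *\<^sub>R 1 + b *\<^sub>R i \<and> norm z = sqrt (a\<^sup>2 + b\<^sup>2))"
    then obtain i :: 'k where i: "i * i = - 1"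
      and rep: "\<And>z. \<exists>a b. z = a *\<^sub>R 1 + b *\<^sub>R i \<and> norm z = sqrt (a\<^sup>2 + b\<^sup>2)"
      by blast
    have re0: "u = 0 \<and> v = 0" if "of_real u + i * of_real v = 0" for u v
    proof -
      have "of_real u = - (i * of_real v)"
        using that by (simp add: add_eq_0_iff2)
      then have "of_real u * of_real u = (- (i * of_real v)) * (- (i * of_real v))"
        by simp
      also have "\<dots> = (i * i) * (of_real v * of_real v)"
        by simp
      finally have "(of_real (u * u + v * v) :: 'k) = of_real 0"
        by (simp add: i)
      then have "u * u + v * v = 0"
        by (simp only: of_real_eq_iff)
      then show ?thesis
        using sum_squares_eq_zero_iff by blast
    qed
    have uniq: "u = u' \<and> v = v'" if "of_real u + i * of_real v = of_real u' + i * of_real v'" for u v u' v'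
      using re0[of "u - u'" "v - v'"] that by (simp add: algebra_simps)
    define g where "g y = of_real (f y) - i * of_real (f (s i y))" for y
    have g_add: "g (y + z) = g y + g z" for y z
      by (simp add: g_def scale_right_distrib f_add algebra_simps)
    have g_scaleR: "g (r *\<^sub>R y) = of_real r * g y" for r y
      by (simp add: g_def scale_scaleR f_scaleR algebra_simps)
    have g_i: "g (s i y) = i * g y" for y
    proof -
      have "s i (s i y) = - y"
        by (simp add: i)
      moreover have "f (- y) = - f y"
        by (simp add: linear_neg[OF lin])
      ultimately have "g (s i y) = of_real (f (s i y)) + i * of_real (f y)"
        by (simp add: g_def)
      also have "\<dots> = i * of_real (f y) - (i * i) * of_real (f (s i y))"
        by (simp add: i)
      also have "\<dots> = i * g y"
        by (simp add: g_def algebra_simps)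
      finally show ?thesis .
    qed
    have g_scale: "g (s c y) = c * g y" for c y
    proof -
      obtain a b where "c = a *\<^sub>R 1 + b *\<^sub>R i"
        using rep by blast
      then have c: "c = of_real a + of_real b * i"
        by (simp add: scaleR_conv_of_real)
      have "s c y = a *\<^sub>R y + b *\<^sub>R s i y"
        by (simp add: c scale_left_distrib scale_of_real flip: scale_scale)
      then show ?thesis
        by (simp add: g_add g_scaleR g_i c algebra_simps)
    qed
    have g_norm: "norm (g y) \<le> norm y" for y
    proof (cases "g y = 0")
      case False
      define c where "c = of_real (norm (g y)) / g y"
      have "norm c = 1"
        using False by (simp add: c_def norm_divide)
      have "g (s c y) = of_real (norm (g y))"
        using False by (simp add: g_scale c_def)
      then have "of_real (f (s c y)) + i * of_real (- f (s i (s c y))) =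
          of_real (norm (g y)) + i * of_real 0"
        by (simp add: g_def)
      then have "norm (g y) = f (s c y)"
        by (metis uniq)
      also have "\<dots> \<le> norm y"
        using le[of "s c y"] \<open>norm c = 1\<close> by (simp add: norm_scale)
      finally show ?thesis .
    qed simp
    have "g x = of_real (norm x)"
    proof -
      obtain a b where ab: "g x = a *\<^sub>R 1 + b *\<^sub>R i" "norm (g x) = sqrt (a\<^sup>2 + b\<^sup>2)"
        using rep by blast
      then have "of_real (norm x) + i * of_real (- f (s i x)) = of_real a + i * of_real b"
        by (simp add: g_def fx scaleR_conv_of_real)
      then have a: "a = norm x" and b: "b = - f (s i x)"
        using uniq by metis+
      have "sqrt (a\<^sup>2 + b\<^sup>2) \<le> norm x"
        using g_norm[of x] ab(2) by simp
      then have "a\<^sup>2 + b\<^sup>2 \<le> (norm x)\<^sup>2"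
        using real_sqrt_le_iff[of "a\<^sup>2 + b\<^sup>2" "(norm x)\<^sup>2"] by simp
      then have "b = 0"
        by (simp add: a)
      then show ?thesis
        using ab(1) by (simp add: a of_real_def)
    qed
    with g_add g_scale g_norm show ?thesis
      by blast
  qed
  then obtain g where g: "\<And>y z. g (y + z) = g y + g z" "\<And>c y. g (s c y) = c * g y"
      "\<And>y. norm (g y) \<le> norm y" "g x = of_real (norm x)"
    by blast
  have bl: "bounded_linear g"
  proof (rule bounded_linear_intro)
    show "g (r *\<^sub>R y) = r *\<^sub>R g y" for r y
      using g(2)[of "of_real r" y] by (simp add: scale_of_real scaleR_conv_of_real)
    show "norm (g y) \<le> norm y * 1" for y
      using g(3) by simp
  qed (rule g(1))
  then have app: "blinfun_apply (Blinfun g) = g"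
    by (rule bounded_linear_Blinfun_apply)
  show thesis
  proof (rule that)
    show "Blinfun g \<in> dual s"
      by (simp add: dual_def L_def app g(2))
    show "norm (Blinfun g) \<le> 1"
      by (rule norm_blinfun_bound) (simp_all add: app g(3))
    show "blinfun_apply (Blinfun g) x = of_real (norm x)"
      by (simp add: app g(4))
  qed
qed

lemma dual_separates:
  assumes "x \<noteq> 0"
  obtains \<phi> where "\<phi> \<in> dual s" "blinfun_apply \<phi> x \<noteq> 0"
  using norming_functional[of x] assms by (metis norm_eq_zero of_real_eq_0_iff)

lemma eq_if_dual_eq:
  assumes "\<And>\<phi>. \<phi> \<in> dual s \<Longrightarrow> blinfun_apply \<phi> x = blinfun_apply \<phi> y"
  shows "x = y"
proof (rule ccontr)
  assume "x \<noteq> y"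
  then obtain \<phi> where "\<phi> \<in> dual s" "blinfun_apply \<phi> (x - y) \<noteq> 0"
    using dual_separates[of "x - y"] by auto
  with assms show False
    by (simp add: blinfun.diff_right)
qed

end

section \<open>Linear operators and dual systems\<close>

lemma L_I: "(\<And>c x. blinfun_apply A (s c x) = t c (blinfun_apply A x)) \<Longrightarrow> A \<in> L s t"
  by (simp add: L_def)

lemma L_scale: "A \<in> L s t \<Longrightarrow> blinfun_apply A (s c x) = t c (blinfun_apply A x)"
  by (simp add: L_def)

lemma dual_scale_right: "\<phi> \<in> dual s \<Longrightarrow> blinfun_apply \<phi> (s c x) = c * blinfun_apply \<phi> x"
  by (simp add: dual_def L_def)

lemma L_compose: "A \<in> L s t \<Longrightarrow> B \<in> L t u \<Longrightarrow> B o\<^sub>L A \<in> L s u"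
  by (simp add: L_def)

lemma dual_compose: "A \<in> L s t \<Longrightarrow> \<phi> \<in> dual t \<Longrightarrow> \<phi> o\<^sub>L A \<in> dual s"
  by (simp add: L_def dual_def)

lemma L_id: "id_blinfun \<in> L s s"
  by (simp add: L_def)

lemma (in banach_over) L_zero: "0 \<in> L u s"
  by (simp add: L_def)

lemma (in banach_over) L_add: "A \<in> L u s \<Longrightarrow> B \<in> L u s \<Longrightarrow> A + B \<in> L u s"
  by (simp add: L_def blinfun.add_left scale_right_distrib)

lemma (in banach_over) L_diff: "A \<in> L u s \<Longrightarrow> B \<in> L u s \<Longrightarrow> A - B \<in> L u s"
  by (simp add: L_def blinfun.diff_left scale_right_diff_distrib)

lemma (in banach_over) L_scaleR: "A \<in> L u s \<Longrightarrow> r *\<^sub>R A \<in> L u s"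
  by (simp add: L_def blinfun.scaleR_left scale_scaleR)

lemma (in banach_over) bounded_linear_scale: "bounded_linear (s c)"
  by (rule bounded_linear_intro[where K = "norm c"])
    (simp_all add: scale_right_distrib scale_scaleR norm_scale)

lemma (in banach_over) L_suminf:
  assumes "summable A" "\<And>k. A k \<in> L u s"
  shows "suminf A \<in> L u s"
proof (rule L_I)
  have app: "blinfun_apply (suminf A) x = (\<Sum>k. blinfun_apply (A k) x)"
    and sm: "summable (\<lambda>k. blinfun_apply (A k) x)" for x
    using assms(1) bounded_linear.suminf[OF blinfun.bounded_linear_left]
      bounded_linear.summable[OF blinfun.bounded_linear_left] by metis+
  show "blinfun_apply (suminf A) (u c x) = s c (blinfun_apply (suminf A) x)" for c x
    using bounded_linear.suminf[OF bounded_linear_scale sm, of c x] 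
    by (simp add: app L_scale[OF assms(2)])
qed

text \<open>
  The elementary tensor of a functional and a vector.
\<close>

definition rank_one :: "('k \<Rightarrow> 'b \<Rightarrow> 'b) \<Rightarrow> ('a::real_normed_vector \<Rightarrow>\<^sub>L 'k::real_normed_field) \<Rightarrow> 'b
    \<Rightarrow> ('a \<Rightarrow>\<^sub>L 'b::real_normed_vector)" where
  "rank_one t \<phi> y = Blinfun (\<lambda>x. t (blinfun_apply \<phi> x) y)"

context banach_over
begin

lemma bounded_linear_rank_one: "bounded_linear (\<lambda>x. s (blinfun_apply \<phi> x) y)"
proof (rule bounded_linear_intro[where K = "norm \<phi> * norm y"])
  show "s (blinfun_apply \<phi> (r *\<^sub>R x)) y = r *\<^sub>R s (blinfun_apply \<phi> x) y" for r x
    by (simp add: blinfun.scaleR_right scaleR_conv_of_real flip: scale_of_real scale_scale)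
  show "norm (s (blinfun_apply \<phi> x) y) \<le> norm x * (norm \<phi> * norm y)" for x
    using mult_right_mono[OF norm_blinfun[of \<phi> x], of "norm y"]
    by (simp add: norm_scale ac_simps)
qed (simp add: blinfun.add_right scale_left_distrib)

lemma rank_one_apply [simp]: "blinfun_apply (rank_one s \<phi> y) x = s (blinfun_apply \<phi> x) y"
  unfolding rank_one_def by (simp add: bounded_linear_Blinfun_apply[OF bounded_linear_rank_one])

lemma rank_one_in_L: "\<phi> \<in> dual u \<Longrightarrow> rank_one s \<phi> y \<in> L u s"
  by (rule L_I) (simp add: dual_scale_right)

lemma norm_rank_one: "norm (rank_one s \<phi> y) \<le> norm \<phi> * norm y"
  using mult_right_mono[OF norm_blinfun[of \<phi>], of "norm y"]
  by (intro norm_blinfun_bound) (auto simp: norm_scale ac_simps)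

end

text \<open>
  The vectors of \<open>B\<close> are treated one after the other: a vector that detects the new element is made
  orthogonal to the old ones, and the old dual vectors are corrected by it. The pairing is applied to
  vectors and functionals in either order. Homogeneity over \<open>'k\<close> is restricted to \<open>V\<close> and \<open>W\<close> because
  the type of functionals contains maps that are only linear over the reals.
\<close>

lemma dual_system:
  fixes pairing :: "'v::ab_group_add \<Rightarrow> 'w::ab_group_add \<Rightarrow> 'k::field"
  assumes v: "vector_space sv" and w: "vector_space sw"
    and add_left: "\<And>x y z. pairing (x + y) z = pairing x z + pairing y z"
    and scale_left: "\<And>c x z. z \<in> W \<Longrightarrow> pairing (sv c x) z = c * pairing x z"
    and add_right: "\<And>x y z. pairing x (y + z) = pairing x y + pairing x z"
    and scale_right: "\<And>c x z. x \<in> V \<Longrightarrow> pairing x (sw c z) = c * pairing x z"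
    and W: "module.subspace sw W"
    and separating: "\<And>x. x \<in> module.span sv B \<Longrightarrow> x \<noteq> 0 \<Longrightarrow> \<exists>z\<in>W. pairing x z \<noteq> 0"
    and B: "finite B" "\<not> module.dependent sv B" "B \<subseteq> V"
  shows "\<exists>d. (\<forall>b\<in>B. d b \<in> W) \<and> (\<forall>b\<in>B. \<forall>c\<in>B. pairing b (d c) = (if b = c then 1 else 0))"
proof -
  interpret v: vector_space sv by fact
  interpret w: vector_space sw by fact
  have zero_right: "pairing x 0 = 0" for x
    using add_right[of x 0 0] by (metis add.right_neutral add_left_cancel)
  have zero_left: "pairing 0 z = 0" for z
    using add_left[of 0 0 z] by (metis add.right_neutral add_left_cancel)
  have minus_right: "pairing x (y - z) = pairing x y - pairing x z" for x y z
    using add_right[of x "y - z" z] by simp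
  have minus_left: "pairing (x - y) z = pairing x z - pairing y z" for x y z
    using add_left[of "x - y" y z] by simp
  have sum_left: "pairing (sum f I) z = (\<Sum>i\<in>I. pairing (f i) z)" for f I z
    by (induction I rule: infinite_finite_induct) (simp_all add: zero_left add_left)
  have sum_right: "pairing x (sum f I) = (\<Sum>i\<in>I. pairing x (f i))" for f I x
    by (induction I rule: infinite_finite_induct) (simp_all add: zero_right add_right)
  show ?thesis
    using B separating
  proof (induction B rule: finite_induct)
    case (insert a B)
    have indep: "\<not> v.dependent B" and a: "a \<notin> v.span B"
      using insert.prems(1) insert.hyps(2) v.independent_insert[of a B] by auto
    have "v.span B \<subseteq> v.span (insert a B)"
      by (intro v.span_mono) auto
    then obtain d where d: "\<forall>b\<in>B. d b \<in> W"
      and dual: "\<forall>b\<in>B. \<forall>c\<in>B. pairing b (d c) = (if b = c then 1 else 0)"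
      using insert.IH[OF indep] insert.prems(2,3) by blast
    define a' where "a' = a - (\<Sum>c\<in>B. sv (pairing a (d c)) c)"
    have "a' \<in> v.span (insert a B)"
      unfolding a'_def
      by (intro v.span_diff v.span_base v.span_sum v.span_scale) auto
    moreover have "(\<Sum>c\<in>B. sv (pairing a (d c)) c) \<in> v.span B"
      by (intro v.span_sum v.span_scale v.span_base)
    with a have "a' \<noteq> 0"
      by (auto simp: a'_def)
    ultimately obtain z where z: "z \<in> W" "pairing a' z \<noteq> 0"
      using insert.prems(3) by blast
    \<comment> \<open>\<open>z\<close> made orthogonal to \<open>B\<close>; its pairing with \<open>a\<close> is that of \<open>z\<close> with \<open>a'\<close>\<close>
    define z' where "z' = z - (\<Sum>c\<in>B. sw (pairing c z) (d c))"
    have z'W: "z' \<in> W"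
      unfolding z'_def using W z(1) d
      by (intro w.subspace_diff w.subspace_sum w.subspace_scale) auto
    have Bz': "pairing b z' = 0" if "b \<in> B" for b
    proof -
      have bV: "b \<in> V"
        using that insert.prems(2) by auto
      have "(\<Sum>c\<in>B. pairing c z * pairing b (d c)) = (\<Sum>c\<in>B. if c = b then pairing c z else 0)"
        using that dual by (intro sum.cong) auto
      also have "\<dots> = pairing b z"
        using that insert.hyps(1) by simp
      finally show ?thesis
        by (simp add: z'_def minus_right sum_right scale_right[OF bV])
    qed
    have aV: "a \<in> V"
      using insert.prems(2) by auto
    have az': "pairing a z' = pairing a' z"
      unfolding z'_def a'_def minus_right sum_right scale_right[OF aV] minus_left sum_left
        scale_left[OF z(1)]
      by (simp add: mult.commute)
    define e where "e = sw (1 / pairing a' z) z'"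
    have e: "e \<in> W" "pairing a e = 1" "\<And>b. b \<in> B \<Longrightarrow> pairing b e = 0"
      using z'W W z(2) insert.prems(2) by (auto simp: e_def scale_right az' Bz' w.subspace_scale)
    define d' where "d' c = (if c = a then e else d c - sw (pairing a (d c)) e)" for c
    have "\<forall>b\<in>insert a B. d' b \<in> W"
      using d e(1) W by (auto simp: d'_def intro!: w.subspace_diff w.subspace_scale)
    moreover have "\<forall>b\<in>insert a B. \<forall>c\<in>insert a B. pairing b (d' c) = (if b = c then 1 else 0)"
      using dual e(2,3) insert.hyps(2) insert.prems(2) by (auto simp: d'_def minus_right scale_right)
    ultimately show ?case
      by blast
  qed auto
qed

section \<open>Operators of finite rank\<close>

text \<open>
  Rank at most \<open>r\<close>, expressed by functionals and vectors in equal numbers. In this form the bound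
  passes between an operator and its adjoint.
\<close>

definition finite_rank :: "('k::real_or_complex \<Rightarrow> 'a \<Rightarrow> 'a) \<Rightarrow> ('k \<Rightarrow> 'b \<Rightarrow> 'b) \<Rightarrow> nat
    \<Rightarrow> ('a::real_normed_vector \<Rightarrow>\<^sub>L 'b::real_normed_vector) \<Rightarrow> bool" where
  "finite_rank s t r A \<longleftrightarrow>
     (\<exists>a b. (\<forall>i<r. a i \<in> dual s) \<and> (\<forall>x. blinfun_apply A x = (\<Sum>i<r. t (blinfun_apply (a i) x) (b i))))"

lemma zero_in_dual: "0 \<in> dual s"
  by (simp add: dual_def L_def)

lemma dual_subspaceD:
  shows "\<phi> \<in> dual s \<Longrightarrow> \<psi> \<in> dual s \<Longrightarrow> \<phi> + \<psi> \<in> dual s"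
    and "\<phi> \<in> dual s \<Longrightarrow> \<psi> \<in> dual s \<Longrightarrow> \<phi> - \<psi> \<in> dual s"
    and "\<phi> \<in> dual s \<Longrightarrow> dual_scale c \<phi> \<in> dual s"
  by (auto simp: dual_def L_def blinfun.bilinear_simps algebra_simps)

lemma finite_rank_compose_right:
  assumes "finite_rank t u r A" "B \<in> L s t"
  shows "finite_rank s u r (A o\<^sub>L B)"
proof -
  obtain a b where "\<forall>i<r. a i \<in> dual t"
      and *: "\<And>x. blinfun_apply A x = (\<Sum>i<r. u (blinfun_apply (a i) x) (b i))"
    using assms(1) unfolding finite_rank_def by blast
  then show ?thesis
    unfolding finite_rank_def using dual_compose[OF assms(2)]
    by (intro exI[of _ "\<lambda>i. a i o\<^sub>L B"] exI[of _ b]) (simp add: *)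
qed

context banach_over
begin

lemma finite_rank_mono:
  assumes "finite_rank u s r A" "r \<le> r'"
  shows "finite_rank u s r' A"
proof -
  obtain a b where a: "\<forall>i<r. a i \<in> dual u"
      and *: "\<And>x. blinfun_apply A x = (\<Sum>i<r. s (blinfun_apply (a i) x) (b i))"
    using assms(1) unfolding finite_rank_def by blast
  define a' where "a' i = (if i < r then a i else 0)" for i
  have "blinfun_apply A x = (\<Sum>i<r'. s (blinfun_apply (a' i) x) (b i))" for x
    unfolding * using assms(2) by (intro sum.mono_neutral_cong_left) (auto simp: a'_def)
  moreover have "\<forall>i<r'. a' i \<in> dual u"
    using a by (simp add: a'_def zero_in_dual)
  ultimately show ?thesis
    unfolding finite_rank_def by blast
qed

lemma finite_rank_zero: "finite_rank u s r 0"
  unfolding finite_rank_def by (intro exI[of _ "\<lambda>i. 0"]) (simp add: zero_in_dual)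

lemma finite_rank_rank_one: "\<phi> \<in> dual u \<Longrightarrow> finite_rank u s 1 (rank_one s \<phi> y)"
  unfolding finite_rank_def by (intro exI[of _ "\<lambda>i. \<phi>"] exI[of _ "\<lambda>i. y"]) simp

lemma finite_rank_add:
  assumes "finite_rank u s r A" "finite_rank u s r' A'"
  shows "finite_rank u s (r + r') (A + A')"
proof -
  obtain a b where a: "\<forall>i<r. a i \<in> dual u"
      and 1: "\<And>x. blinfun_apply A x = (\<Sum>i<r. s (blinfun_apply (a i) x) (b i))"
    using assms(1) unfolding finite_rank_def by blast
  obtain a' b' where a': "\<forall>i<r'. a' i \<in> dual u"
      and 2: "\<And>x. blinfun_apply A' x = (\<Sum>i<r'. s (blinfun_apply (a' i) x) (b' i))"
    using assms(2) unfolding finite_rank_def by blast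
  define c where "c i = (if i < r then a i else a' (i - r))" for i
  define e where "e i = (if i < r then b i else b' (i - r))" for i
  have "(\<Sum>i<r + r'. s (blinfun_apply (c i) x) (e i)) = blinfun_apply (A + A') x" for x
  proof -
    have "(\<Sum>i<r + r'. s (blinfun_apply (c i) x) (e i)) =
        (\<Sum>i<r. s (blinfun_apply (c i) x) (e i)) +
        (\<Sum>i<r'. s (blinfun_apply (c (r + i)) x) (e (r + i)))"
      by (induction r') (simp_all add: add.assoc)
    then show ?thesis
      by (simp add: 1 2 c_def e_def blinfun.add_left)
  qed
  moreover have "\<forall>i<r + r'. c i \<in> dual u"
    using a a' by (auto simp: c_def)
  ultimately show ?thesis
    unfolding finite_rank_def by metis
qed

lemma finite_rank_compose_left:
  fixes t :: "'k \<Rightarrow> 'b::banach \<Rightarrow> 'b"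
  assumes A: "finite_rank u s r A" and B: "B \<in> L s t"
  shows "finite_rank u t r (B o\<^sub>L A)"
proof -
  obtain a b where "\<forall>i<r. a i \<in> dual u"
      and *: "\<And>x. blinfun_apply A x = (\<Sum>i<r. s (blinfun_apply (a i) x) (b i))"
    using A unfolding finite_rank_def by blast
  then show ?thesis
    unfolding finite_rank_def
    by (intro exI[of _ a] exI[of _ "\<lambda>i. blinfun_apply B (b i)"])
      (simp add: * blinfun.sum_right L_scale[OF B])
qed

lemma fin_dim_if_subset_span:
  assumes "subspace V" "V \<subseteq> span B" "finite B"
  shows "fin_dim_subspace s V" "dim V \<le> card B"
proof -
  obtain B' where B': "B' \<subseteq> V" "independent B'" "V \<subseteq> span B'"
    using maximal_independent_subset by blast
  have "finite B'"
    using independent_span_bound[OF assms(3) B'(2)] B'(1) assms(2) by auto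
  moreover have "span B' = V"
    using B' assms(1) by (simp add: span_minimal subset_antisym)
  ultimately show "fin_dim_subspace s V"
    using assms(1) unfolding fin_dim_subspace_def by blast
  show "dim V \<le> card B"
    using assms by (intro dim_le_card)
qed

lemma fin_dim_subspace_basis:
  assumes "fin_dim_subspace s V"
  obtains B where "finite B" "B \<subseteq> V" "independent B" "span B = V" "card B = dim V"
proof -
  obtain B0 where B0: "finite B0" "span B0 = V" and V: "subspace V"
    using assms unfolding fin_dim_subspace_def by blast
  obtain B where B: "B \<subseteq> V" "independent B" "V \<subseteq> span B" "card B = dim V"
    using basis_exists by blast
  moreover have "finite B"
    using independent_span_bound[OF B0(1) B(2)] B(1) B0(2) by auto
  moreover have "span B = V"
    using B V by (simp add: span_minimal subset_antisym)
  ultimately show thesis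
    using that by blast
qed

lemma subspace_range_L:
  assumes u: "vector_space u" and A: "A \<in> L u s"
  shows "subspace (range (blinfun_apply A))"
proof -
  interpret u: vector_space u by fact
  show ?thesis
    unfolding subspace_def
    by (auto simp: image_iff simp flip: L_scale[OF A] blinfun.add_right
        intro: exI[of _ 0])
qed

lemma fin_dim_range_if_finite_rank:
  assumes u: "vector_space u" and A: "A \<in> L u s" "finite_rank u s r A"
  shows "fin_dim_subspace s (range (blinfun_apply A))" "dim (range (blinfun_apply A)) \<le> r"
proof -
  obtain a b where "\<And>x. blinfun_apply A x = (\<Sum>i<r. s (blinfun_apply (a i) x) (b i))"
    using A(2) unfolding finite_rank_def by blast
  then have *: "range (blinfun_apply A) \<subseteq> span (b ` {..<r})"
    by (auto intro!: span_sum span_scale intro: span_base)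
  then show "fin_dim_subspace s (range (blinfun_apply A))"
    by (rule fin_dim_if_subset_span(1)[OF subspace_range_L[OF u A(1)]]) simp
  have "dim (range (blinfun_apply A)) \<le> card (b ` {..<r})"
    using * by (rule dim_le_card) simp
  also have "\<dots> \<le> r"
    using card_image_le[of "{..<r}" b] by simp
  finally show "dim (range (blinfun_apply A)) \<le> r" .
qed

text \<open>
  The coordinate functionals of a basis of \<open>V\<close> extend to bounded functionals on the whole space,
  namely to those of a dual system.
\<close>

lemma finite_rank_if_fin_dim_range:
  fixes A :: "'b::banach \<Rightarrow>\<^sub>L 'a"
  assumes A: "A \<in> L u s"
    and V: "fin_dim_subspace s V" "range (blinfun_apply A) \<subseteq> V" "dim V \<le> r"
  shows "finite_rank u s r A"
proof -
  obtain B where B: "finite B" "independent B" "span B = V" "card B = dim V"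
    using fin_dim_subspace_basis[OF V(1)] by metis
  have "\<exists>d. (\<forall>b\<in>B. d b \<in> dual s) \<and>
      (\<forall>b\<in>B. \<forall>c\<in>B. blinfun_apply (d c) b = (if b = c then 1 else 0))"
  proof (rule dual_system[where sv = s and sw = dual_scale and V = UNIV])
    show "vector_space s"
      by unfold_locales
    show "\<exists>\<phi>\<in>dual s. blinfun_apply \<phi> x \<noteq> 0" if "x \<noteq> 0" for x
      using dual_separates[OF that] by blast
  qed (auto simp: vector_space_dual_scale subspace_dual blinfun.bilinear_simps B dual_scale_right
      intro: B)
  then obtain d where d: "\<And>b. b \<in> B \<Longrightarrow> d b \<in> dual s"
      "\<And>b c. b \<in> B \<Longrightarrow> c \<in> B \<Longrightarrow> blinfun_apply (d c) b = (if b = c then 1 else 0)"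
    by blast
  have expand: "y = (\<Sum>c\<in>B. s (blinfun_apply (d c) y) c)" if "y \<in> V" for y
  proof -
    have "y \<in> range (\<lambda>k. \<Sum>b\<in>B. s (k b) b)"
      using that B(3) span_finite[OF B(1)] by simp
    then obtain k where k: "y = (\<Sum>b\<in>B. s (k b) b)"
      by blast
    have "blinfun_apply (d c) y = k c" if c: "c \<in> B" for c
    proof -
      have "blinfun_apply (d c) y = (\<Sum>b\<in>B. k b * blinfun_apply (d c) b)"
        using d(1)[OF c] by (simp add: k blinfun.sum_right dual_scale_right)
      also have "\<dots> = (\<Sum>b\<in>B. if b = c then k b else 0)"
        using c d(2) by (intro sum.cong) auto
      also have "\<dots> = k c"
        using B(1) c by simp
      finally show ?thesis .
    qed
    then show ?thesis
      using k by simp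
  qed
  obtain e where e: "bij_betw e {..<card B} B"
    using ex_bij_betw_nat_finite[OF B(1)] atLeast0LessThan by metis
  have "finite_rank u s (card B) A"
    unfolding finite_rank_def
  proof (intro exI conjI allI impI)
    show "d (e i) o\<^sub>L A \<in> dual u" if "i < card B" for i
      using that e by (intro dual_compose[OF A] d(1)) (auto simp: bij_betw_def)
    show "blinfun_apply A x = (\<Sum>i<card B. s (blinfun_apply (d (e i) o\<^sub>L A) x) (e i))" for x
      using expand[of "blinfun_apply A x"] V(2)
        sum.reindex_bij_betw[OF e, of "\<lambda>c. s (blinfun_apply (d c) (blinfun_apply A x)) c"]
      by auto
  qed
  then show ?thesis
    using finite_rank_mono B(4) V(3) by auto
qed

text \<open>
  Here the roles are exchanged: vectors dual to a basis of \<open>N\<close> recover \<open>A x\<close> from the values of that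
  basis at \<open>x\<close>, because a vector on which all of \<open>N\<close> vanishes is mapped to \<open>0\<close> by \<open>A\<close>.
\<close>

lemma finite_rank_if_fin_dim_adjoint:
  fixes A :: "'b::banach \<Rightarrow>\<^sub>L 'a"
  assumes u: "banach_over u" and A: "A \<in> L u s"
    and N: "fin_dim_subspace dual_scale N" "N \<subseteq> dual u" "vector_space.dim dual_scale N \<le> r"
    and AN: "\<And>\<phi>. \<phi> \<in> dual s \<Longrightarrow> \<phi> o\<^sub>L A \<in> N"
  shows "finite_rank u s r A"
proof -
  interpret u: banach_over u by fact
  interpret ds: vector_space "dual_scale :: 'k \<Rightarrow> ('b \<Rightarrow>\<^sub>L 'k) \<Rightarrow> _"
    by (rule vector_space_dual_scale)
  obtain B0 where B0: "finite B0" "ds.span B0 = N"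
    using N(1) unfolding fin_dim_subspace_def by blast
  obtain B where B': "B \<subseteq> N" "ds.independent B" "N \<subseteq> ds.span B" "card B = ds.dim N"
    using ds.basis_exists by blast
  have B: "finite B" "B \<subseteq> dual u"
    using ds.independent_span_bound[OF B0(1) B'(2)] B'(1) B0(2) N(2) by auto
  have "\<exists>d. (\<forall>b\<in>B. d b \<in> UNIV) \<and>
      (\<forall>b\<in>B. \<forall>c\<in>B. blinfun_apply b (d c) = (if b = c then 1 else 0))"
  proof (rule dual_system[where sv = dual_scale and sw = u and V = "dual u"])
    show "vector_space u"
      by unfold_locales
    show "\<exists>x\<in>UNIV. blinfun_apply \<phi> x \<noteq> 0" if "\<phi> \<noteq> 0" for \<phi> :: "'b \<Rightarrow>\<^sub>L 'k"
      using that by (metis UNIV_I blinfun_eqI zero_blinfun.rep_eq)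
  qed (use B B' in \<open>auto simp: vector_space_dual_scale blinfun.bilinear_simps dual_scale_right\<close>)
  then obtain d where
    d: "\<And>b c. b \<in> B \<Longrightarrow> c \<in> B \<Longrightarrow> blinfun_apply b (d c) = (if b = c then 1 else 0)"
    by blast
  have kill: "\<phi> x = 0" if "\<phi> \<in> N" "\<And>b. b \<in> B \<Longrightarrow> blinfun_apply b x = 0"
    for \<phi> :: "'b \<Rightarrow>\<^sub>L 'k" and x
  proof -
    have "\<phi> \<in> range (\<lambda>k. \<Sum>b\<in>B. dual_scale (k b) b)"
      using that(1) B'(3) ds.span_finite[OF B(1)] by auto
    then obtain k where "\<phi> = (\<Sum>b\<in>B. dual_scale (k b) b)"
      by blast
    then show ?thesis
      using that(2) by (simp add: blinfun.sum_left)
  qed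
  have expand: "blinfun_apply A x = (\<Sum>c\<in>B. s (blinfun_apply c x) (blinfun_apply A (d c)))" for x
  proof -
    define x' where "x' = x - (\<Sum>c\<in>B. u (blinfun_apply c x) (d c))"
    have "blinfun_apply b x' = 0" if b: "b \<in> B" for b
    proof -
      have "(\<Sum>c\<in>B. blinfun_apply c x * blinfun_apply b (d c)) =
          (\<Sum>c\<in>B. if c = b then blinfun_apply c x else 0)"
        using d b by (intro sum.cong) auto
      also have "\<dots> = blinfun_apply b x"
        using B(1) b by simp
      finally have "(\<Sum>c\<in>B. blinfun_apply c x * blinfun_apply b (d c)) = blinfun_apply b x" .
      moreover have "b \<in> dual u"
        using b B(2) by auto
      ultimately show ?thesis
        by (simp add: x'_def blinfun.diff_right blinfun.sum_right dual_scale_right)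
    qed
    then have "blinfun_apply A x' = 0"
      using kill[OF AN] by (intro eq_if_dual_eq) auto
    then show ?thesis
      by (simp add: x'_def blinfun.diff_right blinfun.sum_right L_scale[OF A])
  qed
  obtain e where e: "bij_betw e {..<card B} B"
    using ex_bij_betw_nat_finite[OF B(1)] atLeast0LessThan by metis
  have "finite_rank u s (card B) A"
    unfolding finite_rank_def
  proof (intro exI conjI allI impI)
    show "e i \<in> dual u" if "i < card B" for i
      using that e B(2) by (auto simp: bij_betw_def)
    show "blinfun_apply A x =
        (\<Sum>i<card B. s (blinfun_apply (e i) x) (blinfun_apply A (d (e i))))" for x
      using expand[of x]
        sum.reindex_bij_betw[OF e, of "\<lambda>c. s (blinfun_apply c x) (blinfun_apply A (d c))"]
      by auto
  qed
  then show ?thesis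
    using finite_rank_mono B'(4) N(3) by auto
qed

text \<open>
  An operator of rank \<open>r\<close> imposes only \<open>r\<close> conditions on a projection whose adjoint has to fix all
  functionals that factor through the operator.
\<close>

lemma finite_rank_adjoint_subset_span:
  assumes "finite_rank u s r A"
  obtains \<Psi> where "finite \<Psi>" "card \<Psi> \<le> r" "\<Psi> \<subseteq> dual u"
    "\<And>\<phi>. \<phi> \<in> dual s \<Longrightarrow> \<phi> o\<^sub>L A \<in> module.span dual_scale \<Psi>"
proof -
  interpret ds: vector_space "dual_scale :: 'k \<Rightarrow> ('b::real_normed_vector \<Rightarrow>\<^sub>L 'k) \<Rightarrow> _"
    by (rule vector_space_dual_scale)
  obtain a b where a: "\<forall>i<r. a i \<in> dual u"
      and *: "\<And>x. blinfun_apply A x = (\<Sum>i<r. s (blinfun_apply (a i) x) (b i))"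
    using assms unfolding finite_rank_def by blast
  show thesis
  proof (rule that[of "a ` {..<r}"])
    show "card (a ` {..<r}) \<le> r"
      using card_image_le[of "{..<r}" a] by simp
    show "\<phi> o\<^sub>L A \<in> ds.span (a ` {..<r})" if "\<phi> \<in> dual s" for \<phi>
    proof -
      have "\<phi> o\<^sub>L A = (\<Sum>i<r. dual_scale (blinfun_apply \<phi> (b i)) (a i))"
        by (rule blinfun_eqI)
          (simp add: * blinfun.sum_right blinfun.sum_left dual_scale_right[OF that] mult.commute)
      then show ?thesis
        by (auto intro!: ds.span_sum ds.span_scale intro: ds.span_base)
    qed
  qed (use a in auto)
qed

lemma norm_le_if_dual:
  assumes "\<And>\<phi>. \<phi> \<in> dual s \<Longrightarrow> norm \<phi> \<le> 1 \<Longrightarrow> norm (blinfun_apply \<phi> x) \<le> c"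
  shows "norm x \<le> c"
  using norming_functional[of x] assms by (metis norm_of_real abs_norm_cancel)

end

section \<open>Local distance and property (D) in terms of operators\<close>

lemma bounded_linear_onD:
  assumes "bounded_linear_on s t S f"
  shows "x \<in> S \<Longrightarrow> y \<in> S \<Longrightarrow> f (x + y) = f x + f y" and "x \<in> S \<Longrightarrow> f (s c x) = t c (f x)"
  using assms by (auto simp: bounded_linear_on_def)

lemma onorm_on_bound:
  assumes f: "bounded_linear_on s t S f" and x: "x \<in> S"
  shows "norm (f x) \<le> onorm_on S f * norm x"
proof (cases "x = 0")
  case True
  then have "f (x + x) = f x + f x"
    using bounded_linear_onD(1)[OF f x x] by simp
  then show ?thesis
    by (simp add: True)
next
  case False
  obtain B where B: "\<And>y. y \<in> S \<Longrightarrow> norm (f y) \<le> B * norm y"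
    using f unfolding bounded_linear_on_def by blast
  have "norm (f y) / norm y \<le> \<bar>B\<bar>" if "y \<in> S" for y
  proof (cases "y = 0")
    case False
    have "norm (f y) \<le> \<bar>B\<bar> * norm y"
      using B[OF that] by (meson abs_ge_self mult_right_mono norm_ge_zero order_trans)
    with False show ?thesis
      by (simp add: field_simps)
  qed simp
  then have "bdd_above ((\<lambda>y. norm (f y) / norm y) ` S)"
    by (auto intro!: bdd_aboveI)
  then have "norm (f x) / norm x \<le> onorm_on S f"
    unfolding onorm_on_def using x by (intro cSUP_upper)
  with False show ?thesis
    by (simp add: field_simps)
qed

lemma onorm_on_nonneg:
  assumes f: "bounded_linear_on s t S f" and x: "x \<in> S"
  shows "0 \<le> onorm_on S f"
proof (cases "\<exists>y\<in>S. y \<noteq> 0")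
  case True
  then obtain y where y: "y \<in> S" "y \<noteq> 0"
    by blast
  have "0 \<le> onorm_on S f * norm y"
    using onorm_on_bound[OF f y(1)] norm_ge_zero[of "f y"] by linarith
  then show ?thesis
    using y(2) by (simp add: zero_le_mult_iff)
next
  case False
  then have "(\<lambda>y. norm (f y) / norm y) ` S = {0}"
    using x by force
  then show ?thesis
    by (simp add: onorm_on_def)
qed

lemma onorm_on_le:
  assumes "S \<noteq> {}" "0 \<le> c" "\<And>x. x \<in> S \<Longrightarrow> norm (f x) \<le> c * norm x"
  shows "onorm_on S f \<le> c"
  unfolding onorm_on_def
proof (rule cSUP_least)
  show "norm (f x) / norm x \<le> c" if "x \<in> S" for x
    using assms(2) assms(3)[OF that] by (cases "x = 0") (simp_all add: field_simps)
qed (rule assms(1))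

lemma isomorphism_onD:
  assumes "isomorphism_on s t M N \<psi>"
  shows "bij_betw \<psi> M N" "bounded_linear_on s t M \<psi>" "bounded_linear_on t s N (inv_into M \<psi>)"
    and "x \<in> M \<Longrightarrow> \<psi> x \<in> N" "x \<in> M \<Longrightarrow> inv_into M \<psi> (\<psi> x) = x"
    and "y \<in> N \<Longrightarrow> inv_into M \<psi> y \<in> M" "y \<in> N \<Longrightarrow> \<psi> (inv_into M \<psi> y) = y"
  using assms unfolding isomorphism_on_def
  by (auto simp: bij_betw_def inv_into_f_f f_inv_into_f inv_into_into)

lemma bm_dist_less_obtain:
  assumes "bm_dist s t M N < ennreal r"
  obtains \<psi> where "isomorphism_on s t M N \<psi>" "onorm_on M \<psi> * onorm_on N (inv_into M \<psi>) < r"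
proof -
  obtain \<psi> where "isomorphism_on s t M N \<psi>"
      and *: "ennreal (onorm_on M \<psi> * onorm_on N (inv_into M \<psi>)) < ennreal r"
    using assms unfolding bm_dist_def by (auto simp: INF_less_iff)
  from * have "onorm_on M \<psi> * onorm_on N (inv_into M \<psi>) < r"
    using ennreal_leI leD not_less by blast
  with \<open>isomorphism_on s t M N \<psi>\<close> show thesis
    by (rule that)
qed

lemma projection_ontoD:
  assumes "projection_onto s S N P"
  shows "bounded_linear_on s s S P" "x \<in> S \<Longrightarrow> P x \<in> N"
    and "N \<subseteq> S \<Longrightarrow> y \<in> N \<Longrightarrow> P y = y"
  using assms unfolding projection_onto_def by auto

lemma (in banach_over) bounded_linear_if_bounded_linear_on:
  fixes t :: "'k \<Rightarrow> 'b::banach \<Rightarrow> 'b"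
  assumes t: "banach_over t" and f: "bounded_linear_on s t UNIV f"
  shows "bounded_linear f"
proof -
  interpret t: banach_over t by fact
  obtain B where "\<And>x. norm (f x) \<le> B * norm x"
    using f unfolding bounded_linear_on_def by blast
  then show ?thesis
    using bounded_linear_onD[OF f]
    by (intro bounded_linear_intro[where K = B])
      (auto simp: mult.commute simp flip: scale_of_real t.scale_of_real)
qed

text \<open>
  For fixed \<open>x\<close> the map \<open>\<phi> \<mapsto> u \<phi> x\<close> is a bounded functional on the dual, hence the evaluation at a
  point, which is the value of the preadjoint \<open>V\<close> at \<open>x\<close>.
\<close>

lemma adjoint_if_reflexive:
  fixes s :: "'k::real_or_complex \<Rightarrow> 'a::banach \<Rightarrow> 'a" and t :: "'k \<Rightarrow> 'b::banach \<Rightarrow> 'b"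
  assumes s: "banach_over s" and t: "banach_over t" and refl: "reflexive t"
    and u: "bounded_linear_on dual_scale dual_scale (dual t) u" "\<And>\<phi>. \<phi> \<in> dual t \<Longrightarrow> u \<phi> \<in> dual s"
    and c: "0 \<le> c" "\<And>\<phi>. \<phi> \<in> dual t \<Longrightarrow> norm (u \<phi>) \<le> c * norm \<phi>"
  obtains V where "V \<in> L s t" "norm V \<le> c"
    "\<And>\<phi> x. \<phi> \<in> dual t \<Longrightarrow> blinfun_apply \<phi> (blinfun_apply V x) = blinfun_apply (u \<phi>) x"
proof -
  interpret s: banach_over s by fact
  interpret t: banach_over t by fact
  have "\<exists>y. \<forall>\<phi>\<in>dual t. blinfun_apply (u \<phi>) x = blinfun_apply \<phi> y" for x
  proof -
    have "bounded_linear_on dual_scale (*) (dual t) (\<lambda>\<phi>. blinfun_apply (u \<phi>) x)"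
      unfolding bounded_linear_on_def
    proof (intro conjI ballI allI exI)
      show "norm (blinfun_apply (u \<phi>) x) \<le> (c * norm x) * norm \<phi>" if "\<phi> \<in> dual t" for \<phi>
      proof -
        have "norm (blinfun_apply (u \<phi>) x) \<le> norm (u \<phi>) * norm x"
          by (rule norm_blinfun)
        also have "\<dots> \<le> (c * norm \<phi>) * norm x"
          by (intro mult_right_mono c that norm_ge_zero)
        finally show ?thesis
          by (simp add: mult_ac)
      qed
    qed (simp_all add: bounded_linear_onD[OF u(1)] blinfun.add_left)
    then show ?thesis
      using refl unfolding reflexive_def by blast
  qed
  then obtain v where v: "\<And>x \<phi>. \<phi> \<in> dual t \<Longrightarrow> blinfun_apply \<phi> (v x) = blinfun_apply (u \<phi>) x"
    by metis
  have v_add: "v (x + y) = v x + v y" for x y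
    by (rule t.eq_if_dual_eq) (simp add: v blinfun.add_right)
  have v_scale: "v (s c x) = t c (v x)" for c x
    by (rule t.eq_if_dual_eq) (simp add: v u(2) dual_scale_right)
  have v_norm: "norm (v x) \<le> c * norm x" for x
  proof (rule t.norm_le_if_dual)
    fix \<phi>
    assume \<phi>: "\<phi> \<in> dual t" "norm \<phi> \<le> 1"
    have "norm (blinfun_apply (u \<phi>) x) \<le> norm (u \<phi>) * norm x"
      by (rule norm_blinfun)
    also have "\<dots> \<le> (c * norm \<phi>) * norm x"
      by (intro mult_right_mono c \<phi> norm_ge_zero)
    also have "\<dots> \<le> (c * 1) * norm x"
      by (intro mult_right_mono mult_left_mono \<phi> c norm_ge_zero)
    finally show "norm (blinfun_apply \<phi> (v x)) \<le> c * norm x"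
      by (simp add: v[OF \<phi>(1)])
  qed
  have "bounded_linear v"
    using v_add v_norm v_scale[of "of_real _"]
    by (intro bounded_linear_intro[where K = c]) (auto simp: s.scale_of_real t.scale_of_real mult.commute)
  then have app: "blinfun_apply (Blinfun v) = v"
    by (rule bounded_linear_Blinfun_apply)
  show thesis
  proof (rule that)
    show "Blinfun v \<in> L s t"
      by (simp add: L_def app v_scale)
    show "norm (Blinfun v) \<le> c"
      by (rule norm_blinfun_bound) (simp_all add: app c v_norm)
  qed (simp add: app v)
qed

text \<open>
  The local distance gives complemented subspaces of the duals and an isomorphism \<open>\<psi>\<close> between them.
  The maps \<open>\<psi> \<circ> P\<close> and \<open>\<psi>\<^sup>-\<^sup>1 \<circ> Q\<close>, where \<open>P\<close> and \<open>Q\<close> are the projections of the duals, are defined on the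
  whole duals; by reflexivity they are the adjoints of operators \<open>V\<close> and \<open>U\<close>. The properties of \<open>V U\<close> and \<open>U V\<close>
  are those of \<open>P\<close> and \<open>Q\<close>.
\<close>

lemma local_dist_operators:
  fixes s :: "'k::real_or_complex \<Rightarrow> 'a::banach \<Rightarrow> 'a" and t :: "'k \<Rightarrow> 'b::banach \<Rightarrow> 'b"
  assumes s: "banach_over s" and t: "banach_over t" and refl: "reflexive s" "reflexive t"
    and C: "0 \<le> C"
    and ld: "local_dist K C dual_scale (dual s) dual_scale (dual t) n < ennreal r"
    and M: "finite \<Phi>" "card \<Phi> \<le> n" "\<Phi> \<subseteq> dual s"
    and M': "finite \<Phi>'" "card \<Phi>' \<le> n" "\<Phi>' \<subseteq> dual t"
  obtains U V where "U \<in> L s t" "V \<in> L t s"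
    "\<And>x. blinfun_apply U (blinfun_apply V (blinfun_apply U x)) = blinfun_apply U x"
    "\<And>y. blinfun_apply V (blinfun_apply U (blinfun_apply V y)) = blinfun_apply V y"
    "norm (V o\<^sub>L U) \<le> C" "norm (U o\<^sub>L V) \<le> C" "norm U * norm V \<le> C\<^sup>2 * r"
    "finite_rank s s (K n) (V o\<^sub>L U)" "finite_rank t t (K n) (U o\<^sub>L V)"
    "\<And>\<phi>. \<phi> \<in> module.span dual_scale \<Phi> \<Longrightarrow> \<phi> o\<^sub>L (V o\<^sub>L U) = \<phi>"
    "\<And>\<phi>. \<phi> \<in> module.span dual_scale \<Phi>' \<Longrightarrow> \<phi> o\<^sub>L (U o\<^sub>L V) = \<phi>"
proof -
  interpret s: banach_over s by fact
  interpret t: banach_over t by fact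
  interpret ds: vector_space "dual_scale :: 'k \<Rightarrow> ('a \<Rightarrow>\<^sub>L 'k) \<Rightarrow> _"
    by (rule vector_space_dual_scale)
  interpret dt: vector_space "dual_scale :: 'k \<Rightarrow> ('b \<Rightarrow>\<^sub>L 'k) \<Rightarrow> _"
    by (rule vector_space_dual_scale)
  have spanM: "ds.span \<Phi> \<subseteq> dual s" "fin_dim_subspace dual_scale (ds.span \<Phi>)" "ds.dim (ds.span \<Phi>) \<le> n"
    using M subspace_dual[of s] ds.dim_le_card'[of \<Phi>]
    by (auto simp: ds.span_minimal fin_dim_subspace_def intro: ds.span_minimal[THEN subsetD])
  have spanM': "dt.span \<Phi>' \<subseteq> dual t" "fin_dim_subspace dual_scale (dt.span \<Phi>')"
      "dt.dim (dt.span \<Phi>') \<le> n"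
    using M' subspace_dual[of t] dt.dim_le_card'[of \<Phi>']
    by (auto simp: dt.span_minimal fin_dim_subspace_def intro: dt.span_minimal[THEN subsetD])
  obtain r' where r': "ennreal r' < ennreal r" and *: "\<And>M M'. M \<subseteq> dual s \<and> fin_dim_subspace dual_scale M \<and> ds.dim M \<le> n \<and>
               M' \<subseteq> dual t \<and> fin_dim_subspace dual_scale M' \<and> dt.dim M' \<le> n \<longrightarrow>
          (\<exists>N N'. complemented dual_scale (dual s) C N \<and> fin_dim_subspace dual_scale N \<and> M \<subseteq> N \<and>
                  complemented dual_scale (dual t) C N' \<and> fin_dim_subspace dual_scale N' \<and> M' \<subseteq> N' \<and>
                  ds.dim N = dt.dim N' \<and>
                  dt.dim N' \<le> K n \<and>
                  bm_dist dual_scale dual_scale N N' \<le> ennreal r')"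
    using ld unfolding local_dist_def Inf_less_iff by blast
  obtain N N' where NC: "complemented dual_scale (dual s) C N" "complemented dual_scale (dual t) C N'"
    and N: "fin_dim_subspace dual_scale N" "fin_dim_subspace dual_scale N'"
    and sub: "ds.span \<Phi> \<subseteq> N" "dt.span \<Phi>' \<subseteq> N'"
    and dim: "ds.dim N \<le> K n" "dt.dim N' \<le> K n"
    and bm: "bm_dist dual_scale dual_scale N N' \<le> ennreal r'"
    using *[of "ds.span \<Phi>" "dt.span \<Phi>'"] spanM spanM' by (metis (no_types, lifting))
  from bm r' have "bm_dist dual_scale dual_scale N N' < ennreal r"
    by (rule order.strict_trans1)
  then obtain \<psi> where iso: "isomorphism_on dual_scale dual_scale N N' \<psi>"
    and iso_norm: "onorm_on N \<psi> * onorm_on N' (inv_into N \<psi>) < r"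
    by (rule bm_dist_less_obtain)
  define \<theta> where "\<theta> = inv_into N \<psi>"
  obtain P where P: "projection_onto dual_scale (dual s) N P" "onorm_on (dual s) P \<le> C"
      and Ns: "N \<subseteq> dual s" "ds.subspace N"
    using NC(1) unfolding complemented_def by blast
  obtain Q where Q: "projection_onto dual_scale (dual t) N' Q" "onorm_on (dual t) Q \<le> C"
      and Nt: "N' \<subseteq> dual t" "dt.subspace N'"
    using NC(2) unfolding complemented_def by blast
  note Pb = projection_ontoD(1)[OF P(1)] and Qb = projection_ontoD(1)[OF Q(1)]
  note Pin = projection_ontoD(2)[OF P(1)] and Qin = projection_ontoD(2)[OF Q(1)]
  note Pid = projection_ontoD(3)[OF P(1) Ns(1)] and Qid = projection_ontoD(3)[OF Q(1) Nt(1)]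
  note iso' = isomorphism_onD[OF iso, folded \<theta>_def]
  have P_norm: "norm (P \<phi>) \<le> C * norm \<phi>" if "\<phi> \<in> dual s" for \<phi>
    using onorm_on_bound[OF Pb that] mult_right_mono[OF P(2), of "norm \<phi>"] by simp
  have Q_norm: "norm (Q \<phi>) \<le> C * norm \<phi>" if "\<phi> \<in> dual t" for \<phi>
    using onorm_on_bound[OF Qb that] mult_right_mono[OF Q(2), of "norm \<phi>"] by simp
  define a where "a = onorm_on N \<psi>"
  define b where "b = onorm_on N' \<theta>"
  have a: "0 \<le> a" "\<And>\<phi>. \<phi> \<in> N \<Longrightarrow> norm (\<psi> \<phi>) \<le> a * norm \<phi>"
    unfolding a_def using onorm_on_nonneg[OF iso'(2) ds.subspace_0[OF Ns(2)]] onorm_on_bound[OF iso'(2)]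
    by auto
  have b: "0 \<le> b" "\<And>\<phi>. \<phi> \<in> N' \<Longrightarrow> norm (\<theta> \<phi>) \<le> b * norm \<phi>"
    unfolding b_def using onorm_on_nonneg[OF iso'(3) dt.subspace_0[OF Nt(2)]] onorm_on_bound[OF iso'(3)]
    by auto
  have u_norm: "norm (\<psi> (P \<phi>)) \<le> (a * C) * norm \<phi>" if "\<phi> \<in> dual s" for \<phi>
    using a(2)[OF Pin[OF that]] mult_left_mono[OF P_norm[OF that] a(1)] by simp
  have v_norm: "norm (\<theta> (Q \<phi>)) \<le> (b * C) * norm \<phi>" if "\<phi> \<in> dual t" for \<phi>
    using b(2)[OF Qin[OF that]] mult_left_mono[OF Q_norm[OF that] b(1)] by simp
  have u_bl: "bounded_linear_on dual_scale dual_scale (dual s) (\<lambda>\<phi>. \<psi> (P \<phi>))"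
    unfolding bounded_linear_on_def using u_norm
    by (auto simp: bounded_linear_onD[OF Pb] bounded_linear_onD[OF iso'(2)] Pin)
  have v_bl: "bounded_linear_on dual_scale dual_scale (dual t) (\<lambda>\<phi>. \<theta> (Q \<phi>))"
    unfolding bounded_linear_on_def using v_norm
    by (auto simp: bounded_linear_onD[OF Qb] bounded_linear_onD[OF iso'(3)] Qin)
  obtain V where V: "V \<in> L t s" "norm V \<le> a * C"
    and V_adj: "\<And>\<phi> x. \<phi> \<in> dual s \<Longrightarrow> blinfun_apply \<phi> (blinfun_apply V x) = blinfun_apply (\<psi> (P \<phi>)) x"
    using adjoint_if_reflexive[OF t s refl(1) u_bl _ _ u_norm] Nt iso'(4) Pin a(1) C
    by (metis mult_nonneg_nonneg subsetD)
  obtain U where U: "U \<in> L s t" "norm U \<le> b * C"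
    and U_adj: "\<And>\<phi> x. \<phi> \<in> dual t \<Longrightarrow> blinfun_apply \<phi> (blinfun_apply U x) = blinfun_apply (\<theta> (Q \<phi>)) x"
    using adjoint_if_reflexive[OF s t refl(2) v_bl _ _ v_norm] Ns iso'(6) Qin b(1) C
    by (metis mult_nonneg_nonneg subsetD)
  have uN: "\<psi> (P \<phi>) \<in> dual t" "\<psi> (P \<phi>) \<in> N'" if "\<phi> \<in> dual s" for \<phi>
    using Nt(1) iso'(4) Pin that by auto
  have vN: "\<theta> (Q \<phi>) \<in> dual s" "\<theta> (Q \<phi>) \<in> N" if "\<phi> \<in> dual t" for \<phi>
    using Ns(1) iso'(6) Qin that by auto
  have VU_adj: "blinfun_apply \<phi> (blinfun_apply V (blinfun_apply U x)) = blinfun_apply (P \<phi>) x" if "\<phi> \<in> dual s" for \<phi> x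
    using that by (simp add: V_adj U_adj uN Qid iso'(5) Pin)
  have UV_adj: "blinfun_apply \<phi> (blinfun_apply U (blinfun_apply V y)) = blinfun_apply (Q \<phi>) y" if "\<phi> \<in> dual t" for \<phi> y
    using that by (simp add: V_adj U_adj vN Pid iso'(7) Qin)
  show thesis
  proof (rule that[of U V])
    show "blinfun_apply U (blinfun_apply V (blinfun_apply U x)) = blinfun_apply U x" for x
      by (rule t.eq_if_dual_eq) (simp add: U_adj VU_adj vN Pid)
    show "blinfun_apply V (blinfun_apply U (blinfun_apply V y)) = blinfun_apply V y" for y
      by (rule s.eq_if_dual_eq) (simp add: V_adj UV_adj uN Qid)
    show "norm (V o\<^sub>L U) \<le> C"
    proof (rule norm_blinfun_bound[OF C], simp, rule s.norm_le_if_dual)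
      fix x \<phi>
      assume \<phi>: "\<phi> \<in> dual s" "norm \<phi> \<le> 1"
      have "norm (blinfun_apply (P \<phi>) x) \<le> norm (P \<phi>) * norm x"
        by (rule norm_blinfun)
      also have "\<dots> \<le> C * norm x"
        using P_norm[OF \<phi>(1)] mult_left_mono[OF \<phi>(2) C] by (intro mult_right_mono) auto
      finally show "norm (blinfun_apply \<phi> (blinfun_apply V (blinfun_apply U x))) \<le> C * norm x"
        by (simp add: VU_adj[OF \<phi>(1)])
    qed
    show "norm (U o\<^sub>L V) \<le> C"
    proof (rule norm_blinfun_bound[OF C], simp, rule t.norm_le_if_dual)
      fix x \<phi>
      assume \<phi>: "\<phi> \<in> dual t" "norm \<phi> \<le> 1"
      have "norm (blinfun_apply (Q \<phi>) x) \<le> norm (Q \<phi>) * norm x"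
        by (rule norm_blinfun)
      also have "\<dots> \<le> C * norm x"
        using Q_norm[OF \<phi>(1)] mult_left_mono[OF \<phi>(2) C] by (intro mult_right_mono) auto
      finally show "norm (blinfun_apply \<phi> (blinfun_apply U (blinfun_apply V x))) \<le> C * norm x"
        by (simp add: UV_adj[OF \<phi>(1)])
    qed
    have "norm U * norm V \<le> (b * C) * (a * C)"
      by (intro mult_mono U V) (use b(1) C in auto)
    also have "\<dots> = C\<^sup>2 * (a * b)"
      by (simp add: power2_eq_square)
    also have "\<dots> \<le> C\<^sup>2 * r"
      using iso_norm by (intro mult_left_mono) (auto simp: a_def b_def \<theta>_def)
    finally show "norm U * norm V \<le> C\<^sup>2 * r" .
    have VU: "\<phi> o\<^sub>L (V o\<^sub>L U) = P \<phi>" if "\<phi> \<in> dual s" for \<phi>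
      by (rule blinfun_eqI) (simp add: VU_adj[OF that])
    have UV: "\<phi> o\<^sub>L (U o\<^sub>L V) = Q \<phi>" if "\<phi> \<in> dual t" for \<phi>
      by (rule blinfun_eqI) (simp add: UV_adj[OF that])
    show "finite_rank s s (K n) (V o\<^sub>L U)"
      by (rule s.finite_rank_if_fin_dim_adjoint[OF s L_compose[OF U(1) V(1)] N(1) Ns(1) dim(1)])
        (simp add: VU Pin)
    show "finite_rank t t (K n) (U o\<^sub>L V)"
      by (rule t.finite_rank_if_fin_dim_adjoint[OF t L_compose[OF V(1) U(1)] N(2) Nt(1) dim(2)])
        (simp add: UV Qin)
    show "\<phi> o\<^sub>L (V o\<^sub>L U) = \<phi>" if "\<phi> \<in> ds.span \<Phi>" for \<phi>
      using VU Pid that sub(1) Ns(1) by (metis subsetD)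
    show "\<phi> o\<^sub>L (U o\<^sub>L V) = \<phi>" if "\<phi> \<in> dt.span \<Phi>'" for \<phi>
      using UV Qid that sub(2) Nt(1) by (metis subsetD)
  qed (rule U V)+
qed

text \<open>
  Property (D) for the range of \<open>E\<close>. The isomorphism of the two ranges is composed with the projections,
  so that \<open>\<sigma>\<close> and \<open>\<sigma>'\<close> are operators on the whole space.
\<close>

lemma property_D_operators:
  fixes t :: "'k::real_or_complex \<Rightarrow> 'b::banach \<Rightarrow> 'b"
  assumes t: "banach_over t" and D: "property_D t f d D"
    and E: "E \<in> L t t" "\<And>y. blinfun_apply E (blinfun_apply E y) = blinfun_apply E y" "E \<noteq> 0"
      "finite_rank t t r E"
  obtains F \<sigma> \<sigma>' where "F \<in> L t t" "\<sigma> \<in> L t t" "\<sigma>' \<in> L t t" "finite_rank t t r F"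
    "\<And>y. blinfun_apply F (blinfun_apply F y) = blinfun_apply F y" "F \<noteq> 0"
    "\<And>y. blinfun_apply E (blinfun_apply F y) = 0" "\<And>y. blinfun_apply F (blinfun_apply E y) = 0"
    "\<And>y. blinfun_apply \<sigma>' (blinfun_apply \<sigma> y) = blinfun_apply E y"
    "\<And>y. blinfun_apply \<sigma> (blinfun_apply \<sigma>' y) = blinfun_apply F y"
    "\<And>y. blinfun_apply F (blinfun_apply \<sigma> y) = blinfun_apply \<sigma> y"
    "\<And>y. blinfun_apply \<sigma>' (blinfun_apply F y) = blinfun_apply \<sigma>' y"
    "norm F \<le> D * norm E powr d" "norm \<sigma> * norm \<sigma>' \<le> 2 * f r * norm E * norm F"
proof -
  interpret t: banach_over t by fact
  define M where "M = range (blinfun_apply E)"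
  have vs: "vector_space t"
    by unfold_locales
  have M: "fin_dim_subspace t M" "t.dim M \<le> r" and M_sub: "t.subspace M"
    unfolding M_def using t.fin_dim_range_if_finite_rank[OF vs E(1,4)] t.subspace_range_L[OF vs E(1)]
    by auto
  define n where "n = t.dim M"
  have n: "1 \<le> n"
  proof -
    obtain B where B: "finite B" "t.independent B" "t.span B = M" "card B = n"
      using t.fin_dim_subspace_basis[OF M(1)] n_def by metis
    have "B \<noteq> {}"
    proof
      assume "B = {}"
      then have "blinfun_apply E y = 0" for y
        using B(3) by (auto simp: M_def)
      with E(3) show False
        by (metis blinfun_eqI zero_blinfun.rep_eq)
    qed
    with B show ?thesis
      by (metis card_gt_0_iff less_eq_Suc_le One_nat_def)
  qed
  have ME: "projection_onto t UNIV M (blinfun_apply E)"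
    unfolding projection_onto_def bounded_linear_on_def M_def
    using norm_blinfun[of E] by (auto simp: blinfun.add_right L_scale[OF E(1)] E(2))
  have E_norm: "onorm_on UNIV (blinfun_apply E) \<le> norm E"
    by (rule onorm_on_le) (auto simp: norm_blinfun)
  have "complemented t UNIV (norm E) M"
    unfolding complemented_def using ME E_norm M_sub by blast
  then obtain N Q where N: "fin_dim_subspace t N" "t.dim N = n" and Q: "projection_onto t UNIV N Q"
    and Q_norm: "onorm_on UNIV Q \<le> D * norm E powr d"
    and EQ: "\<And>x. blinfun_apply E (Q x) = 0" and QE: "\<And>x. Q (blinfun_apply E x) = 0"
    and bm: "bm_dist t t M N \<le> ennreal (f n)"
    using D M(1) ME E_norm n n_def unfolding property_D_def by metis
  have f: "0 < f n" "f n \<le> f r"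
    using D n M(2) mono_onD[of "{1..}" f n r] unfolding property_D_def n_def by auto
  have N_sub: "t.subspace N"
    using N(1) unfolding fin_dim_subspace_def by blast
  note Qb = projection_ontoD(1)[OF Q] and Qin = projection_ontoD(2)[OF Q UNIV_I]
    and Qid = projection_ontoD(3)[OF Q subset_UNIV]
  define F where "F = Blinfun Q"
  have F: "blinfun_apply F = Q"
    unfolding F_def using t.bounded_linear_if_bounded_linear_on[OF t Qb]
    by (rule bounded_linear_Blinfun_apply)
  have F_norm: "norm F \<le> onorm_on UNIV Q"
    using onorm_on_bound[OF Qb] onorm_on_nonneg[OF Qb]
    by (intro norm_blinfun_bound) (auto simp: F)
  have FL: "F \<in> L t t"
    by (simp add: L_def F bounded_linear_onD[OF Qb])
  have "bm_dist t t M N < ennreal (2 * f n)"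
    using bm f(1) by (intro order.strict_trans1[OF bm]) (simp add: ennreal_less_iff)
  then obtain \<psi> where iso: "isomorphism_on t t M N \<psi>"
    and iso_norm: "onorm_on M \<psi> * onorm_on N (inv_into M \<psi>) < 2 * f n"
    by (rule bm_dist_less_obtain)
  define \<theta> where "\<theta> = inv_into M \<psi>"
  note iso' = isomorphism_onD[OF iso, folded \<theta>_def]
  define a where "a = onorm_on M \<psi>"
  define b where "b = onorm_on N \<theta>"
  have a: "0 \<le> a" "\<And>y. y \<in> M \<Longrightarrow> norm (\<psi> y) \<le> a * norm y"
    unfolding a_def using onorm_on_nonneg[OF iso'(2) t.subspace_0[OF M_sub]] onorm_on_bound[OF iso'(2)]
    by auto
  have b: "0 \<le> b" "\<And>y. y \<in> N \<Longrightarrow> norm (\<theta> y) \<le> b * norm y"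
    unfolding b_def using onorm_on_nonneg[OF iso'(3) t.subspace_0[OF N_sub]] onorm_on_bound[OF iso'(3)]
    by auto
  have Ein: "blinfun_apply E y \<in> M" for y
    by (simp add: M_def)
  have Eid: "blinfun_apply E y = y" if "y \<in> M" for y
    using that E(2) by (auto simp: M_def)
  have \<sigma>_norm: "norm (\<psi> (blinfun_apply E y)) \<le> (a * norm E) * norm y" for y
    using a(2)[OF Ein, of y] mult_left_mono[OF norm_blinfun[of E y] a(1)] by simp
  have \<sigma>'_norm: "norm (\<theta> (Q y)) \<le> (b * norm F) * norm y" for y
    using b(2)[OF Qin, of y] mult_left_mono[OF norm_blinfun[of F y] b(1)] by (simp add: F)
  have "bounded_linear_on t t UNIV (\<lambda>y. \<psi> (blinfun_apply E y))"
    unfolding bounded_linear_on_def using \<sigma>_norm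
    by (auto simp: blinfun.add_right L_scale[OF E(1)] bounded_linear_onD[OF iso'(2)] Ein)
  then have \<sigma>_bl: "bounded_linear (\<lambda>y. \<psi> (blinfun_apply E y))"
    by (rule t.bounded_linear_if_bounded_linear_on[OF t])
  have "bounded_linear_on t t UNIV (\<lambda>y. \<theta> (Q y))"
    unfolding bounded_linear_on_def using \<sigma>'_norm
    by (auto simp: bounded_linear_onD[OF Qb] bounded_linear_onD[OF iso'(3)] Qin)
  then have \<sigma>'_bl: "bounded_linear (\<lambda>y. \<theta> (Q y))"
    by (rule t.bounded_linear_if_bounded_linear_on[OF t])
  define \<sigma> where "\<sigma> = Blinfun (\<lambda>y. \<psi> (blinfun_apply E y))"
  define \<sigma>' where "\<sigma>' = Blinfun (\<lambda>y. \<theta> (Q y))"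
  have \<sigma>: "blinfun_apply \<sigma> y = \<psi> (blinfun_apply E y)" for y
    by (simp add: \<sigma>_def bounded_linear_Blinfun_apply[OF \<sigma>_bl])
  have \<sigma>': "blinfun_apply \<sigma>' y = \<theta> (Q y)" for y
    by (simp add: \<sigma>'_def bounded_linear_Blinfun_apply[OF \<sigma>'_bl])
  show thesis
  proof (rule that[of F \<sigma> \<sigma>'])
    show "\<sigma> \<in> L t t"
      by (simp add: L_def \<sigma> L_scale[OF E(1)] bounded_linear_onD[OF iso'(2)] Ein)
    show "\<sigma>' \<in> L t t"
      by (simp add: L_def \<sigma>' bounded_linear_onD[OF Qb] bounded_linear_onD[OF iso'(3)] Qin)
    show "finite_rank t t r F"
      using t.finite_rank_if_fin_dim_range[OF FL N(1), of r] N(2) M(2) Qin by (auto simp: F n_def)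
    show "F \<noteq> 0"
    proof
      assume "F = 0"
      then have "N \<subseteq> t.span {}"
        using Qid by (auto simp flip: F)
      then have "t.dim N \<le> card ({} :: 'b set)"
        by (rule t.dim_le_card) simp
      with N(2) n show False
        by simp
    qed
    show "norm F \<le> D * norm E powr d"
      using F_norm Q_norm by simp
    have "norm \<sigma> * norm \<sigma>' \<le> (a * norm E) * (b * norm F)"
      using \<sigma>_norm \<sigma>'_norm a(1) b(1)
      by (intro mult_mono norm_blinfun_bound) (auto simp: \<sigma> \<sigma>')
    also have "\<dots> = (a * b) * (norm E * norm F)"
      by simp
    also have "\<dots> \<le> (2 * f r) * (norm E * norm F)"
      using iso_norm f by (intro mult_right_mono) (auto simp: a_def b_def \<theta>_def)
    finally show "norm \<sigma> * norm \<sigma>' \<le> 2 * f r * norm E * norm F"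
      by (simp add: mult.assoc)
  qed (simp_all add: FL F \<sigma> \<sigma>' E(2) EQ QE Qid Qin Eid Ein iso'(4-7))
qed

section \<open>One step of the construction\<close>

lemma norm_idempotent_ge_1:
  fixes E :: "'a::real_normed_vector \<Rightarrow>\<^sub>L 'a"
  assumes "\<And>x. blinfun_apply E (blinfun_apply E x) = blinfun_apply E x" "E \<noteq> 0"
  shows "1 \<le> norm E"
proof -
  have "E o\<^sub>L E = E"
    using assms(1) by (intro blinfun_eqI) simp
  then have "norm E \<le> norm E * norm E"
    using norm_blinfun_compose[of E E] by simp
  with assms(2) show ?thesis
    by simp
qed

text \<open>
  To put \<open>y\<close> into the range, add a projection of rank one onto the line of \<open>y' = y - Q y\<close> which vanishes on the
  range of \<open>Q\<close>. Starting from a functional that attains its norm at \<open>y'\<close> bounds the norm of the added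
  operator by \<open>1 + norm Q\<close>.
\<close>

lemma (in banach_over) extend_projection:
  assumes Q: "Q \<in> L s s" "\<And>x. blinfun_apply Q (blinfun_apply Q x) = blinfun_apply Q x"
    and q: "finite_rank s s q Q"
  obtains Q' where "Q' \<in> L s s" "\<And>x. blinfun_apply Q' (blinfun_apply Q' x) = blinfun_apply Q' x"
    "finite_rank s s (q + 1) Q'" "blinfun_apply Q' y = y"
    "\<And>x. blinfun_apply Q' (blinfun_apply Q x) = blinfun_apply Q x"
    "\<And>x. blinfun_apply Q (blinfun_apply Q' x) = blinfun_apply Q x"
    "norm Q' \<le> 1 + 2 * norm Q"
proof (cases "blinfun_apply Q y = y")
  case True
  show thesis
    using finite_rank_mono[OF q, of "q + 1"] True by (intro that[of Q]) (auto simp: Q)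
next
  case False
  define y' where "y' = y - blinfun_apply Q y"
  have y': "y' \<noteq> 0" "blinfun_apply Q y' = 0"
    using False by (auto simp: y'_def blinfun.diff_right Q)
  obtain \<phi> where \<phi>: "\<phi> \<in> dual s" "norm \<phi> \<le> 1" "blinfun_apply \<phi> y' = of_real (norm y')"
    using norming_functional by blast
  define \<theta> where "\<theta> = dual_scale (of_real (1 / norm y')) (\<phi> - (\<phi> o\<^sub>L Q))"
  define R where "R = rank_one s \<theta> y'"
  have \<theta>: "\<theta> \<in> dual s"
    unfolding \<theta>_def by (intro dual_subspaceD dual_compose[OF Q(1)] \<phi>(1))
  have \<theta>y': "blinfun_apply \<theta> y' = 1" "blinfun_apply \<theta> y = 1"
    using y' \<phi>(3) by (simp_all add: \<theta>_def blinfun.diff_left flip: y'_def blinfun.diff_right of_real_mult)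
  have \<theta>Q: "blinfun_apply \<theta> (blinfun_apply Q x) = 0" for x
    by (simp add: \<theta>_def blinfun.diff_left Q(2))
  have R_norm: "norm R \<le> 1 + norm Q"
  proof (rule norm_blinfun_bound)
    fix x
    have "norm (blinfun_apply R x) = norm (blinfun_apply \<phi> (x - blinfun_apply Q x))"
      using y' by (simp add: R_def \<theta>_def norm_scale norm_mult blinfun.diff_left norm_divide blinfun.diff_right)
    also have "\<dots> \<le> norm \<phi> * norm (x - blinfun_apply Q x)"
      by (rule norm_blinfun)
    also have "\<dots> \<le> 1 * (norm x + norm Q * norm x)"
      using norm_blinfun[of Q x] norm_triangle_ineq4[of x "blinfun_apply Q x"]
      by (intro mult_mono \<phi>(2)) auto
    finally show "norm (blinfun_apply R x) \<le> (1 + norm Q) * norm x"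
      by (simp add: algebra_simps)
  qed simp
  show thesis
  proof (rule that[of "Q + R"])
    show "Q + R \<in> L s s"
      unfolding R_def by (intro L_add Q rank_one_in_L \<theta>)
    show "finite_rank s s (q + 1) (Q + R)"
      unfolding R_def by (intro finite_rank_add q finite_rank_rank_one \<theta>)
    show "norm (Q + R) \<le> 1 + 2 * norm Q"
      using norm_triangle_ineq[of Q R] R_norm by simp
    show "blinfun_apply (Q + R) y = y"
      by (simp add: blinfun.add_left R_def \<theta>y' y'_def)
    show "blinfun_apply (Q + R) (blinfun_apply (Q + R) x) = blinfun_apply (Q + R) x" for x
      by (simp add: blinfun.add_left blinfun.add_right R_def \<theta>y' \<theta>Q Q y'
          L_scale[OF Q(1)] dual_scale_right[OF \<theta>])
    show "blinfun_apply (Q + R) (blinfun_apply Q x) = blinfun_apply Q x" for x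
      by (simp add: blinfun.add_left R_def \<theta>Q Q)
    show "blinfun_apply Q (blinfun_apply (Q + R) x) = blinfun_apply Q x" for x
      by (simp add: blinfun.add_left blinfun.add_right R_def Q y' L_scale[OF Q(1)])
  qed
qed

text \<open>
  If \<open>P R = P\<close>, that is, if the adjoint of \<open>R\<close> fixes all functionals that factor through \<open>P\<close>, then
  \<open>P + R (1 - P)\<close> is a projection with the same kernel as \<open>R\<close> which also commutes with \<open>P\<close>. Its norm is linear in
  the norm of \<open>P\<close>, which keeps the growth exponential over many steps.
\<close>

lemma (in banach_over) join_projections:
  assumes P: "P \<in> L s s" "\<And>x. blinfun_apply P (blinfun_apply P x) = blinfun_apply P x"
    and R: "R \<in> L s s" "\<And>x. blinfun_apply R (blinfun_apply R x) = blinfun_apply R x"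
    and PR: "\<And>x. blinfun_apply P (blinfun_apply R x) = blinfun_apply P x"
    and r: "finite_rank s s r R" "norm R \<le> C"
  obtains P' where "P' \<in> L s s" "\<And>x. blinfun_apply P' (blinfun_apply P' x) = blinfun_apply P' x"
    "\<And>x. blinfun_apply P' (blinfun_apply P x) = blinfun_apply P x"
    "\<And>x. blinfun_apply P (blinfun_apply P' x) = blinfun_apply P x"
    "\<And>x. blinfun_apply P' (blinfun_apply R x) = blinfun_apply P' x"
    "\<And>x. blinfun_apply R (blinfun_apply P' x) = blinfun_apply R x"
    "\<And>x. blinfun_apply P' x = blinfun_apply P x + blinfun_apply R (x - blinfun_apply P x)"
    "finite_rank s s r P'" "norm P' \<le> norm P + C * (1 + norm P)"
proof -
  define P' where "P' = P + (R o\<^sub>L (id_blinfun - P))"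
  have P': "blinfun_apply P' x = blinfun_apply P x + blinfun_apply R (x - blinfun_apply P x)" for x
    by (simp add: P'_def blinfun.add_left blinfun.diff_left)
  have P'R: "blinfun_apply P' (blinfun_apply R x) = blinfun_apply P' x" for x
    by (simp add: P' PR R blinfun.diff_right)
  show thesis
  proof (rule that[of P'])
    show L: "P' \<in> L s s"
      unfolding P'_def by (intro L_add L_compose[OF _ R(1)] L_diff L_id P(1))
    have "P' = P' o\<^sub>L R"
      by (rule blinfun_eqI) (simp add: P'R)
    then show "finite_rank s s r P'"
      using finite_rank_compose_left[OF r(1) L] by simp
    have "norm (R o\<^sub>L (id_blinfun - P)) \<le> norm R * norm (id_blinfun - P :: 'a \<Rightarrow>\<^sub>L 'a)"
      by (rule norm_blinfun_compose)
    also have "\<dots> \<le> C * (1 + norm P)"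
      using r(2) norm_triangle_ineq4[of id_blinfun P] norm_blinfun_id_le[where 'a = 'a]
        order_trans[OF norm_ge_zero r(2)]
      by (intro mult_mono) (auto intro: order_trans)
    finally show "norm P' \<le> norm P + C * (1 + norm P)"
      unfolding P'_def using norm_triangle_ineq[of P "R o\<^sub>L (id_blinfun - P)"] by simp
  qed (simp_all add: P' P'R PR P R blinfun.diff_right blinfun.add_right)
qed

text \<open>
  Functionals separate points, so an operator may be tested on the functionals that factor through it.
\<close>

lemma L_eq_compose_if_dual:
  assumes t: "banach_over t" and G: "G \<in> L s t" 
    and "\<And>\<phi>. \<phi> \<in> dual t \<Longrightarrow> (\<phi> o\<^sub>L G) o\<^sub>L R = \<phi> o\<^sub>L G"
  shows "blinfun_apply G (blinfun_apply R x) = blinfun_apply G x"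
proof -
  interpret t: banach_over t by fact
  show ?thesis
    using assms(3) by (intro t.eq_if_dual_eq) (metis blinfun_apply_blinfun_compose)
qed

text \<open>
  One step of the recursion. The projection \<open>Q\<close> is extended to \<open>Q1\<close>, whose range contains \<open>y\<close>. The
  local distance is applied to the functionals that factor through \<open>P\<close> or \<open>S\<close>, to one further functional
  that vanishes on the range of \<open>P\<close> (it forces \<open>P' \<noteq> P\<close>), and on the other side to those that factor
  through \<open>Q1\<close>. Joining the resulting projections to \<open>P\<close> and to \<open>Q1\<close> gives \<open>P'\<close> on \<open>X\<close> and \<open>E\<close> on \<open>Y\<close>.
  Property (D) turns \<open>E\<close> into an orthogonal copy \<open>F\<close>. Then \<open>Q' = E + F\<close>, and the pair \<open>U\<close>, \<open>V\<close> is transported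
  to the range of \<open>F\<close>, which is orthogonal to \<open>Q\<close>: \<open>A = \<sigma> U\<close> and \<open>B = V \<sigma>'\<close>. The number \<open>e\<close> bounds the norm
  of \<open>E\<close>, and \<open>D e\<^sup>d\<close> that of \<open>F\<close>.
\<close>

lemma factorization_step:
  fixes s :: "'k::real_or_complex \<Rightarrow> 'a::banach \<Rightarrow> 'a" and t :: "'k \<Rightarrow> 'b::banach \<Rightarrow> 'b"
  assumes s: "banach_over s" and t: "banach_over t" and refl: "reflexive s" "reflexive t"
    and C: "1 \<le> C" and d: "1 \<le> d" "d' \<le> d" and D': "D' \<le> D"
    and D: "property_D t f d' D'"
    and ld: "local_dist K C dual_scale (dual s) dual_scale (dual t) n < ennreal r"
    and P: "P \<in> L s s" "\<And>x. blinfun_apply P (blinfun_apply P x) = blinfun_apply P x"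
      "finite_rank s s p P"
    and Q: "Q \<in> L t t" "\<And>y. blinfun_apply Q (blinfun_apply Q y) = blinfun_apply Q y"
      "finite_rank t t q Q"
    and S: "S \<in> L s s" "finite_rank s s m S"
    and dims: "p + m + 1 \<le> n" "q + 1 \<le> n" "K n \<le> N"
    and x0: "blinfun_apply P x0 \<noteq> x0"
    and f_N: "1 \<le> N"
  defines "e \<equiv> (1 + C) * (1 + 2 * norm Q) + C"
  obtains P' Q' A B where "P' \<in> L s s" "Q' \<in> L t t" "A \<in> L s t" "B \<in> L t s"
    "\<And>x. blinfun_apply P' (blinfun_apply P' x) = blinfun_apply P' x"
    "\<And>x. blinfun_apply P' (blinfun_apply P x) = blinfun_apply P x"
    "\<And>x. blinfun_apply P (blinfun_apply P' x) = blinfun_apply P x"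
    "finite_rank s s N P'" "1 + norm P' \<le> (1 + C) * (1 + norm P)"
    "\<And>x. blinfun_apply S (blinfun_apply P' x) = blinfun_apply S x" "P' \<noteq> P"
    "\<And>x. blinfun_apply Q' (blinfun_apply Q' x) = blinfun_apply Q' x"
    "\<And>x. blinfun_apply Q' (blinfun_apply Q x) = blinfun_apply Q x"
    "\<And>x. blinfun_apply Q (blinfun_apply Q' x) = blinfun_apply Q x"
    "finite_rank t t (2 * N) Q'" "norm Q' \<le> e + D * e powr d" "blinfun_apply Q' y = y"
    "\<And>x. blinfun_apply Q' (blinfun_apply A x) = blinfun_apply A x"
    "\<And>x. blinfun_apply Q (blinfun_apply A x) = 0"
    "\<And>x. blinfun_apply B (blinfun_apply Q' x) = blinfun_apply B x"
    "\<And>x. blinfun_apply B (blinfun_apply Q x) = 0"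
    "\<And>x. blinfun_apply B (blinfun_apply A (blinfun_apply (P' - P) x)) = blinfun_apply (P' - P) x"
    "norm A * norm B \<le> 2 * f N * e * (D * e powr d) * (C\<^sup>2 * r)"
proof -
  interpret s: banach_over s by fact
  interpret t: banach_over t by fact
  interpret ds: vector_space "dual_scale :: 'k \<Rightarrow> ('a \<Rightarrow>\<^sub>L 'k) \<Rightarrow> _"
    by (rule vector_space_dual_scale)
  interpret dt: vector_space "dual_scale :: 'k \<Rightarrow> ('b \<Rightarrow>\<^sub>L 'k) \<Rightarrow> _"
    by (rule vector_space_dual_scale)
  obtain Q1 where Q1: "Q1 \<in> L t t" "\<And>x. blinfun_apply Q1 (blinfun_apply Q1 x) = blinfun_apply Q1 x"
    "finite_rank t t (q + 1) Q1" "blinfun_apply Q1 y = y"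
    "\<And>x. blinfun_apply Q1 (blinfun_apply Q x) = blinfun_apply Q x"
    "\<And>x. blinfun_apply Q (blinfun_apply Q1 x) = blinfun_apply Q x"
    "norm Q1 \<le> 1 + 2 * norm Q"
    using t.extend_projection[OF Q] by blast
  have "x0 - blinfun_apply P x0 \<noteq> 0"
    using x0 by simp
  then obtain \<phi>0 where \<phi>0: "\<phi>0 \<in> dual s" "blinfun_apply \<phi>0 (x0 - blinfun_apply P x0) \<noteq> 0"
    using s.dual_separates by blast
  define \<psi> where "\<psi> = \<phi>0 - (\<phi>0 o\<^sub>L P)"
  \<comment> \<open>\<open>\<psi>\<close> vanishes on the range of \<open>P\<close> but not on that of \<open>P'\<close>.\<close>
  have \<psi>: "\<psi> \<in> dual s" "\<And>x. blinfun_apply \<psi> (blinfun_apply P x) = 0"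
    "blinfun_apply \<psi> (x0 - blinfun_apply P x0) \<noteq> 0"
    using \<phi>0(2) dual_subspaceD(2)[OF \<phi>0(1) dual_compose[OF P(1) \<phi>0(1)]]
    by (simp_all add: \<psi>_def blinfun.diff_left P blinfun.diff_right)
  obtain \<Psi>1 where \<Psi>1: "finite \<Psi>1" "card \<Psi>1 \<le> p" "\<Psi>1 \<subseteq> dual s"
    "\<And>\<phi>. \<phi> \<in> dual s \<Longrightarrow> \<phi> o\<^sub>L P \<in> ds.span \<Psi>1"
    using s.finite_rank_adjoint_subset_span[OF P(3)] by blast
  obtain \<Psi>2 where \<Psi>2: "finite \<Psi>2" "card \<Psi>2 \<le> m" "\<Psi>2 \<subseteq> dual s"
    "\<And>\<phi>. \<phi> \<in> dual s \<Longrightarrow> \<phi> o\<^sub>L S \<in> ds.span \<Psi>2"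
    using s.finite_rank_adjoint_subset_span[OF S(2)] by blast
  obtain \<Psi>3 where \<Psi>3: "finite \<Psi>3" "card \<Psi>3 \<le> q + 1" "\<Psi>3 \<subseteq> dual t"
    "\<And>\<phi>. \<phi> \<in> dual t \<Longrightarrow> \<phi> o\<^sub>L Q1 \<in> dt.span \<Psi>3"
    using t.finite_rank_adjoint_subset_span[OF Q1(3)] by blast
  define \<Phi> where "\<Phi> = insert \<psi> (\<Psi>1 \<union> \<Psi>2)"
  have \<Phi>: "finite \<Phi>" "\<Phi> \<subseteq> dual s"
    using \<Psi>1 \<Psi>2 \<psi> by (auto simp: \<Phi>_def)
  have "card \<Phi> \<le> Suc (card (\<Psi>1 \<union> \<Psi>2))"
    unfolding \<Phi>_def by (rule card_insert_le_m1) auto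
  also have "\<dots> \<le> n"
    using card_Un_le[of \<Psi>1 \<Psi>2] \<Psi>1(2) \<Psi>2(2) dims(1) by simp
  finally have \<Phi>_card: "card \<Phi> \<le> n" .
  obtain U V where U: "U \<in> L s t" and V: "V \<in> L t s"
    and UVU: "\<And>x. blinfun_apply U (blinfun_apply V (blinfun_apply U x)) = blinfun_apply U x"
    and VUV: "\<And>y. blinfun_apply V (blinfun_apply U (blinfun_apply V y)) = blinfun_apply V y"
    and UV_norm: "norm (V o\<^sub>L U) \<le> C" "norm (U o\<^sub>L V) \<le> C" "norm U * norm V \<le> C\<^sup>2 * r"
    and UV_rank: "finite_rank s s (K n) (V o\<^sub>L U)" "finite_rank t t (K n) (U o\<^sub>L V)"
    and fix_\<Phi>: "\<And>\<phi>. \<phi> \<in> ds.span \<Phi> \<Longrightarrow> \<phi> o\<^sub>L (V o\<^sub>L U) = \<phi>"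
    and fix_\<Psi>3: "\<And>\<phi>. \<phi> \<in> dt.span \<Psi>3 \<Longrightarrow> \<phi> o\<^sub>L (U o\<^sub>L V) = \<phi>"
    by (rule local_dist_operators[OF s t refl order_trans[OF zero_le_one C] ld \<Phi>(1) \<Phi>_card
          \<Phi>(2) \<Psi>3(1) order_trans[OF \<Psi>3(2) dims(2)] \<Psi>3(3)]) (rule that; assumption)
  have span: "ds.span \<Psi>1 \<subseteq> ds.span \<Phi>" "ds.span \<Psi>2 \<subseteq> ds.span \<Phi>" "\<psi> \<in> ds.span \<Phi>"
    unfolding \<Phi>_def by (intro ds.span_mono ds.span_base; auto)+
  define R where "R = V o\<^sub>L U"
  define R' where "R' = U o\<^sub>L V"
  have R_ap: "blinfun_apply R x = blinfun_apply V (blinfun_apply U x)" for x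
    by (simp add: R_def)
  have R'_ap: "blinfun_apply R' x = blinfun_apply U (blinfun_apply V x)" for x
    by (simp add: R'_def)
  have R: "R \<in> L s s" "\<And>x. blinfun_apply R (blinfun_apply R x) = blinfun_apply R x"
      "finite_rank s s N R" "norm R \<le> C"
    using UV_norm(1) s.finite_rank_mono[OF UV_rank(1) dims(3)] L_compose[OF U V] by (auto simp: R_def VUV)
  have R': "R' \<in> L t t" "\<And>x. blinfun_apply R' (blinfun_apply R' x) = blinfun_apply R' x"
      "finite_rank t t N R'" "norm R' \<le> C"
    using UV_norm(2) t.finite_rank_mono[OF UV_rank(2) dims(3)] L_compose[OF V U] by (auto simp: R'_def UVU)
  have PR: "blinfun_apply P (blinfun_apply R x) = blinfun_apply P x" for x
    using \<Psi>1(4) span fix_\<Phi> by (intro L_eq_compose_if_dual[OF s P(1)]) (auto simp: R_def)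
  have SR: "blinfun_apply S (blinfun_apply R x) = blinfun_apply S x" for x
    using \<Psi>2(4) span fix_\<Phi> by (intro L_eq_compose_if_dual[OF s S(1)]) (auto simp: R_def)
  have Q1R': "blinfun_apply Q1 (blinfun_apply R' x) = blinfun_apply Q1 x" for x
    using \<Psi>3(4) fix_\<Psi>3 by (intro L_eq_compose_if_dual[OF t Q1(1)]) (auto simp: R'_def)
  have \<psi>R: "blinfun_apply \<psi> (blinfun_apply R x) = blinfun_apply \<psi> x" for x
    using fix_\<Phi>[OF span(3)] by (metis R_def blinfun_apply_blinfun_compose)
  obtain P' where P': "P' \<in> L s s" "\<And>x. blinfun_apply P' (blinfun_apply P' x) = blinfun_apply P' x"
    "\<And>x. blinfun_apply P' (blinfun_apply P x) = blinfun_apply P x"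
    "\<And>x. blinfun_apply P (blinfun_apply P' x) = blinfun_apply P x"
    "\<And>x. blinfun_apply P' (blinfun_apply R x) = blinfun_apply P' x"
    "\<And>x. blinfun_apply R (blinfun_apply P' x) = blinfun_apply R x"
    and P'_ap: "\<And>x. blinfun_apply P' x = blinfun_apply P x + blinfun_apply R (x - blinfun_apply P x)"
    and P'_rank: "finite_rank s s N P'" and P'_norm: "norm P' \<le> norm P + C * (1 + norm P)"
    by (rule s.join_projections[OF P(1,2) R(1,2) PR R(3,4)])
      (rule that; assumption)
  obtain E where E: "E \<in> L t t" "\<And>x. blinfun_apply E (blinfun_apply E x) = blinfun_apply E x"
    and EQ1: "\<And>x. blinfun_apply E (blinfun_apply Q1 x) = blinfun_apply Q1 x"
    and Q1E: "\<And>x. blinfun_apply Q1 (blinfun_apply E x) = blinfun_apply Q1 x"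
    and R'E: "\<And>x. blinfun_apply R' (blinfun_apply E x) = blinfun_apply R' x"
    and E_rank: "finite_rank t t N E" and E_norm: "norm E \<le> norm Q1 + C * (1 + norm Q1)"
    by (rule t.join_projections[OF Q1(1,2) R'(1,2) Q1R' R'(3,4)]) (rule that; assumption)
  have "E \<noteq> 0"
  proof
    assume "E = 0"
    then have "blinfun_apply R' x = 0" for x
      using R'E[of x] by simp
    then have "blinfun_apply U x = 0" for x
      using UVU[of x] by (simp flip: R'_ap)
    then have "blinfun_apply R x = 0" for x
      by (simp add: R_ap)
    then show False
      using \<psi>R \<psi>(3) by (metis blinfun.zero_right)
  qed
  obtain F \<sigma> \<sigma>' where F: "F \<in> L t t" "\<sigma> \<in> L t t" "\<sigma>' \<in> L t t" "finite_rank t t N F"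
    "\<And>y. blinfun_apply F (blinfun_apply F y) = blinfun_apply F y"
    and EF: "\<And>y. blinfun_apply E (blinfun_apply F y) = 0"
    and FE: "\<And>y. blinfun_apply F (blinfun_apply E y) = 0"
    and \<sigma>'\<sigma>: "\<And>y. blinfun_apply \<sigma>' (blinfun_apply \<sigma> y) = blinfun_apply E y"
    and F\<sigma>: "\<And>y. blinfun_apply F (blinfun_apply \<sigma> y) = blinfun_apply \<sigma> y"
    and \<sigma>'F: "\<And>y. blinfun_apply \<sigma>' (blinfun_apply F y) = blinfun_apply \<sigma>' y"
    and F_norm: "norm F \<le> D' * norm E powr d'" "norm \<sigma> * norm \<sigma>' \<le> 2 * f N * norm E * norm F"
    by (rule property_D_operators[OF t D E \<open>E \<noteq> 0\<close> E_rank]) (rule that; assumption)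
  have D'_pos: "0 < D'" and f_pos: "0 < f N"
    using D f_N unfolding property_D_def by auto
  have E_ge: "1 \<le> norm E"
    by (rule norm_idempotent_ge_1[OF E(2) \<open>E \<noteq> 0\<close>])
  have E_le: "norm E \<le> e"
  proof -
    have "norm E \<le> (1 + C) * norm Q1 + C"
      using E_norm by (simp add: algebra_simps)
    also have "\<dots> \<le> e"
      unfolding e_def using Q1(7) C by (intro add_right_mono mult_left_mono) auto
    finally show ?thesis .
  qed
  have F_le: "norm F \<le> D * e powr d"
  proof -
    have "norm E powr d' \<le> e powr d"
      using E_ge E_le d D unfolding property_D_def by (intro powr_mono_both) auto
    then have "D' * norm E powr d' \<le> D * e powr d"
      using D' D'_pos by (intro mult_mono) auto
    with F_norm(1) show ?thesis
      by simp
  qed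
  have EQ: "blinfun_apply E (blinfun_apply Q x) = blinfun_apply Q x" for x
    using EQ1[of "blinfun_apply Q x"] by (simp add: Q1)
  have QE: "blinfun_apply Q (blinfun_apply E x) = blinfun_apply Q x" for x
    using Q1(6)[of "blinfun_apply E x"] by (simp add: Q1E Q1(6))
  have FQ: "blinfun_apply F (blinfun_apply Q x) = 0" for x
    using FE[of "blinfun_apply Q x"] by (simp add: EQ)
  have QF: "blinfun_apply Q (blinfun_apply F x) = 0" for x
    using QE[of "blinfun_apply F x"] by (simp add: EF)
  have Ey: "blinfun_apply E y = y"
    using EQ1[of y] by (simp add: Q1)
  have Fy: "blinfun_apply F y = 0"
    using FE[of y] by (simp add: Ey)
  have E\<sigma>: "blinfun_apply E (blinfun_apply \<sigma> x) = 0" for x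
    using EF[of "blinfun_apply \<sigma> x"] by (simp add: F\<sigma>)
  have \<sigma>'E: "blinfun_apply \<sigma>' (blinfun_apply E x) = 0" for x
    using \<sigma>'F[of "blinfun_apply E x"] by (simp add: FE)
  have Q\<sigma>: "blinfun_apply Q (blinfun_apply \<sigma> x) = 0" for x
    using QF[of "blinfun_apply \<sigma> x"] by (simp add: F\<sigma>)
  have \<sigma>'Q: "blinfun_apply \<sigma>' (blinfun_apply Q x) = 0" for x
    using \<sigma>'F[of "blinfun_apply Q x"] by (simp add: FQ)
  have VEU: "blinfun_apply V (blinfun_apply E (blinfun_apply U x)) = blinfun_apply R x" for x
  proof -
    have "blinfun_apply V (blinfun_apply E (blinfun_apply U x)) =
        blinfun_apply V (blinfun_apply R' (blinfun_apply E (blinfun_apply U x)))"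
      by (simp add: R'_ap VUV)
    also have "\<dots> = blinfun_apply R x"
      unfolding R'E by (simp add: R'_ap R_ap VUV)
    finally show ?thesis .
  qed
  show thesis
  proof (rule that[of P' "E + F" "\<sigma> o\<^sub>L U" "V o\<^sub>L \<sigma>'"])
    show "E + F \<in> L t t" "\<sigma> o\<^sub>L U \<in> L s t" "V o\<^sub>L \<sigma>' \<in> L t s"
      using t.L_add[OF E(1) F(1)] L_compose[OF U F(2)] L_compose[OF F(3) V] by auto
    show "1 + norm P' \<le> (1 + C) * (1 + norm P)"
      using P'_norm by (simp add: algebra_simps)
    show "blinfun_apply S (blinfun_apply P' x) = blinfun_apply S x" for x
      by (simp add: P'_ap blinfun.add_right blinfun.diff_right SR)
    show "P' \<noteq> P"
    proof
      assume "P' = P"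
      then have "blinfun_apply R (x0 - blinfun_apply P x0) = 0"
        using P'_ap[of x0] by simp
      with \<psi>(3) \<psi>R show False
        by (metis blinfun.zero_right)
    qed
    have "finite_rank t t (N + N) (E + F)"
      by (rule t.finite_rank_add[OF E_rank F(4)])
    then show "finite_rank t t (2 * N) (E + F)"
      by (simp add: mult_2)
    show "norm (E + F) \<le> e + D * e powr d"
      using norm_triangle_ineq[of E F] E_le F_le by simp
    show "blinfun_apply (V o\<^sub>L \<sigma>') (blinfun_apply (\<sigma> o\<^sub>L U) (blinfun_apply (P' - P) x)) =
        blinfun_apply (P' - P) x" for x
      by (simp add: \<sigma>'\<sigma> VEU blinfun.diff_left P'_ap R blinfun.diff_right)
    have "norm (\<sigma> o\<^sub>L U) * norm (V o\<^sub>L \<sigma>') \<le> (norm \<sigma> * norm U) * (norm V * norm \<sigma>')"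
      by (intro mult_mono norm_blinfun_compose) auto
    also have "\<dots> = (norm \<sigma> * norm \<sigma>') * (norm U * norm V)"
      by simp
    also have "\<dots> \<le> (2 * f N * e * (D * e powr d)) * (C\<^sup>2 * r)"
    proof (rule mult_mono[OF _ UV_norm(3)])
      have "2 * f N * norm E * norm F \<le> 2 * f N * e * (D * e powr d)"
        using E_le E_ge F_le f_pos D' D'_pos by (intro mult_mono) auto
      with F_norm(2) show "norm \<sigma> * norm \<sigma>' \<le> 2 * f N * e * (D * e powr d)"
        by simp
      show "0 \<le> 2 * f N * e * (D * e powr d)"
        using E_le E_ge f_pos D' D'_pos by (intro mult_nonneg_nonneg) auto
    qed auto
    finally show "norm (\<sigma> o\<^sub>L U) * norm (V o\<^sub>L \<sigma>') \<le> 2 * f N * e * (D * e powr d) * (C\<^sup>2 * r)" .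
  qed (simp_all add: P' P'_rank blinfun.add_left blinfun.add_right E F EF FE F\<sigma> \<sigma>'F EQ QE FQ QF
      Ey Fy E\<sigma> \<sigma>'E Q\<sigma> \<sigma>'Q)
qed

section \<open>Compactness and separability\<close>

definition precompact :: "'a::metric_space set \<Rightarrow> bool" where
  "precompact S \<longleftrightarrow> (\<forall>e>0. \<exists>F. finite F \<and> S \<subseteq> (\<Union>x\<in>F. ball x e))"

lemma precompact_subset: "precompact S \<Longrightarrow> S' \<subseteq> S \<Longrightarrow> precompact S'"
  unfolding precompact_def by (meson subset_trans)

lemma precompact_compact: "compact S \<Longrightarrow> precompact S"
  unfolding precompact_def compact_eq_totally_bounded by blast

lemma compact_closure_if_precompact:
  fixes S :: "'a::complete_space set"
  assumes "precompact S"
  shows "compact (closure S)"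
  unfolding compact_eq_totally_bounded
proof (intro conjI allI impI)
  show "complete (closure S)"
    by (simp add: complete_eq_closed)
  fix e :: real
  assume "0 < e"
  then obtain F where F: "finite F" "S \<subseteq> (\<Union>x\<in>F. ball x (e / 2))"
    using assms unfolding precompact_def by (meson half_gt_zero)
  have "S \<subseteq> (\<Union>x\<in>F. cball x (e / 2))"
    using F(2) UN_mono[OF order_refl ball_subset_cball] by (rule subset_trans)
  then have "closure S \<subseteq> (\<Union>x\<in>F. cball x (e / 2))"
    by (rule closure_minimal) (intro closed_UN F(1) ballI closed_cball)
  also have "\<dots> \<subseteq> (\<Union>x\<in>F. ball x e)"
    using \<open>0 < e\<close> by (intro UN_mono) auto
  finally show "\<exists>F. finite F \<and> closure S \<subseteq> (\<Union>x\<in>F. ball x e)"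
    using F(1) by blast
qed

lemma precompact_add:
  fixes S :: "'a::real_normed_vector set"
  assumes "precompact S" "precompact S'"
  shows "precompact {x + y |x y. x \<in> S \<and> y \<in> S'}"
  unfolding precompact_def
proof (intro allI impI)
  fix e :: real
  assume "0 < e"
  then have "0 < e / 2"
    by simp
  obtain F F' where F: "finite F" "S \<subseteq> (\<Union>x\<in>F. ball x (e / 2))"
      and F': "finite F'" "S' \<subseteq> (\<Union>x\<in>F'. ball x (e / 2))"
    using assms \<open>0 < e / 2\<close> unfolding precompact_def by meson
  have "{x + y |x y. x \<in> S \<and> y \<in> S'} \<subseteq> (\<Union>z\<in>(\<lambda>(x, y). x + y) ` (F \<times> F'). ball z e)"
  proof clarify
    fix x y
    assume "x \<in> S" "y \<in> S'"
    then obtain u v where u: "u \<in> F" "dist u x < e / 2" and v: "v \<in> F'" "dist v y < e / 2"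
      using F(2) F'(2) unfolding subset_iff UN_iff mem_ball by meson
    have "dist (u + v) (x + y) < e"
      using dist_triangle_add[of u v x y] u(2) v(2) by simp
    with u(1) v(1) show "x + y \<in> (\<Union>z\<in>(\<lambda>(x, y). x + y) ` (F \<times> F'). ball z e)"
      by force
  qed
  with F(1) F'(1) show "\<exists>F. finite F \<and> {x + y |x y. x \<in> S \<and> y \<in> S'} \<subseteq> (\<Union>x\<in>F. ball x e)"
    by (meson finite_SigmaI finite_imageI)
qed

lemma precompact_cball_scalar: "precompact (cball (0 :: 'k::real_or_complex) r)"
  using real_or_complex
proof
  assume *: "\<forall>z::'k. \<exists>a. z = a *\<^sub>R 1"
  have "cball (0 :: 'k) r \<subseteq> (\<lambda>a. a *\<^sub>R 1) ` {-r..r}"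
  proof
    fix z :: 'k
    assume "z \<in> cball 0 r"
    moreover obtain a where "z = a *\<^sub>R 1"
      using * by blast
    ultimately show "z \<in> (\<lambda>a. a *\<^sub>R 1) ` {-r..r}"
      by (intro image_eqI[of _ _ a]) auto
  qed
  moreover have "compact ((\<lambda>a. a *\<^sub>R (1 :: 'k)) ` {-r..r})"
    by (intro compact_continuous_image continuous_intros) simp
  ultimately show ?thesis
    using precompact_compact precompact_subset by blast
next
  assume "\<exists>i::'k. i * i = - 1 \<and>
      (\<forall>z. \<exists>a b. z = a *\<^sub>R 1 + b *\<^sub>R i \<and> norm z = sqrt (a\<^sup>2 + b\<^sup>2))"
  then obtain i :: 'k
    where *: "\<And>z. \<exists>a b. z = a *\<^sub>R 1 + b *\<^sub>R i \<and> norm z = sqrt (a\<^sup>2 + b\<^sup>2)"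
    by blast
  have "cball (0 :: 'k) r \<subseteq> (\<lambda>(a, b). a *\<^sub>R 1 + b *\<^sub>R i) ` ({-r..r} \<times> {-r..r})"
  proof
    fix z :: 'k
    assume z: "z \<in> cball 0 r"
    obtain a b where ab: "z = a *\<^sub>R 1 + b *\<^sub>R i" "norm z = sqrt (a\<^sup>2 + b\<^sup>2)"
      using * by blast
    have "sqrt (a\<^sup>2 + b\<^sup>2) \<le> r"
      using z ab(2) by simp
    moreover have "\<bar>a\<bar> \<le> sqrt (a\<^sup>2 + b\<^sup>2)" "\<bar>b\<bar> \<le> sqrt (a\<^sup>2 + b\<^sup>2)"
      by (rule real_le_rsqrt, simp)+
    ultimately have "\<bar>a\<bar> \<le> r" "\<bar>b\<bar> \<le> r"
      by linarith+
    then show "z \<in> (\<lambda>(a, b). a *\<^sub>R 1 + b *\<^sub>R i) ` ({-r..r} \<times> {-r..r})"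
      using ab(1) by (intro image_eqI[of _ _ "(a, b)"]) auto
  qed
  moreover have "compact ((\<lambda>(a, b). a *\<^sub>R (1 :: 'k) + b *\<^sub>R i) ` ({-r..r} \<times> {-r..r}))"
    unfolding case_prod_unfold
    by (intro compact_continuous_image continuous_intros compact_Times) simp_all
  ultimately show ?thesis
    using precompact_compact precompact_subset by blast
qed

lemma precompact_image_linear:
  assumes "precompact S" "bounded_linear f"
  shows "precompact (f ` S)"
  unfolding precompact_def
proof (intro allI impI)
  fix e :: real
  assume e: "0 < e"
  obtain K where K: "0 < K" "\<And>x. norm (f x) \<le> norm x * K"
    using bounded_linear.pos_bounded[OF assms(2)] by blast
  have "0 < e / K"
    using e K(1) by simp
  then obtain F where F: "finite F" "S \<subseteq> (\<Union>x\<in>F. ball x (e / K))"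
    using assms(1) unfolding precompact_def by meson
  have "f ` S \<subseteq> (\<Union>y\<in>f ` F. ball y e)"
  proof clarify
    fix x
    assume "x \<in> S"
    then obtain u where u: "u \<in> F" "dist u x < e / K"
      using F(2) by auto
    have "dist (f u) (f x) \<le> dist u x * K"
      using K(2)[of "u - x"] by (simp add: dist_norm linear_diff[OF bounded_linear.linear[OF assms(2)]])
    also have "\<dots> < e"
      using u(2) K(1) by (simp add: field_simps)
    finally show "f x \<in> (\<Union>y\<in>f ` F. ball y e)"
      using u(1) by auto
  qed
  with F(1) show "\<exists>F. finite F \<and> f ` S \<subseteq> (\<Union>x\<in>F. ball x e)"
    by blast
qed

context banach_over
begin

text \<open>
  The image lies in a finite sum of images of balls of scalars under linear maps.
\<close>

lemma precompact_image_finite_rank: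
  assumes "finite_rank u s r A"
  shows "precompact (blinfun_apply A ` cball 0 1)"
proof -
  obtain a b where A: "\<And>x. blinfun_apply A x = (\<Sum>i<r. s (blinfun_apply (a i) x) (b i))"
    using assms unfolding finite_rank_def by blast
  have "precompact ((\<lambda>x. \<Sum>i<n. s (blinfun_apply (a i) x) (b i)) ` cball 0 1)" for n
  proof (induction n)
    case 0
    have "precompact {0 :: 'a}"
      by (rule precompact_compact) simp
    then show ?case
      by (rule precompact_subset) auto
  next
    case (Suc n)
    have "bounded_linear (\<lambda>c. s c (b n))"
      by (rule bounded_linear_intro[where K = "norm (b n)"])
        (simp_all add: scale_left_distrib norm_scale scaleR_conv_of_real flip: scale_of_real)
    with precompact_cball_scalar
    have "precompact ((\<lambda>c. s c (b n)) ` cball 0 (norm (a n)))"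
      by (rule precompact_image_linear)
    from precompact_add[OF Suc.IH this] show ?case
    proof (rule precompact_subset)
      have "norm (blinfun_apply (a n) x) \<le> norm (a n)" if "norm x \<le> 1" for x
        using norm_blinfun[of "a n" x] mult_left_mono[OF that, of "norm (a n)"] by simp
      then show "(\<lambda>x. \<Sum>i<Suc n. s (blinfun_apply (a i) x) (b i)) ` cball 0 1 \<subseteq>
          {x + y |x y. x \<in> (\<lambda>x. \<Sum>i<n. s (blinfun_apply (a i) x) (b i)) ` cball 0 1 \<and>
             y \<in> (\<lambda>c. s c (b n)) ` cball 0 (norm (a n))}"
        by fastforce
    qed
  qed
  then show ?thesis
    by (simp add: A image_def)
qed

lemma finite_rank_scaleR:
  assumes "finite_rank u s r A"
  shows "finite_rank u s r (c *\<^sub>R A)"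
proof -
  have "c *\<^sub>R A = (c *\<^sub>R id_blinfun) o\<^sub>L A"
    by (rule blinfun_eqI) (simp add: blinfun.scaleR_left)
  with finite_rank_compose_left[OF assms L_scaleR[OF L_id]] show ?thesis
    by metis
qed

lemma finite_rank_sum:
  assumes "\<And>i. i \<in> I \<Longrightarrow> \<exists>r. finite_rank u s r (A i)"
  shows "\<exists>r. finite_rank u s r (sum A I)"
  using assms
proof (induction I rule: infinite_finite_induct)
  case (insert i I)
  then show ?case
    using finite_rank_add by (metis insertCI sum.insert)
qed (auto intro: finite_rank_zero)

text \<open>
  Images of the unit ball under the partial sums are precompact, and they approximate the image under
  the sum uniformly.
\<close>

lemma compact_operator_suminf:
  fixes A :: "nat \<Rightarrow> 'b::real_normed_vector \<Rightarrow>\<^sub>L 'a"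
  assumes "summable A" "\<And>k. \<exists>r. finite_rank u s r (A k)"
  shows "compact_operator (suminf A)"
proof -
  have "precompact (blinfun_apply (suminf A) ` cball 0 1)"
    unfolding precompact_def
  proof (intro allI impI)
    fix e :: real
    assume "0 < e"
    then have e: "0 < e / 2"
      by simp
    have "(\<lambda>n. sum A {..<n}) \<longlonglongrightarrow> suminf A"
      using assms(1) by (rule summable_LIMSEQ)
    then obtain n where n: "norm (sum A {..<n} - suminf A) < e / 2"
      using LIMSEQ_D[OF _ e] by (metis order_refl)
    have "precompact (blinfun_apply (sum A {..<n}) ` cball 0 1)"
      using finite_rank_sum[of "{..<n}" u A] assms(2) precompact_image_finite_rank by metis
    then obtain F where F: "finite F" "blinfun_apply (sum A {..<n}) ` cball 0 1 \<subseteq> (\<Union>x\<in>F. ball x (e / 2))"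
      using e unfolding precompact_def by meson
    have "blinfun_apply (suminf A) ` cball 0 1 \<subseteq> (\<Union>x\<in>F. ball x e)"
    proof clarify
      fix x :: 'b
      assume x: "x \<in> cball 0 1"
      then obtain y where y: "y \<in> F" "dist y (blinfun_apply (sum A {..<n}) x) < e / 2"
        using F(2) by fastforce
      have "norm (blinfun_apply (sum A {..<n} - suminf A) x) \<le> norm (sum A {..<n} - suminf A) * norm x"
        by (rule norm_blinfun)
      also have "\<dots> \<le> norm (sum A {..<n} - suminf A)"
        using x by (simp add: mult_left_le)
      finally have "dist (blinfun_apply (sum A {..<n}) x) (blinfun_apply (suminf A) x) < e / 2"
        using n by (simp add: dist_norm blinfun.diff_left)
      then have "dist y (blinfun_apply (suminf A) x) < e"
        using y(2) dist_triangle[of y "blinfun_apply (suminf A) x" "blinfun_apply (sum A {..<n}) x"]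
        by linarith
      with y(1) show "blinfun_apply (suminf A) x \<in> (\<Union>x\<in>F. ball x e)"
        by auto
    qed
    with F(1) show "\<exists>F. finite F \<and> blinfun_apply (suminf A) ` cball 0 1 \<subseteq> (\<Union>x\<in>F. ball x e)"
      by blast
  qed
  then show ?thesis
    unfolding compact_operator_def by (rule compact_closure_if_precompact)
qed

end

lemma dense_sequence_if_separable:
  assumes "separable_space (euclidean :: 'a::metric_space topology)"
  obtains v :: "nat \<Rightarrow> 'a::metric_space" where "closure (range v) = UNIV"
proof -
  obtain D :: "'a set" where D: "countable D" "closure D = UNIV"
    using assms unfolding separable_space_def by auto
  then have "D \<noteq> {}"
    by auto
  with D that[of "from_nat_into D"] show thesis
    by (simp add: range_from_nat_into)
qed

text \<open>
  The index \<open>k\<close> encodes a pair \<open>(j, i)\<close> and asks for a point of \<open>Z\<close> within \<open>1 / (i + 1)\<close> of \<open>v j\<close>.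
  For every \<open>w\<close> in \<open>Z\<close> and every \<open>i\<close> some \<open>j\<close> makes this possible close to \<open>w\<close>, and the code of \<open>(j, i)\<close> is
  at least \<open>i\<close>.
\<close>

lemma sequence_recurring_densely:
  fixes v :: "nat \<Rightarrow> 'a::metric_space"
  assumes v: "closure (range v) = UNIV" and Z: "Z \<noteq> {}"
  obtains z :: "nat \<Rightarrow> 'a::metric_space" where "range z \<subseteq> Z"
    "\<And>w e N. w \<in> Z \<Longrightarrow> 0 < e \<Longrightarrow> \<exists>k\<ge>N. dist (z k) w < e"
proof -
  define good where "good k w \<longleftrightarrow> w \<in> Z \<and>
    dist w (v (fst (prod_decode k))) < 1 / real (Suc (snd (prod_decode k)))" for k w
  define z where "z k = (if \<exists>w. good k w then SOME w. good k w else (SOME w. w \<in> Z))" for k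
  have z_good: "good k (z k)" if "good k w" for k w
    using that someI_ex[of "good k"] by (auto simp: z_def)
  show thesis
  proof (rule that)
    show "range z \<subseteq> Z"
    proof clarify
      fix k
      show "z k \<in> Z"
        using z_good[of k] Z by (cases "\<exists>w. good k w") (auto simp: good_def z_def some_in_eq)
    qed
    fix w e N
    assume w: "w \<in> Z" and e: "(0 :: real) < e"
    have "0 < e / 2"
      using e by simp
    then obtain i0 where i0: "1 / real (Suc i0) < e / 2"
      by (rule nat_approx_posE)
    define i where "i = max i0 N"
    have "1 / real (Suc i) \<le> 1 / real (Suc i0)"
      by (intro frac_le) (auto simp: i_def)
    then have i: "1 / real (Suc i) < e / 2" "N \<le> i"
      using i0 by (auto simp: i_def)
    have "w \<in> closure (range v)"
      using v by simp
    moreover have "0 < 1 / real (Suc i)"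
      by simp
    ultimately obtain j where j: "dist (v j) w < 1 / real (Suc i)"
      unfolding closure_approachable by blast
    define k where "k = prod_encode (j, i)"
    have "N \<le> k"
      using i(2) le_prod_encode_2[of i j] by (simp add: k_def)
    have "good k w"
      using w j by (simp add: good_def k_def dist_commute)
    then have "dist (z k) (v j) < 1 / real (Suc i)"
      using z_good[of k w] by (simp add: good_def k_def)
    then have "dist (z k) w < e"
      using j i(1) dist_triangle[of "z k" w "v j"] by linarith
    with \<open>N \<le> k\<close> show "\<exists>k\<ge>N. dist (z k) w < e"
      by blast
  qed
qed

section \<open>Passage to the limit\<close>

lemma increasing_projections:
  fixes P :: "nat \<Rightarrow> 'a::real_normed_vector \<Rightarrow>\<^sub>L 'a"
  assumes "\<And>k x. blinfun_apply (P k) (blinfun_apply (P k) x) = blinfun_apply (P k) x"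
    and "\<And>k x. blinfun_apply (P (Suc k)) (blinfun_apply (P k) x) = blinfun_apply (P k) x"
    and "\<And>k x. blinfun_apply (P k) (blinfun_apply (P (Suc k)) x) = blinfun_apply (P k) x"
    and "i \<le> j"
  shows "blinfun_apply (P j) (blinfun_apply (P i) x) = blinfun_apply (P i) x"
    and "blinfun_apply (P i) (blinfun_apply (P j) x) = blinfun_apply (P i) x"
proof -
  have "(\<forall>x. blinfun_apply (P j) (blinfun_apply (P i) x) = blinfun_apply (P i) x) \<and>
      (\<forall>x. blinfun_apply (P i) (blinfun_apply (P j) x) = blinfun_apply (P i) x)"
    using \<open>i \<le> j\<close>
  proof (induction j rule: dec_induct)
    case base
    then show ?case
      by (simp add: assms(1))
  next
    case (step j)
    then show ?case
      using assms(2,3) by metis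
  qed
  then show "blinfun_apply (P j) (blinfun_apply (P i) x) = blinfun_apply (P i) x"
    "blinfun_apply (P i) (blinfun_apply (P j) x) = blinfun_apply (P i) x"
    by auto
qed

lemma suminf_single:
  fixes f :: "nat \<Rightarrow> 'a::{comm_monoid_add,t2_space}"
  assumes "\<And>j. j \<noteq> k \<Longrightarrow> f j = 0"
  shows "suminf f = f k"
  using suminf_finite[of "{k}" f] assms by simp

lemma blinfun_suminf_apply:
  assumes "summable A"
  shows "blinfun_apply (suminf A) x = (\<Sum>k. blinfun_apply (A k) x)"
    and "summable (\<lambda>k. blinfun_apply (A k) x)"
  using bounded_linear.suminf[OF blinfun.bounded_linear_left assms]
    bounded_linear.summable[OF blinfun.bounded_linear_left assms] by metis+

lemma subspace_closure:
  fixes S :: "'a::real_normed_vector set"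
  assumes "subspace S"
  shows "subspace (closure S)"
proof (rule subspaceI)
  show "0 \<in> closure S"
    using subspace_0[OF assms] closure_subset by blast
next
  fix x y
  assume "x \<in> closure S" "y \<in> closure S"
  then obtain f g where f: "\<And>n. f n \<in> S" "f \<longlonglongrightarrow> x" and g: "\<And>n. g n \<in> S" "g \<longlonglongrightarrow> y"
    unfolding closure_sequential by blast
  have "(\<lambda>n. f n + g n) \<longlonglongrightarrow> x + y"
    by (intro tendsto_add f g)
  then show "x + y \<in> closure S"
    unfolding closure_sequential using subspace_add[OF assms f(1) g(1)]
    by (intro exI[of _ "\<lambda>n. f n + g n"]) simp
next
  fix x and c :: real
  assume "x \<in> closure S"
  then obtain f where f: "\<And>n. f n \<in> S" "f \<longlonglongrightarrow> x"
    unfolding closure_sequential by blast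
  have "(\<lambda>n. c *\<^sub>R f n) \<longlonglongrightarrow> c *\<^sub>R x"
    by (intro tendsto_scaleR tendsto_const f)
  then show "c *\<^sub>R x \<in> closure S"
    unfolding closure_sequential using subspace_scale[OF assms f(1)]
    by (intro exI[of _ "\<lambda>n. c *\<^sub>R f n"]) simp
qed

text \<open>
  The passage from the recursively built data to the two operators. The bound \<open>small\<close> contains the
  power of \<open>8 c\<^sup>3\<close> for the following reason. The factor \<open>c\<close> enters three times, since \<open>norm (\<Delta> k)\<close> is of order
  \<open>c ^ k\<close>: twice in the norm of the summands of \<open>T1\<close>, and once more because these norms have to be small
  against \<open>\<epsilon> k\<close>, which in turn compensates the norm of \<open>\<theta> k \<circ> \<Delta> k\<close>. The factor \<open>2\<close> enters three times as
  well: in the summands of \<open>T2\<close>, in \<open>\<epsilon> k\<close>, and to make the quotient tend to zero.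
\<close>

lemma dense_compact_factorization:
  fixes s :: "'k::real_or_complex \<Rightarrow> 'a::banach \<Rightarrow> 'a" and t :: "'k \<Rightarrow> 'b::banach \<Rightarrow> 'b"
    and P S :: "nat \<Rightarrow> 'a \<Rightarrow>\<^sub>L 'a" and Q :: "nat \<Rightarrow> 'b \<Rightarrow>\<^sub>L 'b"
    and A :: "nat \<Rightarrow> 'a \<Rightarrow>\<^sub>L 'b" and B :: "nat \<Rightarrow> 'b \<Rightarrow>\<^sub>L 'a"
  assumes s: "banach_over s" and t: "banach_over t" and T: "T \<in> L s s"
    and P0: "P 0 = 0"
    and P: "\<And>k. P k \<in> L s s"
      "\<And>k x. blinfun_apply (P k) (blinfun_apply (P k) x) = blinfun_apply (P k) x"
      "\<And>k x. blinfun_apply (P (Suc k)) (blinfun_apply (P k) x) = blinfun_apply (P k) x"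
      "\<And>k x. blinfun_apply (P k) (blinfun_apply (P (Suc k)) x) = blinfun_apply (P k) x"
    and P_rank: "\<And>k. \<exists>r. finite_rank s s r (P k)"
    and P_neq: "\<And>k. P (Suc k) \<noteq> P k"
    and Q: "\<And>k x. blinfun_apply (Q k) (blinfun_apply (Q k) x) = blinfun_apply (Q k) x"
      "\<And>k x. blinfun_apply (Q (Suc k)) (blinfun_apply (Q k) x) = blinfun_apply (Q k) x"
      "\<And>k x. blinfun_apply (Q k) (blinfun_apply (Q (Suc k)) x) = blinfun_apply (Q k) x"
    and v: "closure (range v) = UNIV" "\<And>k. blinfun_apply (Q (Suc k)) (v k) = v k"
    and A: "\<And>k. A k \<in> L s t"
      "\<And>k x. blinfun_apply (Q (Suc k)) (blinfun_apply (A k) x) = blinfun_apply (A k) x"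
      "\<And>k x. blinfun_apply (Q k) (blinfun_apply (A k) x) = 0"
    and B: "\<And>k. B k \<in> L t s"
      "\<And>k x. blinfun_apply (B k) (blinfun_apply (Q (Suc k)) x) = blinfun_apply (B k) x"
      "\<And>k x. blinfun_apply (B k) (blinfun_apply (Q k) x) = 0"
    and BA: "\<And>k x. blinfun_apply (B k) (blinfun_apply (A k) (blinfun_apply (P (Suc k) - P k) x)) =
        blinfun_apply (P (Suc k) - P k) x"
    and c: "2 \<le> c" "\<And>k. 1 + norm (P k) \<le> c ^ k"
    and S: "\<And>k x. blinfun_apply (S k) (blinfun_apply (P k) x) = blinfun_apply (S k) x"
    and e: "\<And>k. 0 < e k" "\<And>k. norm (T - S k) \<le> e k"
    and small: "\<And>k. norm (A k) * norm (B k) * e k * (8 * c ^ 3) ^ k \<le> M"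
  shows "\<exists>T1 T2. T1 \<in> L s t \<and> T2 \<in> L t s \<and> T = T2 o\<^sub>L T1 \<and>
           closure (range (blinfun_apply T1)) = UNIV \<and>
           compact_operator T1 \<and> compact_operator T2"
proof -
  interpret s: banach_over s by fact
  interpret t: banach_over t by fact
  define \<Delta> where "\<Delta> k = P (Suc k) - P k" for k
  note PP = increasing_projections[of P, OF P(2-4)] and QQ = increasing_projections[of Q, OF Q]
  have \<Delta>_L: "\<Delta> k \<in> L s s" for k
    unfolding \<Delta>_def by (intro s.L_diff P)
  have \<Delta>_ap: "blinfun_apply (\<Delta> k) x = blinfun_apply (P (Suc k)) x - blinfun_apply (P k) x" for k x
    by (simp add: \<Delta>_def blinfun.diff_left)
  have \<Delta>\<Delta>: "blinfun_apply (\<Delta> k) (blinfun_apply (\<Delta> k) x) = blinfun_apply (\<Delta> k) x" for k x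
    by (simp add: \<Delta>_ap blinfun.diff_right P)
  have \<Delta>_orth: "blinfun_apply (\<Delta> j) (blinfun_apply (\<Delta> k) x) = 0" if "j \<noteq> k" for j k x
  proof (cases "j < k")
    case True
    then show ?thesis
      by (simp add: \<Delta>_ap blinfun.diff_right PP(2))
  next
    case False
    with that have "k < j"
      by simp
    then show ?thesis
      by (simp add: \<Delta>_ap blinfun.diff_right PP(1))
  qed
  have BA': "blinfun_apply (B k) (blinfun_apply (A k) (blinfun_apply (\<Delta> k) x)) = blinfun_apply (\<Delta> k) x" for k x
    using BA by (simp add: \<Delta>_def)
  have BA_orth: "blinfun_apply (B j) (blinfun_apply (A k) x) = 0" if "j \<noteq> k" for j k x
  proof (cases "j < k")
    case True
    have "blinfun_apply (B j) (blinfun_apply (A k) x) =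
        blinfun_apply (B j) (blinfun_apply (Q (Suc j)) (blinfun_apply (Q k) (blinfun_apply (A k) x)))"
      using True by (simp add: B(2) QQ(2))
    then show ?thesis
      by (simp add: A(3))
  next
    case False
    with that have "Suc k \<le> j"
      by simp
    then have "blinfun_apply (Q j) (blinfun_apply (A k) x) = blinfun_apply (A k) x"
      using QQ(1)[of "Suc k" j "blinfun_apply (A k) x"] by (simp add: A(2))
    then show ?thesis
      using B(3)[of j "blinfun_apply (A k) x"] by simp
  qed
  have \<Delta>_neq: "\<Delta> k \<noteq> 0" for k
    using P_neq by (simp add: \<Delta>_def)
  have AB_ge: "1 \<le> norm (A k) * norm (B k)" for k
  proof -
    have "\<Delta> k = B k o\<^sub>L (A k o\<^sub>L \<Delta> k)"
      by (rule blinfun_eqI) (simp add: BA')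
    then have "norm (\<Delta> k) \<le> norm (B k) * norm (A k o\<^sub>L \<Delta> k)"
      by (metis norm_blinfun_compose)
    also have "\<dots> \<le> norm (B k) * (norm (A k) * norm (\<Delta> k))"
      by (intro mult_left_mono norm_blinfun_compose) simp
    finally have "1 * norm (\<Delta> k) \<le> (norm (A k) * norm (B k)) * norm (\<Delta> k)"
      by (simp add: mult_ac)
    then show ?thesis
      using \<Delta>_neq by (simp add: mult_le_cancel_right)
  qed
  have c_pow: "1 \<le> c ^ k" for k
    using c(1) by (simp add: one_le_power)
  have \<Delta>_norm: "norm (\<Delta> k) \<le> c\<^sup>2 * c ^ k" for k
  proof -
    have "norm (\<Delta> k) \<le> norm (P (Suc k)) + norm (P k)"
      unfolding \<Delta>_def by (rule norm_triangle_ineq4)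
    also have "\<dots> \<le> c ^ Suc k + c ^ k"
      using c(2)[of k] c(2)[of "Suc k"] by linarith
    also have "\<dots> = (c + 1) * c ^ k"
      by (simp add: algebra_simps)
    also have "\<dots> \<le> c\<^sup>2 * c ^ k"
    proof (rule mult_right_mono)
      have "2 * c \<le> c * c"
        using c(1) by (intro mult_right_mono) auto
      then show "c + 1 \<le> c\<^sup>2"
        using c(1) unfolding power2_eq_square by linarith
    qed (use c_pow[of k] in simp)
    finally show ?thesis .
  qed
  have M: "0 \<le> M"
  proof -
    have "0 \<le> norm (A 0) * norm (B 0) * e 0"
      using e(1)[of 0] by simp
    also have "\<dots> \<le> M"
      using small[of 0] by simp
    finally show ?thesis .
  qed
  have T\<Delta>_norm: "norm (T o\<^sub>L \<Delta> k) \<le> e k * norm (\<Delta> k)" for k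
  proof -
    have "T o\<^sub>L \<Delta> k = (T - S k) o\<^sub>L \<Delta> k"
    proof (rule blinfun_eqI)
      fix x
      have "blinfun_apply (S k) (blinfun_apply (P (Suc k)) x) =
          blinfun_apply (S k) (blinfun_apply (P k) (blinfun_apply (P (Suc k)) x))"
        by (simp only: S)
      then show "blinfun_apply (T o\<^sub>L \<Delta> k) x = blinfun_apply ((T - S k) o\<^sub>L \<Delta> k) x"
        by (simp add: blinfun.diff_left \<Delta>_ap blinfun.diff_right P S)
    qed
    then have "norm (T o\<^sub>L \<Delta> k) \<le> norm (T - S k) * norm (\<Delta> k)"
      by (simp add: norm_blinfun_compose)
    also have "\<dots> \<le> e k * norm (\<Delta> k)"
      by (intro mult_right_mono e) simp
    finally show ?thesis .
  qed
  have TP: "(\<lambda>n. blinfun_apply T (blinfun_apply (P n) x)) \<longlonglongrightarrow> blinfun_apply T x" for x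
  proof -
    have bound: "norm (blinfun_apply T (blinfun_apply (P n) x) - blinfun_apply T x) \<le> M * norm x * (1 / 2) ^ n" for n
    proof -
      have "blinfun_apply T (blinfun_apply (P n) x) - blinfun_apply T x =
          blinfun_apply (T - S n) (blinfun_apply (P n) x - x)"
        by (simp add: blinfun.diff_left blinfun.diff_right S)
      also have "norm \<dots> \<le> norm (T - S n) * norm (blinfun_apply (P n) x - x)"
        by (rule norm_blinfun)
      also have "\<dots> \<le> e n * (c ^ n * norm x)"
      proof (intro mult_mono e)
        have "norm (blinfun_apply (P n) x - x) \<le> norm (P n) * norm x + norm x"
          using norm_triangle_ineq4[of "blinfun_apply (P n) x" x] norm_blinfun[of "P n" x] by linarith
        also have "\<dots> = (1 + norm (P n)) * norm x"
          by (simp add: algebra_simps)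
        also have "\<dots> \<le> c ^ n * norm x"
          by (intro mult_right_mono c) simp
        finally show "norm (blinfun_apply (P n) x - x) \<le> c ^ n * norm x" .
      qed (use e(1) in \<open>auto intro: less_imp_le\<close>)
      also have "\<dots> = (2 * c) ^ n * e n * norm x * (1 / 2) ^ n"
        by (simp add: power_mult_distrib power_one_over)
      also have "\<dots> \<le> M * norm x * (1 / 2) ^ n"
      proof -
        have "2 * c \<le> 8 * c ^ 3"
          using c(1) one_le_power[of c 2] mult_left_mono[of 1 "c\<^sup>2" c] by (simp add: power3_eq_cube power2_eq_square)
        then have "(2 * c) ^ n \<le> (8 * c ^ 3) ^ n"
          using c(1) by (intro power_mono) auto
        then have "(2 * c) ^ n * e n \<le> (8 * c ^ 3) ^ n * e n"
          using e(1)[of n] by (intro mult_right_mono) auto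
        also have "\<dots> \<le> (norm (A n) * norm (B n)) * ((8 * c ^ 3) ^ n * e n)"
          using mult_right_mono[OF AB_ge, of "(8 * c ^ 3) ^ n * e n" n] e(1)[of n] c(1) by simp
        also have "\<dots> \<le> M"
          using small[of n] by (simp add: mult_ac)
        finally show ?thesis
          by (intro mult_right_mono) auto
      qed
      finally show ?thesis .
    qed
    have "(\<lambda>n. M * norm x * (1 / 2) ^ n) \<longlonglongrightarrow> M * norm x * 0"
      by (intro tendsto_mult tendsto_const LIMSEQ_power_zero) simp
    then have "(\<lambda>n. M * norm x * (1 / 2) ^ n) \<longlonglongrightarrow> 0"
      by simp
    with always_eventually[OF allI, OF bound]
    have "(\<lambda>n. blinfun_apply T (blinfun_apply (P n) x) - blinfun_apply T x) \<longlonglongrightarrow> 0"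
      by (rule Lim_null_comparison)
    then show ?thesis
      by (rule LIM_zero_cancel)
  qed
  have AB_neq: "A k \<noteq> 0" "B k \<noteq> 0" for k
    using AB_ge[of k] by auto
  \<comment> \<open>The scalars are chosen such that the summands of \<open>T2\<close> have norm at most \<open>2\<^sup>-\<^sup>k\<close>; all that is left of
    the smallness goes to \<open>T1\<close>, whose summands have to be small against \<open>\<epsilon> k\<close>.\<close>
  define \<mu> where "\<mu> k = 2 ^ k * norm (B k) * norm (\<Delta> k) * e k" for k
  have \<mu>: "0 < \<mu> k" for k
    using AB_neq \<Delta>_neq e(1) by (simp add: \<mu>_def)
  define t1 where "t1 k = \<mu> k *\<^sub>R (A k o\<^sub>L \<Delta> k)" for k
  define t2 where "t2 k = (1 / \<mu> k) *\<^sub>R (T o\<^sub>L (\<Delta> k o\<^sub>L B k))" for k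
  have t1_norm: "norm (t1 k) \<le> c ^ 4 * M * (1 / 2) ^ k * (1 / (2 * c)) ^ k" for k
  proof -
    have "norm (t1 k) \<le> \<mu> k * (norm (A k) * norm (\<Delta> k))"
      using \<mu>[of k] by (simp add: t1_def norm_blinfun_compose)
    also have "\<dots> = (2 ^ k * norm (A k) * norm (B k) * e k) * (norm (\<Delta> k) * norm (\<Delta> k))"
      by (simp add: \<mu>_def)
    also have "\<dots> \<le> (2 ^ k * norm (A k) * norm (B k) * e k) * ((c\<^sup>2 * c ^ k) * (c\<^sup>2 * c ^ k))"
      using e(1)[of k] c(1) by (intro mult_left_mono mult_mono \<Delta>_norm) auto
    also have "\<dots> = c ^ 4 * (norm (A k) * norm (B k) * e k * (8 * c ^ 3) ^ k) * (1 / 2) ^ k * (1 / (2 * c)) ^ k"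
    proof -
      have "(2::real) ^ k * (c ^ k * c ^ k) = (2 * c\<^sup>2) ^ k"
        by (simp add: power_mult_distrib power2_eq_square)
      also have "2 * c\<^sup>2 = 8 * c ^ 3 * (1 / 2) * (1 / (2 * c))"
        using c(1) by (simp add: power2_eq_square power3_eq_cube)
      also have "\<dots> ^ k = (8 * c ^ 3) ^ k * (1 / 2) ^ k * (1 / (2 * c)) ^ k"
        by (simp only: power_mult_distrib)
      finally have "(2::real) ^ k * (c ^ k * c ^ k) = (8 * c ^ 3) ^ k * (1 / 2) ^ k * (1 / (2 * c)) ^ k" .
      moreover have "c\<^sup>2 * c\<^sup>2 = c ^ 4"
        by (simp flip: power_add)
      moreover have "(2 ^ k * norm (A k) * norm (B k) * e k) * ((c\<^sup>2 * c ^ k) * (c\<^sup>2 * c ^ k)) =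
          (c\<^sup>2 * c\<^sup>2) * (norm (A k) * norm (B k) * e k) * (2 ^ k * (c ^ k * c ^ k))"
        by (simp only: mult_ac)
      ultimately show ?thesis
        by (simp only: mult_ac)
    qed
    also have "\<dots> \<le> c ^ 4 * M * (1 / 2) ^ k * (1 / (2 * c)) ^ k"
      using c(1) by (intro mult_right_mono mult_left_mono small) auto
    finally show ?thesis .
  qed
  have t2_norm: "norm (t2 k) \<le> (1 / 2) ^ k" for k
  proof -
    have "t2 k = (1 / \<mu> k) *\<^sub>R ((T o\<^sub>L \<Delta> k) o\<^sub>L B k)"
      unfolding t2_def by (rule blinfun_eqI) (simp add: blinfun.scaleR_left)
    then have "norm (t2 k) = (1 / \<mu> k) * norm ((T o\<^sub>L \<Delta> k) o\<^sub>L B k)"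
      using \<mu>[of k] by simp
    also have "\<dots> \<le> (1 / \<mu> k) * (norm (T o\<^sub>L \<Delta> k) * norm (B k))"
      using \<mu>[of k] by (intro mult_left_mono norm_blinfun_compose) simp
    also have "\<dots> \<le> (1 / \<mu> k) * ((e k * norm (\<Delta> k)) * norm (B k))"
      using \<mu>[of k] by (intro mult_left_mono mult_right_mono T\<Delta>_norm) auto
    also have "\<dots> = (1 / 2) ^ k"
      using \<mu>[of k] e(1)[of k] AB_neq \<Delta>_neq by (simp add: \<mu>_def field_simps power_one_over)
    finally show ?thesis .
  qed
  have half_pow: "summable (\<lambda>k. (1 / 2 :: real) ^ k)"
    by (intro summable_geometric) simp
  have c_half: "(1 / (2 * c)) ^ k \<le> 1" for k
    using c(1) by (intro power_le_one) (auto simp: field_simps)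
  have t1_sum: "summable t1"
  proof (rule summable_comparison_test'[OF summable_mult[OF half_pow, of "c ^ 4 * M"]])
    fix k
    note t1_norm[of k]
    also have "c ^ 4 * M * (1 / 2) ^ k * (1 / (2 * c)) ^ k \<le> c ^ 4 * M * (1 / 2) ^ k"
      using M c(1) c_half[of k] by (intro mult_left_le) auto
    finally show "norm (t1 k) \<le> c ^ 4 * M * (1 / 2) ^ k" .
  qed
  have t2_sum: "summable t2"
    by (rule summable_comparison_test'[OF half_pow]) (rule t2_norm)
  define T2 where "T2 = suminf t2"
  have T2_ap: "blinfun_apply T2 y = (\<Sum>k. blinfun_apply (t2 k) y)" for y
    unfolding T2_def by (rule blinfun_suminf_apply[OF t2_sum])
  have t2_ap: "blinfun_apply (t2 k) y = (1 / \<mu> k) *\<^sub>R blinfun_apply T (blinfun_apply (\<Delta> k) (blinfun_apply (B k) y))" for k y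
    by (simp add: t2_def blinfun.scaleR_left)
  have T2A: "blinfun_apply T2 (blinfun_apply (A k) (blinfun_apply (\<Delta> k) x)) =
      (1 / \<mu> k) *\<^sub>R blinfun_apply T (blinfun_apply (\<Delta> k) x)" for k x
  proof -
    have "blinfun_apply T2 (blinfun_apply (A k) (blinfun_apply (\<Delta> k) x)) =
        blinfun_apply (t2 k) (blinfun_apply (A k) (blinfun_apply (\<Delta> k) x))"
      unfolding T2_ap by (rule suminf_single) (simp add: t2_ap BA_orth)
    then show ?thesis
      by (simp add: t2_ap BA' \<Delta>\<Delta>)
  qed
  define Z where "Z = {y. blinfun_apply T2 y = 0 \<and> norm y \<le> 1}"
  have "0 \<in> Z"
    by (simp add: Z_def)
  then have "Z \<noteq> {}"
    by blast
  obtain z :: "nat \<Rightarrow> 'b" where z: "range z \<subseteq> Z"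
    and z_dense: "\<And>w r N. w \<in> Z \<Longrightarrow> 0 < r \<Longrightarrow> \<exists>k\<ge>N. dist (z k) w < r"
    by (rule sequence_recurring_densely[OF v(1) \<open>Z \<noteq> {}\<close>]) (rule that; assumption)
  have z: "blinfun_apply T2 (z k) = 0" "norm (z k) \<le> 1" for k
    using z by (auto simp: Z_def)
  have "\<exists>x \<theta>. blinfun_apply (\<Delta> k) x = x \<and> norm x = 1 \<and> \<theta> \<in> dual s \<and> norm \<theta> \<le> 1 \<and>
      blinfun_apply \<theta> x = 1" for k
  proof -
    obtain u where u: "blinfun_apply (\<Delta> k) u \<noteq> 0"
      using \<Delta>_neq by (metis blinfun_eqI zero_blinfun.rep_eq)
    define x where "x = (1 / norm (blinfun_apply (\<Delta> k) u)) *\<^sub>R blinfun_apply (\<Delta> k) u"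
    have "norm x = 1" "blinfun_apply (\<Delta> k) x = x"
      using u by (simp_all add: x_def blinfun.scaleR_right \<Delta>\<Delta>)
    moreover obtain \<theta> where "\<theta> \<in> dual s" "norm \<theta> \<le> 1" "blinfun_apply \<theta> x = of_real (norm x)"
      by (rule s.norming_functional)
    ultimately show ?thesis
      by auto
  qed
  then obtain x \<theta> where x: "\<And>k. blinfun_apply (\<Delta> k) (x k) = x k" "\<And>k. norm (x k) = 1"
    and \<theta>: "\<And>k. \<theta> k \<in> dual s" "\<And>k. norm (\<theta> k) \<le> 1" "\<And>k. blinfun_apply (\<theta> k) (x k) = 1"
    by metis
  define \<epsilon> where "\<epsilon> k = (1 / (2 * c)) ^ k" for k
  have \<epsilon>: "0 < \<epsilon> k" for k
    using c(1) by (simp add: \<epsilon>_def)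
  define h where "h k = \<epsilon> k *\<^sub>R rank_one t (\<theta> k o\<^sub>L \<Delta> k) (z k)" for k
  have h_ap: "blinfun_apply (h k) u = \<epsilon> k *\<^sub>R t (blinfun_apply (\<theta> k) (blinfun_apply (\<Delta> k) u)) (z k)" for k u
    by (simp add: h_def blinfun.scaleR_left)
  have h_norm: "norm (h k) \<le> c\<^sup>2 * (1 / 2) ^ k" for k
  proof -
    have "norm (h k) \<le> \<epsilon> k * (norm (\<theta> k o\<^sub>L \<Delta> k) * norm (z k))"
      using \<epsilon>[of k] by (simp add: h_def t.norm_rank_one)
    also have "\<dots> \<le> \<epsilon> k * ((c\<^sup>2 * c ^ k) * 1)"
    proof (intro mult_left_mono mult_mono z(2))
      have "norm (\<theta> k o\<^sub>L \<Delta> k) \<le> norm (\<theta> k) * norm (\<Delta> k)"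
        by (rule norm_blinfun_compose)
      also have "\<dots> \<le> 1 * (c\<^sup>2 * c ^ k)"
        by (intro mult_mono \<theta> \<Delta>_norm) auto
      finally show "norm (\<theta> k o\<^sub>L \<Delta> k) \<le> c\<^sup>2 * c ^ k"
        by simp
    qed (use \<epsilon>[of k] c(1) in auto)
    also have "\<dots> = c\<^sup>2 * (1 / 2) ^ k"
      using c(1) by (simp add: \<epsilon>_def field_simps power_mult_distrib power_one_over)
    finally show ?thesis .
  qed
  have h_sum: "summable h"
    by (rule summable_comparison_test'[OF summable_mult[OF half_pow, of "c\<^sup>2"]]) (rule h_norm)
  define T1 where "T1 = (\<Sum>k. t1 k + h k)"
  have th_sum: "summable (\<lambda>k. t1 k + h k)"
    using t1_sum h_sum by (rule summable_add)
  have T1_ap: "blinfun_apply T1 u = (\<Sum>k. blinfun_apply (t1 k) u) + (\<Sum>k. blinfun_apply (h k) u)" for u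
    unfolding T1_def suminf_add[OF t1_sum h_sum, symmetric]
    by (simp add: blinfun.add_left blinfun_suminf_apply t1_sum h_sum)
  have t1_ap: "blinfun_apply (t1 k) u = \<mu> k *\<^sub>R blinfun_apply (A k) (blinfun_apply (\<Delta> k) u)" for k u
    by (simp add: t1_def blinfun.scaleR_left)
  have T2h: "blinfun_apply T2 (\<Sum>k. blinfun_apply (h k) u) = 0" for u
  proof -
    have T2_L: "T2 \<in> L t s"
      unfolding T2_def t2_def
      by (intro s.L_suminf[OF t2_sum[unfolded t2_def[abs_def]]] s.L_scaleR L_compose[OF _ T] L_compose[OF B(1) \<Delta>_L])
    have "blinfun_apply T2 (\<Sum>k. blinfun_apply (h k) u) = (\<Sum>k. blinfun_apply T2 (blinfun_apply (h k) u))"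
      by (rule bounded_linear.suminf[OF blinfun.bounded_linear_right blinfun_suminf_apply(2)[OF h_sum]])
    then show ?thesis
      by (simp add: h_ap blinfun.scaleR_right L_scale[OF T2_L] z)
  qed
  have T2T1: "blinfun_apply T2 (blinfun_apply T1 u) = blinfun_apply T u" for u
  proof -
    have "blinfun_apply T2 (blinfun_apply T1 u) = blinfun_apply T2 (\<Sum>k. blinfun_apply (t1 k) u)"
      by (simp add: T1_ap blinfun.add_right T2h)
    also have "\<dots> = (\<Sum>k. blinfun_apply T2 (blinfun_apply (t1 k) u))"
      by (rule bounded_linear.suminf[OF blinfun.bounded_linear_right blinfun_suminf_apply(2)[OF t1_sum]])
    also have "\<dots> = (\<Sum>k. blinfun_apply T (blinfun_apply (P (Suc k)) u) - blinfun_apply T (blinfun_apply (P k) u))"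
    proof (rule suminf_cong)
      fix k
      have "blinfun_apply T2 (blinfun_apply (t1 k) u) = blinfun_apply T (blinfun_apply (\<Delta> k) u)"
        using \<mu>[of k] by (simp add: t1_ap blinfun.scaleR_right T2A)
      then show "blinfun_apply T2 (blinfun_apply (t1 k) u) =
          blinfun_apply T (blinfun_apply (P (Suc k)) u) - blinfun_apply T (blinfun_apply (P k) u)"
        by (simp add: \<Delta>_ap blinfun.diff_right)
    qed
    also have "\<dots> = blinfun_apply T u - blinfun_apply T (blinfun_apply (P 0) u)"
      using TP by (intro sums_unique[symmetric] telescope_sums)
    finally show ?thesis
      by (simp add: P0)
  qed
  define V where "V = closure (range (blinfun_apply T1))"
  have "subspace (range (blinfun_apply T1))"
    by (intro linear_subspace_image subspace_UNIV) (simp add: blinfun.bounded_linear_right bounded_linear.linear)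
  then have V: "subspace V"
    unfolding V_def by (rule subspace_closure)
  have T1V: "blinfun_apply T1 u \<in> V" for u
    unfolding V_def by (rule closure_subset[THEN subsetD]) (rule rangeI)
  have T1x: "blinfun_apply T1 (x k) = blinfun_apply (t1 k) (x k) + \<epsilon> k *\<^sub>R z k" for k
  proof -
    have orth: "blinfun_apply (\<Delta> j) (x k) = 0" if "j \<noteq> k" for j
      using \<Delta>_orth[OF that, of "x k"] by (simp add: x)
    have "(\<Sum>j. blinfun_apply (t1 j) (x k)) = blinfun_apply (t1 k) (x k)"
      by (rule suminf_single) (simp add: t1_ap orth)
    moreover have "(\<Sum>j. blinfun_apply (h j) (x k)) = blinfun_apply (h k) (x k)"
      by (rule suminf_single) (simp add: h_ap orth)
    ultimately show ?thesis
      by (simp add: T1_ap h_ap x \<theta>)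
  qed
  \<comment> \<open>\<open>T1\<close> maps \<open>x k / \<epsilon> k\<close> to \<open>z k\<close> up to an error that tends to zero.\<close>
  have ZV: "Z \<subseteq> V"
  proof
    fix w
    assume w: "w \<in> Z"
    show "w \<in> V"
      unfolding V_def closure_approachable
    proof (intro allI impI)
      fix r :: real
      assume r: "0 < r"
      have "(\<lambda>k. c ^ 4 * M * (1 / 2) ^ k) \<longlonglongrightarrow> c ^ 4 * M * 0"
        by (intro tendsto_mult tendsto_const LIMSEQ_power_zero) simp
      then have "eventually (\<lambda>k. c ^ 4 * M * (1 / 2) ^ k < r / 2) sequentially"
        using r by (intro order_tendstoD) auto
      then obtain N where N: "\<And>k. N \<le> k \<Longrightarrow> c ^ 4 * M * (1 / 2) ^ k < r / 2"
        unfolding eventually_sequentially by blast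
      have "0 < r / 2"
        using r by simp
      then obtain k where k: "N \<le> k" "dist (z k) w < r / 2"
        using z_dense[OF w] by blast
      have "norm (blinfun_apply (t1 k) (x k)) \<le> norm (t1 k)"
        using norm_blinfun[of "t1 k" "x k"] by (simp add: x)
      also have "\<dots> \<le> (c ^ 4 * M * (1 / 2) ^ k) * \<epsilon> k"
        using t1_norm[of k] by (simp add: \<epsilon>_def)
      also have "\<dots> < (r / 2) * \<epsilon> k"
        using N[OF k(1)] \<epsilon>[of k] by (intro mult_strict_right_mono)
      finally have small_t1: "norm ((1 / \<epsilon> k) *\<^sub>R blinfun_apply (t1 k) (x k)) < r / 2"
        using \<epsilon>[of k] by (simp add: field_simps)
      have "blinfun_apply T1 ((1 / \<epsilon> k) *\<^sub>R x k) = (1 / \<epsilon> k) *\<^sub>R blinfun_apply (t1 k) (x k) + z k"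
        using \<epsilon>[of k] by (simp add: blinfun.scaleR_right T1x scaleR_add_right)
      then have "dist (blinfun_apply T1 ((1 / \<epsilon> k) *\<^sub>R x k)) w =
          norm ((1 / \<epsilon> k) *\<^sub>R blinfun_apply (t1 k) (x k) + (z k - w))"
        by (simp add: dist_norm algebra_simps)
      also have "\<dots> < r"
        using norm_triangle_ineq[of "(1 / \<epsilon> k) *\<^sub>R blinfun_apply (t1 k) (x k)" "z k - w"] small_t1 k(2)
        unfolding dist_norm by linarith
      finally show "\<exists>y\<in>range (blinfun_apply T1). dist y w < r"
        by blast
    qed
  qed
  have kerV: "y \<in> V" if "blinfun_apply T2 y = 0" for y
  proof (cases "y = 0")
    case True
    then show ?thesis
      using V by (simp add: subspace_0)
  next
    case False
    have "(1 / norm y) *\<^sub>R y \<in> V"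
      using that False by (intro ZV[THEN subsetD]) (simp add: Z_def blinfun.scaleR_right)
    then have "norm y *\<^sub>R (1 / norm y) *\<^sub>R y \<in> V"
      using V by (rule subspace_scale[rotated])
    then show ?thesis
      using False by simp
  qed
  have A\<Delta>V: "blinfun_apply (A k) (blinfun_apply (\<Delta> k) u) \<in> V" for k u
  proof -
    have "(\<Sum>j. blinfun_apply (t1 j) (blinfun_apply (\<Delta> k) u)) = blinfun_apply (t1 k) (blinfun_apply (\<Delta> k) u)"
      by (rule suminf_single) (simp add: t1_ap \<Delta>_orth)
    then have "\<mu> k *\<^sub>R blinfun_apply (A k) (blinfun_apply (\<Delta> k) u) =
        blinfun_apply T1 (blinfun_apply (\<Delta> k) u) - (\<Sum>j. blinfun_apply (h j) (blinfun_apply (\<Delta> k) u))"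
      by (simp add: T1_ap t1_ap \<Delta>\<Delta>)
    also have "\<dots> \<in> V"
      by (intro subspace_diff V T1V kerV T2h)
    finally have "(1 / \<mu> k) *\<^sub>R \<mu> k *\<^sub>R blinfun_apply (A k) (blinfun_apply (\<Delta> k) u) \<in> V"
      using V by (rule subspace_scale[rotated])
    then show ?thesis
      using \<mu>[of k] by simp
  qed
  \<comment> \<open>Subtracting \<open>y'\<close> from \<open>y\<close> removes all components that \<open>T2\<close> can see.\<close>
  have QV: "y \<in> V" if y: "blinfun_apply (Q n) y = y" for n y
  proof -
    define y' where "y' = (\<Sum>k<n. blinfun_apply (A k) (blinfun_apply (\<Delta> k) (blinfun_apply (B k) y)))"
    have "y' \<in> V"
      unfolding y'_def by (intro subspace_sum V A\<Delta>V)
    have By': "blinfun_apply (B j) y' = (if j < n then blinfun_apply (\<Delta> j) (blinfun_apply (B j) y) else 0)" for j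
    proof -
      have "blinfun_apply (B j) y' = (\<Sum>k<n. if k = j then blinfun_apply (\<Delta> k) (blinfun_apply (B k) y) else 0)"
        unfolding y'_def blinfun.sum_right by (intro sum.cong) (auto simp: BA_orth BA')
      then show ?thesis
        by simp
    qed
    have "blinfun_apply (\<Delta> j) (blinfun_apply (B j) (y - y')) = 0" for j
    proof (cases "j < n")
      case True
      then show ?thesis
        by (simp add: blinfun.diff_right By' \<Delta>\<Delta>)
    next
      case False
      then have "blinfun_apply (Q j) y = y"
        using QQ(1)[of n j y] by (simp add: y)
      then have "blinfun_apply (B j) y = 0"
        using B(3)[of j y] by simp
      with False show ?thesis
        by (simp add: blinfun.diff_right By')
    qed
    then have "blinfun_apply T2 (y - y') = 0"
      by (simp add: T2_ap t2_ap)
    then have "(y - y') + y' \<in> V"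
      by (intro subspace_add V kerV \<open>y' \<in> V\<close>)
    then show ?thesis
      by simp
  qed
  have "range v \<subseteq> V"
    using QV v(2) by blast
  then have "closure (range v) \<subseteq> V"
    by (rule closure_minimal) (simp add: V_def)
  then have dense: "closure (range (blinfun_apply T1)) = UNIV"
    using v(1) by (auto simp: V_def)
  have \<Delta>_rank: "\<exists>r. finite_rank s s r (\<Delta> k)" for k
  proof -
    have "\<Delta> k = P (Suc k) + (- 1) *\<^sub>R P k"
      by (simp add: \<Delta>_def)
    then show ?thesis
      using s.finite_rank_add s.finite_rank_scaleR P_rank by metis
  qed
  show ?thesis
  proof (intro exI conjI)
    show "T1 \<in> L s t"
      unfolding T1_def
    proof (rule t.L_suminf[OF th_sum])
      show "t1 k + h k \<in> L s t" for k
        unfolding t1_def h_def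
        by (intro t.L_add t.L_scaleR t.rank_one_in_L L_compose[OF \<Delta>_L A(1)] dual_compose[OF \<Delta>_L \<theta>(1)])
    qed
    show "T2 \<in> L t s"
      unfolding T2_def
    proof (rule s.L_suminf[OF t2_sum])
      show "t2 k \<in> L t s" for k
        unfolding t2_def by (intro s.L_scaleR L_compose[OF _ T] L_compose[OF B(1) \<Delta>_L])
    qed
    show "T = T2 o\<^sub>L T1"
      by (rule blinfun_eqI) (simp add: T2T1)
    show "closure (range (blinfun_apply T1)) = UNIV"
      by (rule dense)
    show "compact_operator T1"
      unfolding T1_def
    proof (rule t.compact_operator_suminf[OF th_sum])
      fix k
      obtain r where "finite_rank s s r (\<Delta> k)"
        using \<Delta>_rank by blast
      then have "finite_rank s t r (t1 k)"
        unfolding t1_def by (intro t.finite_rank_scaleR s.finite_rank_compose_left[OF _ A(1)])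
      moreover have "finite_rank s t 1 (h k)"
        unfolding h_def
        by (intro t.finite_rank_scaleR t.finite_rank_rank_one dual_compose[OF \<Delta>_L \<theta>(1)])
      ultimately show "\<exists>r. finite_rank s t r (t1 k + h k)"
        using t.finite_rank_add by blast
    qed
    show "compact_operator T2"
      unfolding T2_def
    proof (rule s.compact_operator_suminf[OF t2_sum])
      fix k
      obtain r where "finite_rank s s r (\<Delta> k)"
        using \<Delta>_rank by blast
      then show "\<exists>r. finite_rank t s r (t2 k)"
        unfolding t2_def
        by (intro exI s.finite_rank_scaleR s.finite_rank_compose_left[OF _ T]
            finite_rank_compose_right[OF _ B(1)])
    qed
  qed
qed

section \<open>Estimates and degenerate cases\<close>

text \<open>
  The last claim is the recursion for the norms in \<open>factorization_step\<close>: if \<open>q\<close> is the norm of \<open>Q\<close>, then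
  \<open>e\<close> bounds the norm of \<open>E\<close> and \<open>D e\<^sup>d\<close> that of \<open>F\<close>. The exponents \<open>(k + 1) d\<^sup>k\<close> of the Gamma
  factor absorb in each step that \<open>q\<close> is raised to the power \<open>d\<close> and multiplied by a constant, which is at most
  \<open>(4 D (C + 3))\<^sup>d\<close>.
\<close>

lemma Gamma_fac_bounds:
  assumes D: "1 \<le> D" and C: "1 \<le> C" and d: "1 \<le> d"
  defines "\<gamma> \<equiv> 4 * D * (C + 3)"
  shows "\<gamma> ^ (k + 1) \<le> Gamma_fac d D C k" and "Gamma_fac d D C k \<le> Gamma_fac d D C (Suc k)"
    and "2 * (1 + C) \<le> \<gamma>"
    and "\<And>q e. 0 \<le> q \<Longrightarrow> q \<le> Gamma_fac d D C k \<Longrightarrow> e = (1 + C) * (1 + 2 * q) + C \<Longrightarrow>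
      e + D * e powr d \<le> Gamma_fac d D C (Suc k) \<and> e * (D * e powr d) \<le> (Gamma_fac d D C (Suc k))\<^sup>2"
proof -
  define G where "G = Gamma_fac d D C"
  have G: "G j = \<gamma> powr (real (j + 1) * d ^ j)" for j
    by (simp add: G_def Gamma_fac_def \<gamma>_def)
  have "4 * 1 * (C + 3) \<le> 4 * D * (C + 3)"
    using D C by (intro mult_right_mono mult_left_mono) auto
  then have \<gamma>_ge4: "4 * (C + 3) \<le> \<gamma>"
    by (simp only: \<gamma>_def mult_1_right)
  then show \<gamma>_ge: "2 * (1 + C) \<le> \<gamma>"
    using C by simp
  have \<gamma>1: "1 \<le> \<gamma>"
    using \<gamma>_ge C by simp
  have d_pow: "1 \<le> d ^ j" for j
    using d by (rule one_le_power)
  have pow_le_G: "\<gamma> ^ (j + 1) \<le> G j" for j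
  proof -
    have "\<gamma> ^ (j + 1) = \<gamma> powr real (j + 1)"
      using \<gamma>1 by (subst powr_realpow) auto
    also have "\<dots> \<le> G j"
      unfolding G using \<gamma>1 d_pow[of j] mult_left_mono[OF d_pow[of j], of "real (j + 1)"]
      by (intro powr_mono) auto
    finally show ?thesis .
  qed
  then show "\<gamma> ^ (k + 1) \<le> Gamma_fac d D C k"
    by (simp add: G_def)
  have "real (k + 1) * d ^ k \<le> real (Suc k + 1) * d ^ Suc k"
    using d d_pow[of k] by (intro mult_mono power_increasing) auto
  then show "Gamma_fac d D C k \<le> Gamma_fac d D C (Suc k)"
    unfolding G_def[symmetric] G using \<gamma>1 by (intro powr_mono) auto
  fix q e
  assume q: "0 \<le> q" "q \<le> Gamma_fac d D C k" and e: "e = (1 + C) * (1 + 2 * q) + C"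
  have \<gamma>_le_G: "\<gamma> \<le> G k"
  proof -
    have "\<gamma> ^ 1 \<le> \<gamma> ^ (k + 1)"
      using \<gamma>1 by (intro power_increasing) auto
    with pow_le_G[of k] show ?thesis
      by simp
  qed
  have e1: "1 \<le> e"
    using q(1) C mult_mono[of 1 "1 + C" 1 "1 + 2 * q"] unfolding e by simp
  \<comment> \<open>The constant term \<open>1 + 2 C\<close> of \<open>e\<close> is at most \<open>\<gamma> / 2\<close> and hence \<open>G k / 2\<close>.\<close>
  have e_le: "e \<le> (2 * C + 5 / 2) * G k"
  proof -
    have "e \<le> (1 + C) * (1 + 2 * G k) + C"
      unfolding e using q(2) C by (intro add_right_mono mult_left_mono) (auto simp: G_def)
    also have "\<dots> = (2 * C + 2) * G k + (1 + 2 * C)"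
      by (simp add: algebra_simps)
    also have "\<dots> \<le> (2 * C + 2) * G k + G k / 2"
      using \<gamma>_le_G \<gamma>_ge4 C by simp
    finally show ?thesis
      by (simp add: algebra_simps)
  qed
  have G_pos: "0 < G k"
    using \<gamma>_le_G \<gamma>1 by simp
  have half: "2 * (D * e powr d) \<le> G (Suc k)"
  proof -
    have "2 * D = (2 * D) powr 1"
      using D by simp
    also have "\<dots> \<le> (2 * D) powr d"
      using D d by (intro powr_mono) auto
    finally have "2 * D * e powr d \<le> (2 * D) powr d * e powr d"
      by (intro mult_right_mono) auto
    also have "\<dots> = (2 * D * e) powr d"
      using D e1 by (simp add: powr_mult)
    also have "\<dots> \<le> (\<gamma> * G k) powr d"
    proof (rule powr_mono2)
      have "2 * D * e \<le> 2 * D * ((2 * C + 5 / 2) * G k)"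
        using e_le D by (intro mult_left_mono) auto
      also have "\<dots> = (4 * D * (C + 5 / 4)) * G k"
        by (simp add: algebra_simps)
      also have "\<dots> \<le> \<gamma> * G k"
        unfolding \<gamma>_def using D C G_pos by (intro mult_right_mono mult_left_mono) auto
      finally show "2 * D * e \<le> \<gamma> * G k" .
    qed (use d D e1 in auto)
    also have "\<dots> = \<gamma> powr d * \<gamma> powr (real (k + 1) * d ^ Suc k)"
      using \<gamma>1 G_pos by (simp add: powr_mult G powr_powr mult_ac)
    also have "\<dots> = \<gamma> powr (d + real (k + 1) * d ^ Suc k)"
      by (simp add: powr_add)
    also have "\<dots> \<le> \<gamma> powr (d ^ Suc k + real (k + 1) * d ^ Suc k)"
      using \<gamma>1 d d_pow[of k] mult_left_mono[OF d_pow[of k], of d] by (intro powr_mono) auto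
    also have "d ^ Suc k + real (k + 1) * d ^ Suc k = real (Suc k + 1) * d ^ Suc k"
      by (simp add: algebra_simps)
    finally show ?thesis
      by (simp add: G)
  qed
  have e_le': "e \<le> D * e powr d"
  proof -
    have "e = e powr 1"
      using e1 by simp
    also have "\<dots> \<le> e powr d"
      using e1 d by (intro powr_mono) auto
    also have "\<dots> \<le> D * e powr d"
      using D mult_right_mono[of 1 D "e powr d"] by simp
    finally show ?thesis .
  qed
  have "e * (D * e powr d) \<le> G (Suc k) * G (Suc k)"
    using half e_le' e1 by (intro mult_mono) auto
  with half e_le' show "e + D * e powr d \<le> Gamma_fac d D C (Suc k) \<and>
      e * (D * e powr d) \<le> (Gamma_fac d D C (Suc k))\<^sup>2"
    by (auto simp: G_def power2_eq_square)
qed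

text \<open>
  The infimum need not be attained, whence \<open>\<tau>\<close>.
\<close>

lemma (in banach_over) approx_number_bounds:
  fixes T :: "'a \<Rightarrow>\<^sub>L 'a"
  assumes n: "1 \<le> n"
  shows "0 \<le> approx_number s s T n" and "approx_number s s T n \<le> norm T"
    and "0 < \<tau> \<Longrightarrow> \<exists>A\<in>L s s. finite_rank s s n A \<and> norm (T - A) \<le> approx_number s s T n + \<tau>"
proof -
  define X where "X = {norm (T - A) | A. A \<in> L s s \<and> fin_dim_subspace s (range (blinfun_apply A)) \<and>
                            dim (range (blinfun_apply A)) < n}"
  have a: "approx_number s s T n = Inf X"
    by (simp add: approx_number_def X_def)
  have "range (blinfun_apply (0 :: 'a \<Rightarrow>\<^sub>L 'a)) \<subseteq> span {}"
    by auto
  then have "fin_dim_subspace s (range (blinfun_apply (0 :: 'a \<Rightarrow>\<^sub>L 'a)))"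
      "dim (range (blinfun_apply (0 :: 'a \<Rightarrow>\<^sub>L 'a))) \<le> card ({} :: 'a set)"
    using subspace_range_L[OF _ L_zero[of s]] vector_space_axioms
    by (blast intro: fin_dim_if_subset_span)+
  then have T_in: "norm T \<in> X"
    unfolding X_def using n L_zero[of s] by (auto intro!: exI[of _ 0])
  have bdd: "bdd_below X"
    by (rule bdd_belowI[of _ 0]) (auto simp: X_def)
  show "0 \<le> approx_number s s T n"
    unfolding a using T_in by (intro cInf_greatest) (auto simp: X_def)
  show "approx_number s s T n \<le> norm T"
    unfolding a using T_in bdd by (rule cInf_lower)
  assume "0 < \<tau>"
  then have "Inf X < Inf X + \<tau>"
    by simp
  then obtain y where "y \<in> X" "y < Inf X + \<tau>"
    using cInf_lessD T_in by (metis empty_iff)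
  then obtain A where A: "A \<in> L s s" "fin_dim_subspace s (range (blinfun_apply A))"
      "dim (range (blinfun_apply A)) < n" "norm (T - A) < Inf X + \<tau>"
    unfolding X_def by blast
  then have "finite_rank s s n A"
    by (intro finite_rank_if_fin_dim_range[OF A(1,2)]) auto
  with A show "\<exists>A\<in>L s s. finite_rank s s n A \<and> norm (T - A) \<le> approx_number s s T n + \<tau>"
    unfolding a by (intro bexI[of _ A]) auto
qed

text \<open>
  A projection onto a line that comes from a norming functional has norm one, and the projection that
  property (D) associates with it has at least this norm.
\<close>

lemma property_D_constant_ge_1:
  fixes s :: "'k::real_or_complex \<Rightarrow> 'a::banach \<Rightarrow> 'a"
  assumes s: "banach_over s" and D: "property_D s f d D" and x: "(x :: 'a) \<noteq> 0"
  shows "1 \<le> D"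
proof -
  interpret s: banach_over s by fact
  obtain \<phi> where \<phi>: "\<phi> \<in> dual s" "norm \<phi> \<le> 1" "blinfun_apply \<phi> x = of_real (norm x)"
    by (rule s.norming_functional)
  define u where "u = (1 / norm x) *\<^sub>R x"
  have u: "norm u = 1" "blinfun_apply \<phi> u = 1"
    using x \<phi>(3) by (simp_all add: u_def blinfun.scaleR_right) (simp add: scaleR_conv_of_real flip: of_real_mult)
  define E where "E = rank_one s \<phi> u"
  have idem: "blinfun_apply E (blinfun_apply E y) = blinfun_apply E y" for y
    by (simp add: E_def dual_scale_right[OF \<phi>(1)] u)
  have "blinfun_apply E u = u"
    by (simp add: E_def u)
  then have "E \<noteq> 0"
    using u(1) by auto
  have "norm E \<le> norm \<phi> * norm u"
    unfolding E_def by (rule s.norm_rank_one)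
  then have "norm E = 1"
    using norm_idempotent_ge_1[OF idem \<open>E \<noteq> 0\<close>] \<phi>(2) u(1) by simp
  have E: "E \<in> L s s" "finite_rank s s 1 E"
    unfolding E_def by (intro s.rank_one_in_L s.finite_rank_rank_one \<phi>(1))+
  obtain F :: "'a \<Rightarrow>\<^sub>L 'a" where F: "F \<noteq> 0" "\<And>y. blinfun_apply F (blinfun_apply F y) = blinfun_apply F y"
      "norm F \<le> D * norm E powr d"
    by (rule property_D_operators[OF s D E(1) idem \<open>E \<noteq> 0\<close> E(2)]) (rule that; assumption)
  with norm_idempotent_ge_1[OF F(2,1)] show ?thesis
    by (simp add: \<open>norm E = 1\<close>)
qed

text \<open>
  Property (D) forces infinite dimension: nothing except \<open>0\<close> is orthogonal to the identity.
\<close>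

lemma property_D_finite_rank_neq_id:
  fixes s :: "'k::real_or_complex \<Rightarrow> 'a::banach \<Rightarrow> 'a"
  assumes s: "banach_over s" and D: "property_D s f d D" and x: "(x :: 'a) \<noteq> 0"
    and P: "P \<in> L s s" "finite_rank s s r P"
  shows "\<exists>x. blinfun_apply P x \<noteq> x"
proof (rule ccontr)
  assume "\<not> (\<exists>x. blinfun_apply P x \<noteq> x)"
  then have id: "blinfun_apply P y = y" for y
    by blast
  then have idem: "blinfun_apply P (blinfun_apply P y) = blinfun_apply P y" for y
    by simp
  have "P \<noteq> 0"
    using id[of x] x by auto
  obtain F :: "'a \<Rightarrow>\<^sub>L 'a" where F: "F \<noteq> 0" "\<And>y. blinfun_apply P (blinfun_apply F y) = 0"
    by (rule property_D_operators[OF s D P(1) idem \<open>P \<noteq> 0\<close> P(2)]) (rule that; assumption)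
  then have "F = 0"
    by (intro blinfun_eqI) (simp add: id)
  with F(1) show False ..
qed

lemma local_dist_zero_space:
  fixes s :: "'k::real_or_complex \<Rightarrow> 'a::banach \<Rightarrow> 'a" and t :: "'k \<Rightarrow> 'b::banach \<Rightarrow> 'b"
  assumes s: "banach_over s" and t: "banach_over t" and refl: "reflexive s" "reflexive t"
    and C: "0 \<le> C" and ld: "local_dist K C dual_scale (dual s) dual_scale (dual t) 1 < ennreal r"
    and zero: "\<And>x :: 'a. x = 0"
  shows "(y :: 'b) = 0"
proof (rule ccontr)
  interpret t: banach_over t by fact
  interpret dt: vector_space "dual_scale :: 'k \<Rightarrow> ('b \<Rightarrow>\<^sub>L 'k) \<Rightarrow> _"
    by (rule vector_space_dual_scale)
  assume "y \<noteq> 0"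
  then obtain \<phi> where \<phi>: "\<phi> \<in> dual t" "blinfun_apply \<phi> y \<noteq> 0"
    by (rule t.dual_separates)
  obtain U :: "'a \<Rightarrow>\<^sub>L 'b" and V :: "'b \<Rightarrow>\<^sub>L 'a" where "\<And>\<psi>. \<psi> \<in> dt.span {\<phi>} \<Longrightarrow> \<psi> o\<^sub>L (U o\<^sub>L V) = \<psi>"
    by (rule local_dist_operators[OF s t refl C ld, of "{}" "{\<phi>}"]) (use \<phi>(1) in auto)
  then have "\<phi> o\<^sub>L (U o\<^sub>L V) = \<phi>"
    by (simp add: dt.span_base)
  then have "blinfun_apply \<phi> (blinfun_apply U (blinfun_apply V y)) = blinfun_apply \<phi> y"
    by (metis blinfun_apply_blinfun_compose)
  moreover have "blinfun_apply V y = 0"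
    by (rule zero)
  ultimately show False
    using \<phi>(2) by simp
qed

text \<open>
  The infimum in the definition of the local distance need not be attained; the factor \<open>2\<close> leaves room for a
  strict inequality. For \<open>a = 0\<close> the bound is infinite and only finiteness of \<open>l\<close> is left.
\<close>

lemma radius_if_less_top:
  assumes "l < (\<infinity> :: ennreal)"
    and "a \<noteq> 0 \<Longrightarrow> l \<le> ennreal b * neg_pow a p" and "0 \<le> a" "0 < b"
  shows "\<exists>r>0. l < ennreal r \<and> (a \<noteq> 0 \<longrightarrow> r \<le> 2 * b * a powr (- p))"
proof (cases "a = 0")
  case True
  obtain q where "0 \<le> q" "l = ennreal q"
    using assms(1) by (cases l) auto
  then have "0 < q + 1" "l < ennreal (q + 1)"
    by (auto simp: ennreal_less_iff)
  with True show ?thesis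
    by blast
next
  case False
  define r where "r = 2 * b * a powr (- p)"
  have r: "0 < r"
    using False assms(3,4) by (simp add: r_def)
  have "l \<le> ennreal (r / 2)"
    using assms(2)[OF False] False assms(4) by (simp add: neg_pow_def r_def ennreal_mult')
  also have "\<dots> < ennreal r"
    using r by (simp add: ennreal_less_iff)
  finally show ?thesis
    using r by (auto simp: r_def intro!: exI[of _ r])
qed

text \<open>
  The balance behind the hypotheses. The total exponent of \<open>a\<close> is \<open>-\<beta>\<close> from \<open>f\<close>, \<open>-(1 - 4 max \<alpha> \<beta>) / 4\<close> from
  \<open>r\<close> and \<open>1\<close> from the approximation of \<open>T\<close>, which is between \<open>0\<close> and \<open>1\<close>, and the fifth power of \<open>G\<close> is
  cancelled by \<open>r\<close>. The summand \<open>1 / (f r G\<^sup>5)\<close> is the tolerance in the choice of the approximation;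
  it contributes at most \<open>1\<close>, and for \<open>a = 0\<close> it is all that is left.
\<close>

lemma approximation_cost_bound:
  fixes a b f r G C' \<alpha> \<beta> :: real
  assumes a: "0 \<le> a" "a \<le> b" and pos: "0 < f" "0 < r" "0 < G" "0 < C'" and k: "1 \<le> k"
    and params: "0 \<le> \<alpha>" "\<alpha> < 1 / 4" "0 \<le> \<beta>" "\<beta> < 1 / 4"
    and f: "ennreal f \<le> ennreal C' * neg_pow a \<beta>"
    and r: "a \<noteq> 0 \<Longrightarrow> r \<le> 2 * (C' * real k powr (- 3 / 4) * G powr (- 5)) *
      a powr (- ((1 - 4 * max \<alpha> \<beta>) / 4))"
  shows "f * r * (a + 1 / (f * r * G ^ 5)) * G ^ 5 \<le> 2 * C'\<^sup>2 * (1 + b) + 1"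
proof -
  have "f * r * a * G ^ 5 \<le> 2 * C'\<^sup>2 * (1 + b)"
  proof (cases "a = 0")
    case True
    then show ?thesis
      using a by simp
  next
    case False
    with a have a0: "0 < a"
      by simp
    define p where "p = (1 - 4 * max \<alpha> \<beta>) / 4"
    have "ennreal f \<le> ennreal (C' * a powr (- \<beta>))"
      using f False pos by (simp add: neg_pow_def ennreal_mult')
    then have f_le: "f \<le> C' * a powr (- \<beta>)"
      using pos by (simp add: ennreal_le_iff)
    have "f * r \<le> (C' * a powr (- \<beta>)) * (2 * (C' * real k powr (- 3 / 4) * G powr (- 5)) * a powr (- p))"
      using pos f_le r[OF False] by (intro mult_mono) (auto simp: p_def)
    also have "\<dots> = 2 * C'\<^sup>2 * real k powr (- 3 / 4) * G powr (- 5) * a powr (- \<beta> - p)"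
      using a0 by (simp add: power2_eq_square powr_diff powr_minus powr_add field_simps)
    finally have "f * r * a * G ^ 5 \<le>
        2 * C'\<^sup>2 * real k powr (- 3 / 4) * G powr (- 5) * a powr (- \<beta> - p) * a * G ^ 5"
      using a0 pos by (intro mult_right_mono) auto
    also have "\<dots> = 2 * C'\<^sup>2 * (G powr (- 5) * G ^ 5) * real k powr (- 3 / 4) * (a powr (- \<beta> - p) * a)"
      by simp
    also have "G powr (- 5) * G ^ 5 = 1"
      using pos by (simp add: powr_minus powr_numeral)
    also have "a powr (- \<beta> - p) * a = a powr (1 - \<beta> - p)"
      using a0 powr_add[of a "- \<beta> - p" 1] by (simp add: algebra_simps)
    also have "2 * C'\<^sup>2 * 1 * real k powr (- 3 / 4) * a powr (1 - \<beta> - p) \<le> 2 * C'\<^sup>2 * 1 * 1 * (1 + b)"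
    proof (intro mult_mono)
      have "real k powr (- 3 / 4) \<le> real k powr 0"
        using k by (intro powr_mono) auto
      then show "real k powr (- 3 / 4) \<le> 1"
        using k by simp
      have q: "0 \<le> 1 - \<beta> - p" "1 - \<beta> - p \<le> 1"
        using params by (auto simp: p_def)
      have "a powr (1 - \<beta> - p) \<le> (1 + b) powr (1 - \<beta> - p)"
        using a q by (intro powr_mono2) auto
      also have "\<dots> \<le> (1 + b) powr 1"
        using a q by (intro powr_mono) auto
      also have "\<dots> = 1 + b"
        using a by simp
      finally show "a powr (1 - \<beta> - p) \<le> 1 + b" .
    qed (use pos a in auto)
    finally show ?thesis
      by simp
  qed
  moreover have "f * r * (a + 1 / (f * r * G ^ 5)) * G ^ 5 = f * r * a * G ^ 5 + 1"
    using pos by (simp add: field_simps)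
  ultimately show ?thesis
    by simp
qed

section \<open>The factorization theorem\<close>

theorem theorem2p8:
  fixes s :: "'k::real_or_complex \<Rightarrow> 'x::banach \<Rightarrow> 'x"
    and t :: "'k \<Rightarrow> 'y::banach \<Rightarrow> 'y"
    and T :: "'x \<Rightarrow>\<^sub>L 'x"
    and K m :: "nat \<Rightarrow> nat"
    and f\<^sub>X f\<^sub>Y :: "nat \<Rightarrow> real"
    and C C' \<alpha> \<beta> d\<^sub>X D\<^sub>X d\<^sub>Y D\<^sub>Y d D :: real
  assumes X: "banach_over s" and Y: "banach_over t"
    and separable: "separable_space (euclidean :: 'x topology)"
                   "separable_space (euclidean :: 'y topology)"
    and reflexive: "reflexive s" "reflexive t"
    and C: "C \<ge> 1"
    and K: "mono_on {1..} K" "\<forall>n\<ge>1. K n \<ge> 1"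
    and ld_finite: "\<forall>n\<ge>1. local_dist K C dual_scale (dual s) dual_scale (dual t) n < \<infinity>"
    and T: "T \<in> L s s" "compact_operator T"
    and m: "m 0 = 2" "\<forall>k\<ge>1. m k \<ge> K (4 * m (k - 1) + 2) + 1"
    and params: "0 \<le> \<alpha>" "\<alpha> < 1 / 4" "0 \<le> \<beta>" "\<beta> < 1 / 4" "C' > 0"
    and D_X: "property_D s f\<^sub>X d\<^sub>X D\<^sub>X"
    and D_Y: "property_D t f\<^sub>Y d\<^sub>Y D\<^sub>Y"
    and f_X: "\<forall>k\<ge>1. \<forall>n\<in>{1..m (k + 1)}.
        ennreal (f\<^sub>X n) \<le> ennreal C' * neg_pow (approx_number s s T (m (k - 1))) \<alpha>"
    and f_Y: "\<forall>k\<ge>1. \<forall>n\<in>{1..m (k + 1)}.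
        ennreal (f\<^sub>Y n) \<le> ennreal C' * neg_pow (approx_number s s T (m (k - 1))) \<beta>"
    and d_def: "d = Max {d\<^sub>X, d\<^sub>Y, 1}" and D_def: "D = max D\<^sub>X D\<^sub>Y"
    and ld_bound: "\<forall>k\<ge>1.
        local_dist K C dual_scale (dual s) dual_scale (dual t) (4 * m (k + 1))
          \<le> ennreal (C' * real k powr (- 3 / 4) * Gamma_fac d D C (k + 2) powr (- 5)) *
             neg_pow (approx_number s s T (m k)) ((1 - 4 * max \<alpha> \<beta>) / 4)"
  shows "\<exists>T1 T2. T1 \<in> L s t \<and> T2 \<in> L t s \<and> T = T2 o\<^sub>L T1 \<and>
           closure (range (blinfun_apply T1)) = UNIV \<and>
           compact_operator T1 \<and> compact_operator T2"
proof (cases "\<forall>x :: 'x. x = 0")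
  case True
  \<comment> \<open>For \<open>X = 0\<close> the local distance forces \<open>Y = 0\<close>.\<close>
  obtain r where "local_dist K C dual_scale (dual s) dual_scale (dual t) 1 < ennreal r"
    using ld_finite radius_if_less_top[where a = 0 and b = 1 and p = 1] by force
  then have Y0: "y = 0" for y :: 'y
    using C True by (intro local_dist_zero_space[OF X Y reflexive]) auto
  interpret s: banach_over s by (rule X)
  interpret t: banach_over t by (rule Y)
  have "T = 0 o\<^sub>L (0 :: 'x \<Rightarrow>\<^sub>L 'y)"
    using True by (intro blinfun_eqI) simp
  moreover have "closure (range (blinfun_apply (0 :: 'x \<Rightarrow>\<^sub>L 'y))) = UNIV"
    using Y0 by (auto simp: image_def)
  moreover have "compact_operator (0 :: 'x \<Rightarrow>\<^sub>L 'y)" "compact_operator (0 :: 'y \<Rightarrow>\<^sub>L 'x)"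
    by (simp_all add: compact_operator_def image_constant_conv)
  ultimately show ?thesis
    using t.L_zero[of s] s.L_zero[of t] by blast
next
  case False
  then obtain x0 :: 'x where x0: "x0 \<noteq> 0"
    by blast
  interpret s: banach_over s by (rule X)
  interpret t: banach_over t by (rule Y)
  have D: "1 \<le> D" "D\<^sub>Y \<le> D"
    using property_D_constant_ge_1[OF X D_X x0] by (auto simp: D_def)
  have d: "1 \<le> d" "d\<^sub>Y \<le> d"
    by (auto simp: d_def)
  define \<gamma> where "\<gamma> = 4 * D * (C + 3)"
  define c where "c = 1 + C"
  define G where "G = Gamma_fac d D C"
  note G_bounds = Gamma_fac_bounds[OF D(1) C d(1), folded G_def \<gamma>_def]
  have \<gamma>: "2 * c \<le> \<gamma>" "1 \<le> \<gamma>"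
    using G_bounds(3) C by (auto simp: c_def)
  have G1: "1 \<le> G k" for k
    using one_le_power[OF \<gamma>(2), of "k + 1"] G_bounds(1)[of k] by (rule order_trans)
  define a where "a k = approx_number s s T (m k)" for k
  have m1: "1 \<le> m k" for k
    using m(1) m(2)[rule_format, of k] by (cases "k = 0") auto
  have K_le: "K (4 * m (k + 1)) \<le> m (k + 2)" for k
  proof -
    have "K (4 * m (k + 1)) \<le> K (4 * m (k + 1) + 2)"
      using m1[of "k + 1"] by (intro mono_onD[OF K(1)]) auto
    also have "\<dots> \<le> m (k + 2)"
      using m(2)[rule_format, of "k + 2"] by simp
    finally show ?thesis .
  qed
  have a: "0 \<le> a k" "a k \<le> norm T" for k
    using s.approx_number_bounds(1,2)[OF m1] by (auto simp: a_def)
  define f where "f k = f\<^sub>Y (m (k + 2))" for k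
  have f_pos: "0 < f k" for k
    using D_Y m1[of "k + 2"] unfolding property_D_def f_def by blast
  define ld where "ld k = local_dist K C dual_scale (dual s) dual_scale (dual t) (4 * m (k + 1))" for k
  have "\<exists>r>0. ld k < ennreal r \<and> (1 \<le> k \<longrightarrow> a k \<noteq> 0 \<longrightarrow>
      r \<le> 2 * (C' * real k powr (- 3 / 4) * G (k + 2) powr (- 5)) *
        a k powr (- ((1 - 4 * max \<alpha> \<beta>) / 4)))" for k
  proof -
    have fin: "ld k < \<infinity>"
      using ld_finite m1[of "k + 1"] unfolding ld_def by simp
    show ?thesis
    proof (cases "1 \<le> k")
      case True
      then have "0 < C' * real k powr (- 3 / 4) * G (k + 2) powr (- 5)"
        using params(5) less_le_trans[OF zero_less_one G1[of "k + 2"]] by simp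
      with radius_if_less_top[OF fin _ a(1)[of k] this] ld_bound True show ?thesis
        unfolding ld_def a_def G_def by blast
    next
      case False
      with radius_if_less_top[OF fin, where a = 0 and b = 1 and p = 1] show ?thesis
        by auto
    qed
  qed
  then obtain r where r: "\<And>k. 0 < r k" "\<And>k. ld k < ennreal (r k)"
    and r_le: "\<And>k. 1 \<le> k \<Longrightarrow> a k \<noteq> 0 \<Longrightarrow>
      r k \<le> 2 * (C' * real k powr (- 3 / 4) * G (k + 2) powr (- 5)) *
        a k powr (- ((1 - 4 * max \<alpha> \<beta>) / 4))"
    by metis
  define \<tau> where "\<tau> k = 1 / (f k * r k * G (k + 2) ^ 5)" for k
  have G_pos: "0 < G k" for k
    using G1[of k] by linarith
  have \<tau>: "0 < \<tau> k" for k
    using f_pos r(1) G_pos by (simp add: \<tau>_def)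
  have "\<exists>S\<in>L s s. finite_rank s s (m k) S \<and> norm (T - S) \<le> a k + \<tau> k" for k
    using s.approx_number_bounds(3)[OF m1 \<tau>] by (simp add: a_def)
  then obtain S0 where S0: "\<And>k. S0 k \<in> L s s" "\<And>k. finite_rank s s (m k) (S0 k)"
      "\<And>k. norm (T - S0 k) \<le> a k + \<tau> k"
    by metis
  \<comment> \<open>At \<open>k = 0\<close> the condition \<open>S 0 P\<^sub>0 = S 0\<close> with \<open>P\<^sub>0 = 0\<close> leaves no choice. No hypothesis bounds the
    local distance at this stage, but a single term does no harm: \<open>M\<close> below accounts for it.\<close>
  define S where "S k = (if k = 0 then 0 else S0 k)" for k
  define e where "e k = (if k = 0 then norm T + 1 else a k + \<tau> k)" for k
  have e: "0 < e k" "norm (T - S k) \<le> e k" for k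
    using S0(3)[of k] a(1)[of k] \<tau>[of k] by (auto simp: e_def S_def intro: add_nonneg_pos)
  define M where "M = max (f 0 * r 0 * e 0 * G 2 ^ 5) (2 * C'\<^sup>2 * (1 + norm T) + 1)"
  have cost: "f k * r k * e k * G (k + 2) ^ 5 \<le> M" for k
  proof (cases "k = 0")
    case True
    then show ?thesis
      by (simp add: M_def numeral_2_eq_2)
  next
    case False
    then have k: "1 \<le> k"
      by simp
    have "ennreal (f k) \<le> ennreal C' * neg_pow (a k) \<beta>"
      using f_Y[rule_format, of "k + 1" "m (k + 2)"] m1[of "k + 2"] by (simp add: f_def a_def)
    from approximation_cost_bound[OF a f_pos r(1) G_pos params(5) k params(1-4) this r_le[OF k]]
    show ?thesis
      using False by (simp add: e_def \<tau>_def M_def)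
  qed
  obtain v :: "nat \<Rightarrow> 'y" where v: "closure (range v) = UNIV"
    using dense_sequence_if_separable[OF separable(2)] by blast
  \<comment> \<open>The ranks of \<open>P\<^sub>k\<close>, \<open>Q\<^sub>k\<close> and \<open>S\<^sub>k\<^sub>+\<^sub>1\<close> are at most \<open>m (k + 1)\<close>, \<open>2 m (k + 1)\<close> and \<open>m (k + 1)\<close>, so that
    together with one more dimension on either side they fit into the local distance at \<open>4 m (k + 1)\<close>,
    for which \<open>K\<close> returns rank at most \<open>m (k + 2)\<close>.\<close>
  define good where "good k P Q \<longleftrightarrow>
      P \<in> L s s \<and> (\<forall>x. blinfun_apply P (blinfun_apply P x) = blinfun_apply P x) \<and>
      finite_rank s s (m (k + 1)) P \<and> 1 + norm P \<le> c ^ k \<and>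
      (\<forall>x. blinfun_apply (S k) (blinfun_apply P x) = blinfun_apply (S k) x) \<and> (k = 0 \<longrightarrow> P = 0) \<and>
      Q \<in> L t t \<and> (\<forall>y. blinfun_apply Q (blinfun_apply Q y) = blinfun_apply Q y) \<and>
      finite_rank t t (2 * m (k + 1)) Q \<and> norm Q \<le> G k" for k P Q
  define linked where "linked k P Q P' Q' A B \<longleftrightarrow>
      (\<forall>x. blinfun_apply P' (blinfun_apply P x) = blinfun_apply P x) \<and>
      (\<forall>x. blinfun_apply P (blinfun_apply P' x) = blinfun_apply P x) \<and> P' \<noteq> P \<and>
      (\<forall>y. blinfun_apply Q' (blinfun_apply Q y) = blinfun_apply Q y) \<and>
      (\<forall>y. blinfun_apply Q (blinfun_apply Q' y) = blinfun_apply Q y) \<and>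
      blinfun_apply Q' (v k) = v k \<and> A \<in> L s t \<and> B \<in> L t s \<and>
      (\<forall>x. blinfun_apply Q' (blinfun_apply A x) = blinfun_apply A x) \<and>
      (\<forall>x. blinfun_apply Q (blinfun_apply A x) = 0) \<and>
      (\<forall>y. blinfun_apply B (blinfun_apply Q' y) = blinfun_apply B y) \<and>
      (\<forall>y. blinfun_apply B (blinfun_apply Q y) = 0) \<and>
      (\<forall>x. blinfun_apply B (blinfun_apply A (blinfun_apply (P' - P) x)) = blinfun_apply (P' - P) x) \<and>
      norm A * norm B \<le> 2 * f k * (G (Suc k))\<^sup>2 * (C\<^sup>2 * r k)" for k P Q P' Q' A B
  have step: "\<exists>P' Q'. good (Suc k) P' Q' \<and> (\<exists>A B. linked k P Q P' Q' A B)" if PQ: "good k P Q" for k P Q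
  proof -
    have P: "P \<in> L s s" "\<And>x. blinfun_apply P (blinfun_apply P x) = blinfun_apply P x"
        "finite_rank s s (m (k + 1)) P" "1 + norm P \<le> c ^ k"
      and Q: "Q \<in> L t t" "\<And>y. blinfun_apply Q (blinfun_apply Q y) = blinfun_apply Q y"
        "finite_rank t t (2 * m (k + 1)) Q" "norm Q \<le> G k"
      using PQ unfolding good_def by auto
    have Sk: "S (Suc k) \<in> L s s" "finite_rank s s (m (k + 1)) (S (Suc k))"
      using S0 by (simp_all add: S_def)
    obtain u where u: "blinfun_apply P u \<noteq> u"
      using property_D_finite_rank_neq_id[OF X D_X x0 P(1,3)] by blast
    have dims: "m (k + 1) + m (k + 1) + 1 \<le> 4 * m (k + 1)" "2 * m (k + 1) + 1 \<le> 4 * m (k + 1)"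
      using m1[of "k + 1"] by auto
    define q where "q = (1 + C) * (1 + 2 * norm Q) + C"
    have q: "q + D * q powr d \<le> G (Suc k)" "q * (D * q powr d) \<le> (G (Suc k))\<^sup>2"
      using G_bounds(4)[OF norm_ge_zero Q(4) q_def] by auto
    obtain P' Q' A B where P': "P' \<in> L s s"
        "\<And>x. blinfun_apply P' (blinfun_apply P' x) = blinfun_apply P' x"
        "\<And>x. blinfun_apply P' (blinfun_apply P x) = blinfun_apply P x"
        "\<And>x. blinfun_apply P (blinfun_apply P' x) = blinfun_apply P x"
        "finite_rank s s (m (k + 2)) P'" "1 + norm P' \<le> (1 + C) * (1 + norm P)"
        "\<And>x. blinfun_apply (S (Suc k)) (blinfun_apply P' x) = blinfun_apply (S (Suc k)) x"
        "P' \<noteq> P"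
      and Q': "Q' \<in> L t t" "\<And>x. blinfun_apply Q' (blinfun_apply Q' x) = blinfun_apply Q' x"
        "\<And>x. blinfun_apply Q' (blinfun_apply Q x) = blinfun_apply Q x"
        "\<And>x. blinfun_apply Q (blinfun_apply Q' x) = blinfun_apply Q x"
        "finite_rank t t (2 * m (k + 2)) Q'" "norm Q' \<le> q + D * q powr d"
        "blinfun_apply Q' (v k) = v k"
      and AB: "A \<in> L s t" "B \<in> L t s"
        "\<And>x. blinfun_apply Q' (blinfun_apply A x) = blinfun_apply A x"
        "\<And>x. blinfun_apply Q (blinfun_apply A x) = 0"
        "\<And>x. blinfun_apply B (blinfun_apply Q' x) = blinfun_apply B x"
        "\<And>x. blinfun_apply B (blinfun_apply Q x) = 0"
        "\<And>x. blinfun_apply B (blinfun_apply A (blinfun_apply (P' - P) x)) = blinfun_apply (P' - P) x"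
        "norm A * norm B \<le> 2 * f\<^sub>Y (m (k + 2)) * q * (D * q powr d) * (C\<^sup>2 * r k)"
      by (rule factorization_step[OF X Y reflexive C d D(2) D_Y r(2)[unfolded ld_def] P(1-3) Q(1-3)
            Sk dims K_le u m1, of "v k", folded q_def]) (rule that; assumption)
    have "norm A * norm B \<le> 2 * f k * (q * (D * q powr d)) * (C\<^sup>2 * r k)"
      using AB(8) by (simp add: f_def mult_ac)
    also have "\<dots> \<le> 2 * f k * (G (Suc k))\<^sup>2 * (C\<^sup>2 * r k)"
      using f_pos[of k] r(1)[of k] by (intro mult_right_mono mult_left_mono q) auto
    finally have "linked k P Q P' Q' A B"
      unfolding linked_def using P' Q' AB by blast
    moreover have "1 + norm P' \<le> c ^ Suc k"
    proof -
      note P'(6)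
      also have "(1 + C) * (1 + norm P) \<le> (1 + C) * c ^ k"
        using P(4) C by (intro mult_left_mono) auto
      finally show ?thesis
        by (simp add: c_def)
    qed
    then have "good (Suc k) P' Q'"
      unfolding good_def using P' Q' q(1) by simp
    ultimately show ?thesis
      by blast
  qed
  have base: "good 0 0 0"
    using G1[of 0] by (simp add: good_def S_def s.L_zero t.L_zero s.finite_rank_zero t.finite_rank_zero)
  have "\<exists>PQ. \<forall>k. good k (fst (PQ k)) (snd (PQ k)) \<and>
      (\<exists>A B. linked k (fst (PQ k)) (snd (PQ k)) (fst (PQ (Suc k))) (snd (PQ (Suc k))) A B)"
  proof (rule dependent_nat_choice)
    show "\<exists>PQ. good 0 (fst PQ) (snd PQ)"
      using base by (intro exI[of _ "(0, 0)"]) simp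
    show "\<exists>PQ'. good (Suc k) (fst PQ') (snd PQ') \<and>
        (\<exists>A B. linked k (fst PQ) (snd PQ) (fst PQ') (snd PQ') A B)"
      if "good k (fst PQ) (snd PQ)" for PQ k
      using step[OF that] by (metis fst_conv snd_conv)
  qed
  then obtain PQ where "\<And>k. good k (fst (PQ k)) (snd (PQ k)) \<and>
      (\<exists>A B. linked k (fst (PQ k)) (snd (PQ k)) (fst (PQ (Suc k))) (snd (PQ (Suc k))) A B)"
    by blast
  then obtain P Q where PQ: "\<And>k. good k (P k) (Q k)"
    and "\<And>k. \<exists>A B. linked k (P k) (Q k) (P (Suc k)) (Q (Suc k)) A B"
    using that[of "\<lambda>k. fst (PQ k)" "\<lambda>k. snd (PQ k)"] by blast
  then obtain A B where AB: "\<And>k. linked k (P k) (Q k) (P (Suc k)) (Q (Suc k)) (A k) (B k)"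
    by metis
  note PQ = PQ[unfolded good_def] and AB = AB[unfolded linked_def]
  have small: "norm (A k) * norm (B k) * e k * (8 * c ^ 3) ^ k \<le> M" for k
  proof -
    have c1: "1 \<le> c"
      using C by (simp add: c_def)
    have "norm (A k) * norm (B k) * (e k * (8 * c ^ 3) ^ k) \<le>
        (2 * f k * (G (Suc k))\<^sup>2 * (C\<^sup>2 * r k)) * (e k * (8 * c ^ 3) ^ k)"
      using AB[of k] e(1)[of k] c1 by (intro mult_right_mono) auto
    also have "\<dots> = f k * r k * e k * ((G (Suc k))\<^sup>2 * (2 * C\<^sup>2 * (8 * c ^ 3) ^ k))"
      by simp
    also have "\<dots> \<le> f k * r k * e k * ((G (k + 2))\<^sup>2 * G (k + 2) ^ 3)"
    proof (intro mult_left_mono mult_mono)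
      have G_le: "G (Suc k) \<le> G (k + 2)"
        using G_bounds(2)[of "Suc k"] by simp
      then show "(G (Suc k))\<^sup>2 \<le> (G (k + 2))\<^sup>2"
        using G_pos[of "Suc k"] by (intro power_mono) auto
      have "2 * C\<^sup>2 \<le> (2 * c)\<^sup>2"
        using C by (simp add: c_def power2_eq_square algebra_simps)
      also have "\<dots> \<le> \<gamma>\<^sup>2"
        using \<gamma> c1 by (intro power_mono) auto
      also have "\<dots> \<le> \<gamma> ^ 6"
        using \<gamma>(2) by (intro power_increasing) auto
      finally have "2 * C\<^sup>2 \<le> \<gamma> ^ 6" .
      moreover have "((2 * c) ^ 3) ^ k \<le> (\<gamma> ^ 3) ^ k"
        using \<gamma> c1 by (intro power_mono) auto
      then have "(8 * c ^ 3) ^ k \<le> (\<gamma> ^ 3) ^ k"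
        by (simp add: power_mult_distrib)
      ultimately have "2 * C\<^sup>2 * (8 * c ^ 3) ^ k \<le> \<gamma> ^ 6 * (\<gamma> ^ 3) ^ k"
        using c1 \<gamma>(2) by (intro mult_mono) auto
      also have "\<dots> = (\<gamma> ^ (k + 2)) ^ 3"
        by (simp flip: power_add power_mult add: algebra_simps)
      also have "\<dots> \<le> (G (k + 2)) ^ 3"
        using G_bounds(1)[of "Suc k"] G_le \<gamma>(2) by (intro power_mono) auto
      finally show "2 * C\<^sup>2 * (8 * c ^ 3) ^ k \<le> G (k + 2) ^ 3" .
    qed (use f_pos[of k] r(1)[of k] e(1)[of k] c1 in auto)
    also have "\<dots> = f k * r k * e k * G (k + 2) ^ 5"
      by (simp flip: power_add)
    also have "\<dots> \<le> M"
      by (rule cost)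
    finally show ?thesis
      by (simp add: mult.assoc)
  qed
  show ?thesis
  proof (rule dense_compact_factorization[OF X Y T(1), where P = P and Q = Q and A = A and B = B
        and S = S and e = e and v = v and c = c and M = M])
    show "2 \<le> c"
      using C by (simp add: c_def)
    show "\<exists>r. finite_rank s s r (P k)" for k
      using PQ by blast
  qed (use PQ AB v e small in auto)
qed

end
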